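(* Let $(X,g,\mu_g)$ be a $2$-parabolic admissible Riemannian polyhedron (with $\partial X=\emptyset$). Suppose $f\in W^{1,2}_{\mathrm{loc}}(X)$ is a positive, continuous (weakly) superharmonic function on $X$. Then $f$ is constant.
   Context: Riemannian polyhedra. A polyhedron is a connected locally compact separable Hausdorff space $X$ homeomorphic, via some $\theta:|K|\to X$, to the space $|K|$ of a countable, locally finite simplicial complex $K$ of finite dimension; $(K,\theta)$ is a triangulation. $|K|$ carries the barycentric distance $\rho(\alpha,\beta)=(\sum_v(\alpha(v)-\beta(v))^2)^{1/2}$ and is affinely Lipschitz-homeomorphically embedded as a closed subset of a Euclidean space. $X$ is a Lipschitz polyhedron if it is a metric space and $\theta$ is a Lipschitz homeomorphism. A Riemannian polyhedron is a Lipschitz polyhedron $X$ such that, for some triangulation, each maximal simplex $s$ (viewed in the Euclidean space) carries a measurable Riemannian metric $g^s=g_{ij}dx^idx^j$ with $\Lambda^{-2}\|\xi\|^2\le g_{ij}(x)\xi^i\xi^j\le\Lambda^2\|\xi\|^2$ for a.e. $x\in s$, with $\Lambda$ independent of $s$. $d_X=d_X^g$ is the associated intrinsic distance: $d_X^g(x,y)$ is the supremum, over null sets $Z$, of the infimum of $g$-lengths of Lipschitz paths from $x$ to $y$ meeting $Z$ only on a parameter set of measure zero. The volume measure $\mu_g$ is given simplexwise by $d\mu_g=\sqrt{\det(g_{ij})}\,dx_1\cdots dx_n$. $X^{k}$ denotes the $k$-skeleton. Admissible: in some (hence any) triangulation, all maximal simplexes have the same dimension $n=\dim X$, and for every connected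 open $U\subset X$ the set $U\setminus X^{n-2}$ is connected. $\partial X$ is the union of all non-maximal simplexes contained in only one maximal simplex; it is always assumed that $\partial X=\emptyset$. Sobolev spaces. $W^{1,2}(X)$ is the completion of the space of Lipschitz functions $u:(X,d_X)\to\mathbb R$ with finite norm $\|u\|_{1,2}^2=\int_X(u^2+|\nabla u|^2)\,d\mu_g$, where $\nabla u$ is the Riemannian gradient, defined a.e. on each $n$-simplex. $\mathrm{Lip}_c(X)$: Lipschitz functions with compact support. $W_0^{1,2}(X)$: closure of $\mathrm{Lip}_c(X)$ in $W^{1,2}(X)$ (similarly for domains). $W^{1,2}_{\mathrm{loc}}(X)$: all $u\in L^2_{\mathrm{loc}}(X)$ with $u\in W^{1,2}(U)$ for all relatively compact subdomains $U\subset X$. $f\in W^{1,2}_{\mathrm{loc}}(X)$ is (weakly) superharmonic if $\int_X\langle\nabla f,\nabla\rho\rangle\,d\mu_g\ge 0$ for every non-negative $\rho\in\mathrm{Lip}_c(X)$. $2$-parabolicity. For $E\subset\Omega$, $\mathrm{cap}(E,\Omega)=\inf\int_\Omega|\nabla u|^2\,d\mu_g$ over $u\in W^{1,2}_0(\Omega)$ with $u\ge1$ on $E$ (equivalently, over such $u$ with $u\le1$ and $u=1$ on a neighborhood of $E$). A domain (connected open set) $\Omega\subset X$ is $2$-parabolic if $\mathrm{cap}(D,\Omega)=0$ for every compact $D\subset\Omega$; $X$ is $2$-parabolic if this holds with $\Omega=X$. *)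

theory Defs
  imports "HOL-Analysis.Analysis"
begin

section \<open>Simplicial complexes and their realization\<close>

text \<open>An abstract simplicial complex is given by the vertex sets of its simplexes.\<close>

definition abstract_complex :: "'v set set \<Rightarrow> bool" where
  "abstract_complex K \<longleftrightarrow>
     (\<forall>s\<in>K. finite s \<and> s \<noteq> {}) \<and>
     (\<forall>s\<in>K. \<forall>t. t \<subseteq> s \<and> t \<noteq> {} \<longrightarrow> t \<in> K)"

definition locally_finite_complex :: "'v set set \<Rightarrow> bool" where
  "locally_finite_complex K \<longleftrightarrow> (\<forall>v. finite {s \<in> K. v \<in> s})"

definition finite_dimensional_complex :: "'v set set \<Rightarrow> bool" where
  "finite_dimensional_complex K \<longleftrightarrow> (\<exists>d. \<forall>s\<in>K. card s \<le> d + 1)"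

definition maximal_simplexes :: "'v set set \<Rightarrow> 'v set set" where
  "maximal_simplexes K = {s \<in> K. \<forall>t\<in>K. s \<subseteq> t \<longrightarrow> t = s}"

definition supp :: "('v \<Rightarrow> real) \<Rightarrow> 'v set" where
  "supp \<alpha> = {v. \<alpha> v \<noteq> 0}"

text \<open>Points of the space of \<open>K\<close> are families of barycentric coordinates.\<close>

definition realization :: "'v set set \<Rightarrow> ('v \<Rightarrow> real) set" where
  "realization K = {\<alpha>. supp \<alpha> \<in> K \<and> (\<forall>v. 0 \<le> \<alpha> v) \<and> (\<Sum>v\<in>supp \<alpha>. \<alpha> v) = 1}"

definition barycentric_dist :: "('v \<Rightarrow> real) \<Rightarrow> ('v \<Rightarrow> real) \<Rightarrow> real" where
  "barycentric_dist \<alpha> \<beta> = sqrt (\<Sum>v\<in>supp \<alpha> \<union> supp \<beta>. (\<alpha> v - \<beta> v)\<^sup>2)"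

definition affine_map :: "('v \<Rightarrow> 'e) \<Rightarrow> ('v \<Rightarrow> real) \<Rightarrow> 'e::real_vector" where
  "affine_map p \<alpha> = (\<Sum>v\<in>supp \<alpha>. \<alpha> v *\<^sub>R p v)"

text \<open>Lipschitz homeomorphisms are understood locally. A global Lipschitz condition could not be
  meant: the barycentric distance is bounded, so the space of an infinite complex has no globally
  bi-Lipschitz embedding onto a closed subset of a Euclidean space.\<close>

definition locally_lipschitz ::
  "'p set \<Rightarrow> ('p \<Rightarrow> 'p \<Rightarrow> real) \<Rightarrow> ('q \<Rightarrow> 'q \<Rightarrow> real) \<Rightarrow> ('p \<Rightarrow> 'q) \<Rightarrow> bool" where
  "locally_lipschitz A d d' f \<longleftrightarrow>
     (\<forall>a\<in>A. \<exists>r>0. \<exists>L. \<forall>x\<in>A. \<forall>y\<in>A. d a x < r \<and> d a y < r \<longrightarrow> d' (f x) (f y) \<le> L * d x y)"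

definition lipschitz_homeomorphism ::
  "'p set \<Rightarrow> ('p \<Rightarrow> 'p \<Rightarrow> real) \<Rightarrow> 'q set \<Rightarrow> ('q \<Rightarrow> 'q \<Rightarrow> real) \<Rightarrow> ('p \<Rightarrow> 'q) \<Rightarrow> bool" where
  "lipschitz_homeomorphism A d B d' f \<longleftrightarrow>
     bij_betw f A B \<and> locally_lipschitz A d d' f \<and> locally_lipschitz B d' d (inv_into A f)"

section \<open>Riemannian polyhedra\<close>

text \<open>The polyhedron \<open>X\<close> is the whole metric type \<open>'a\<close>. The data are: a complex \<open>cplx\<close>; a
  triangulation \<open>tri\<close> from its space to \<open>X\<close>; the positions \<open>vpos\<close> of the vertices in a Euclidean
  space \<open>'e\<close>, inducing an affine embedding of the space of the complex; and for every maximal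
  simplex \<open>s\<close> Euclidean coordinates \<open>euc s\<close> on the affine hull of \<open>s\<close> in \<open>'e\<close> together with the
  matrix \<open>gmat s x\<close> of coefficients \<open>g_ij(x)\<close> in these coordinates. All maximal simplexes will have
  the dimension \<open>CARD('n)\<close>.\<close>

record ('v, 'a, 'e, 'n::finite) triangulated_polyhedron =
  cplx :: "'v set set"
  tri :: "('v \<Rightarrow> real) \<Rightarrow> 'a"
  vpos :: "'v \<Rightarrow> 'e"
  euc :: "'v set \<Rightarrow> real^'n \<Rightarrow> 'e"
  gmat :: "'v set \<Rightarrow> real^'n \<Rightarrow> real^'n^'n"

abbreviation max_simplexes ::
  "('v, 'a, 'e, 'n::finite) triangulated_polyhedron \<Rightarrow> 'v set set" where
  "max_simplexes P \<equiv> maximal_simplexes (cplx P)"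

text \<open>A connected Lipschitz polyhedron. Local compactness and separability of \<open>X\<close> are
  consequences of the triangulation by a countable locally finite complex.\<close>

definition lipschitz_polyhedron ::
  "('v, 'a::metric_space, 'e::euclidean_space, 'n::finite) triangulated_polyhedron \<Rightarrow> bool" where
  "lipschitz_polyhedron P \<longleftrightarrow>
     connected (UNIV :: 'a set) \<and>
     abstract_complex (cplx P) \<and> countable (cplx P) \<and>
     locally_finite_complex (cplx P) \<and> finite_dimensional_complex (cplx P) \<and>
     lipschitz_homeomorphism (realization (cplx P)) barycentric_dist UNIV dist (tri P)"

definition euclidean_embedded ::
  "('v, 'a::metric_space, 'e::euclidean_space, 'n::finite) triangulated_polyhedron \<Rightarrow> bool" where
  "euclidean_embedded P \<longleftrightarrow>
     (let E = affine_map (vpos P) ` realization (cplx P) in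
        closed E \<and>
        lipschitz_homeomorphism (realization (cplx P)) barycentric_dist E dist
          (affine_map (vpos P)))"

text \<open>The maximal simplex \<open>s\<close> in its Euclidean coordinates.\<close>

definition coord_simplex ::
  "('v, 'a, 'e::euclidean_space, 'n::finite) triangulated_polyhedron \<Rightarrow> 'v set \<Rightarrow> (real^'n) set"
  where "coord_simplex P s = {x. euc P s x \<in> convex hull (vpos P ` s)}"

definition riemannian_polyhedron ::
  "('v, 'a::metric_space, 'e::euclidean_space, 'n::finite) triangulated_polyhedron \<Rightarrow> bool" where
  "riemannian_polyhedron P \<longleftrightarrow>
     lipschitz_polyhedron P \<and> euclidean_embedded P \<and>
     (\<forall>s\<in>max_simplexes P.
        (\<forall>x y. dist (euc P s x) (euc P s y) = dist x y) \<and>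
        range (euc P s) = affine hull (vpos P ` s) \<and>
        gmat P s \<in> borel_measurable (lebesgue_on (coord_simplex P s))) \<and>
     (\<exists>\<Lambda>>0. \<forall>s\<in>max_simplexes P. AE x in lebesgue_on (coord_simplex P s).
        transpose (gmat P s x) = gmat P s x \<and>
        (\<forall>\<xi>. inverse (\<Lambda>\<^sup>2) * (norm \<xi>)\<^sup>2 \<le> \<xi> \<bullet> (gmat P s x *v \<xi>) \<and>
             \<xi> \<bullet> (gmat P s x *v \<xi>) \<le> \<Lambda>\<^sup>2 * (norm \<xi>)\<^sup>2))"

definition bary :: "('v, 'a, 'e, 'n::finite) triangulated_polyhedron \<Rightarrow> 'a \<Rightarrow> 'v \<Rightarrow> real" where
  "bary P = inv_into (realization (cplx P)) (tri P)"

definition closed_cell :: "('v, 'a, 'e, 'n::finite) triangulated_polyhedron \<Rightarrow> 'v set \<Rightarrow> 'a set" where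
  "closed_cell P t = tri P ` {\<alpha> \<in> realization (cplx P). supp \<alpha> \<subseteq> t}"

definition skeleton :: "('v, 'a, 'e, 'n::finite) triangulated_polyhedron \<Rightarrow> int \<Rightarrow> 'a set" where
  "skeleton P k = (\<Union>t\<in>{t \<in> cplx P. int (card t) \<le> k + 1}. closed_cell P t)"

definition admissible ::
  "('v, 'a::metric_space, 'e::euclidean_space, 'n::finite) triangulated_polyhedron \<Rightarrow> bool" where
  "admissible P \<longleftrightarrow>
     (\<forall>s\<in>max_simplexes P. card s = CARD('n) + 1) \<and>
     (\<forall>U. open U \<and> connected U \<longrightarrow> connected (U - skeleton P (int CARD('n) - 2)))"

definition polyhedron_boundary ::
  "('v, 'a, 'e, 'n::finite) triangulated_polyhedron \<Rightarrow> 'a set" where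
  "polyhedron_boundary P =
     (\<Union>t\<in>{t \<in> cplx P. t \<notin> max_simplexes P \<and> (\<exists>!s. s \<in> max_simplexes P \<and> t \<subseteq> s)}.
        closed_cell P t)"

section \<open>Volume and intrinsic distance\<close>

text \<open>Integration takes place on the disjoint union of the maximal simplexes in their coordinates:
  distinct maximal simplexes only overlap in lower-dimensional faces, which are null sets. Its
  points are pairs \<open>(s, x)\<close>; \<open>pt P (s, x)\<close> is the corresponding point of \<open>X\<close>. Vector fields are
  functions of \<open>(s, x)\<close>, given by their components in the coordinates on \<open>s\<close>.\<close>

definition pt ::
  "('v, 'a, 'e::euclidean_space, 'n::finite) triangulated_polyhedron \<Rightarrow> 'v set \<times> (real^'n) \<Rightarrow> 'a" where
  "pt P = (\<lambda>(s, x). tri P (inv_into (realization (cplx P)) (affine_map (vpos P)) (euc P s x)))"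

definition over ::
  "('v, 'a, 'e::euclidean_space, 'n::finite) triangulated_polyhedron \<Rightarrow> 'a set \<Rightarrow>
     ('v set \<times> (real^'n)) set" where
  "over P U = {(s, x). s \<in> max_simplexes P \<and> x \<in> coord_simplex P s \<and> pt P (s, x) \<in> U}"

definition vol ::
  "('v, 'a, 'e::euclidean_space, 'n::finite) triangulated_polyhedron \<Rightarrow>
     ('v set \<times> (real^'n)) measure" where
  "vol P = density (restrict_space (count_space (max_simplexes P) \<Otimes>\<^sub>M lebesgue) (over P UNIV))
             (\<lambda>(s, x). ennreal (sqrt (det (gmat P s x))))"

abbreviation vol_on ::
  "('v, 'a, 'e::euclidean_space, 'n::finite) triangulated_polyhedron \<Rightarrow> 'a set \<Rightarrow>
     ('v set \<times> (real^'n)) measure" where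
  "vol_on P U \<equiv> restrict_space (vol P) (over P U)"

definition ginner ::
  "('v, 'a, 'e, 'n::finite) triangulated_polyhedron \<Rightarrow> 'v set \<times> (real^'n) \<Rightarrow>
     real^'n \<Rightarrow> real^'n \<Rightarrow> real" where
  "ginner P = (\<lambda>(s, x) \<xi> \<eta>. \<xi> \<bullet> (gmat P s x *v \<eta>))"

text \<open>The coordinates with respect to \<open>s\<close> of a point of \<open>X\<close> in the simplex \<open>s\<close>.\<close>

definition loc ::
  "('v, 'a, 'e::euclidean_space, 'n::finite) triangulated_polyhedron \<Rightarrow> 'v set \<Rightarrow> 'a \<Rightarrow> real^'n" where
  "loc P s q = inv (euc P s) (affine_map (vpos P) (bary P q))"

text \<open>The speed is set to zero on the union of the non-maximal simplexes, where no metric is given.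
  This does not affect the distance below, because its supremum may be restricted to null sets
  containing these simplexes.\<close>

definition gspeed ::
  "('v, 'a, 'e::euclidean_space, 'n::finite) triangulated_polyhedron \<Rightarrow> (real \<Rightarrow> 'a) \<Rightarrow>
     real \<Rightarrow> real" where
  "gspeed P \<gamma> t =
     (let s = supp (bary P (\<gamma> t));
          w = vector_derivative (\<lambda>\<tau>. loc P s (\<gamma> \<tau>)) (at t)
      in if s \<in> max_simplexes P then sqrt (ginner P (s, loc P s (\<gamma> t)) w w) else 0)"

definition glength ::
  "('v, 'a, 'e::euclidean_space, 'n::finite) triangulated_polyhedron \<Rightarrow> (real \<Rightarrow> 'a) \<Rightarrow> ennreal" where
  "glength P \<gamma> = (\<integral>\<^sup>+t. ennreal (gspeed P \<gamma> t) \<partial>lebesgue_on {0..1})"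

definition transversal_paths :: "'a::metric_space set \<Rightarrow> 'a \<Rightarrow> 'a \<Rightarrow> (real \<Rightarrow> 'a) set" where
  "transversal_paths Z x y =
     {\<gamma>. (\<exists>L. L-lipschitz_on {0..1} \<gamma>) \<and> \<gamma> 0 = x \<and> \<gamma> 1 = y \<and>
         {t \<in> {0..1}. \<gamma> t \<in> Z} \<in> null_sets lebesgue}"

definition intrinsic_dist ::
  "('v, 'a::metric_space, 'e::euclidean_space, 'n::finite) triangulated_polyhedron \<Rightarrow>
     'a \<Rightarrow> 'a \<Rightarrow> ennreal" where
  "intrinsic_dist P x y =
     (SUP Z\<in>{Z. over P Z \<in> null_sets (vol P)}. INF \<gamma>\<in>transversal_paths Z x y. glength P \<gamma>)"

section \<open>Sobolev spaces\<close>

definition lipschitz_functions ::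
  "('v, 'a::metric_space, 'e::euclidean_space, 'n::finite) triangulated_polyhedron \<Rightarrow>
     'a set \<Rightarrow> ('a \<Rightarrow> real) set" where
  "lipschitz_functions P U =
     {u. \<exists>L. \<forall>x\<in>U. \<forall>y\<in>U. ennreal \<bar>u x - u y\<bar> \<le> ennreal L * intrinsic_dist P x y}"

definition lip_c ::
  "('v, 'a::metric_space, 'e::euclidean_space, 'n::finite) triangulated_polyhedron \<Rightarrow>
     'a set \<Rightarrow> ('a \<Rightarrow> real) set" where
  "lip_c P U =
     {u \<in> lipschitz_functions P U. compact (closure {x. u x \<noteq> 0}) \<and> closure {x. u x \<noteq> 0} \<subseteq> U}"

text \<open>In coordinates the Riemannian gradient is \<open>g^ij \<partial>_j u\<close>. For Lipschitz \<open>u\<close> the partial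
  derivatives exist almost everywhere; the values elsewhere are irrelevant.\<close>

definition grad ::
  "('v, 'a, 'e::euclidean_space, 'n::finite) triangulated_polyhedron \<Rightarrow> ('a \<Rightarrow> real) \<Rightarrow>
     'v set \<times> (real^'n) \<Rightarrow> real^'n" where
  "grad P u = (\<lambda>(s, x).
     matrix_inv (gmat P s x) *v (\<chi> j. deriv (\<lambda>t. u (pt P (s, x + t *\<^sub>R axis j 1))) 0))"

definition sobolev_norm2 ::
  "('v, 'a, 'e::euclidean_space, 'n::finite) triangulated_polyhedron \<Rightarrow> 'a set \<Rightarrow>
     ('a \<Rightarrow> real) \<Rightarrow> ('v set \<times> (real^'n) \<Rightarrow> real^'n) \<Rightarrow> ennreal" where
  "sobolev_norm2 P U u G =
     (\<integral>\<^sup>+q. ennreal ((u (pt P q))\<^sup>2 + ginner P q (G q) (G q)) \<partial>vol_on P U)"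

text \<open>\<open>u\<close> and \<open>G\<close> are the limits, in \<open>L\<^sup>2(U)\<close>, of a sequence of functions in the class \<open>A\<close> and of
  their gradients. The elements of the completion of a class of Lipschitz functions are realized
  by such pairs; \<open>u\<close> determines \<open>G\<close> almost everywhere.\<close>

definition sobolev_limit ::
  "('v, 'a, 'e::euclidean_space, 'n::finite) triangulated_polyhedron \<Rightarrow> 'a set \<Rightarrow>
     ('a \<Rightarrow> real) set \<Rightarrow> ('a \<Rightarrow> real) \<Rightarrow> ('v set \<times> (real^'n) \<Rightarrow> real^'n) \<Rightarrow> bool" where
  "sobolev_limit P U A u G \<longleftrightarrow>
     (\<lambda>q. u (pt P q)) \<in> borel_measurable (vol_on P U) \<and>
     G \<in> borel_measurable (vol_on P U) \<and>
     (\<exists>w. (\<forall>k. w k \<in> A) \<and>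
        (\<lambda>k. sobolev_norm2 P U (\<lambda>y. w k y - u y) (\<lambda>q. grad P (w k) q - G q)) \<longlonglongrightarrow> 0)"

definition has_grad ::
  "('v, 'a::metric_space, 'e::euclidean_space, 'n::finite) triangulated_polyhedron \<Rightarrow> 'a set \<Rightarrow>
     ('a \<Rightarrow> real) \<Rightarrow> ('v set \<times> (real^'n) \<Rightarrow> real^'n) \<Rightarrow> bool" where
  "has_grad P U u G \<longleftrightarrow>
     sobolev_limit P U {w \<in> lipschitz_functions P U. sobolev_norm2 P U w (grad P w) < \<infinity>} u G"

definition W12 ::
  "('v, 'a::metric_space, 'e::euclidean_space, 'n::finite) triangulated_polyhedron \<Rightarrow> 'a set \<Rightarrow>
     ('a \<Rightarrow> real) set" where
  "W12 P U = {u. \<exists>G. has_grad P U u G}"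

definition has_grad0 ::
  "('v, 'a::metric_space, 'e::euclidean_space, 'n::finite) triangulated_polyhedron \<Rightarrow> 'a set \<Rightarrow>
     ('a \<Rightarrow> real) \<Rightarrow> ('v set \<times> (real^'n) \<Rightarrow> real^'n) \<Rightarrow> bool" where
  "has_grad0 P U u G \<longleftrightarrow> sobolev_limit P U (lip_c P U) u G"

definition relatively_compact_domain :: "'a::metric_space set \<Rightarrow> bool" where
  "relatively_compact_domain U \<longleftrightarrow> open U \<and> connected U \<and> compact (closure U)"

definition L2_loc ::
  "('v, 'a::metric_space, 'e::euclidean_space, 'n::finite) triangulated_polyhedron \<Rightarrow>
     ('a \<Rightarrow> real) set" where
  "L2_loc P =
     {u. \<forall>C. compact C \<longrightarrow>
        (\<lambda>q. u (pt P q)) \<in> borel_measurable (vol_on P C) \<and>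
        (\<integral>\<^sup>+q. ennreal ((u (pt P q))\<^sup>2) \<partial>vol_on P C) < \<infinity>}"

definition W12_loc ::
  "('v, 'a::metric_space, 'e::euclidean_space, 'n::finite) triangulated_polyhedron \<Rightarrow>
     ('a \<Rightarrow> real) set" where
  "W12_loc P = {u \<in> L2_loc P. \<forall>U. relatively_compact_domain U \<longrightarrow> u \<in> W12 P U}"

definition has_grad_loc ::
  "('v, 'a::metric_space, 'e::euclidean_space, 'n::finite) triangulated_polyhedron \<Rightarrow>
     ('a \<Rightarrow> real) \<Rightarrow> ('v set \<times> (real^'n) \<Rightarrow> real^'n) \<Rightarrow> bool" where
  "has_grad_loc P u G \<longleftrightarrow> (\<forall>U. relatively_compact_domain U \<longrightarrow> has_grad P U u G)"

text \<open>The gradient \<open>G\<close> of \<open>f\<close> exists for \<open>f \<in> W12_loc P\<close> and is unique up to null sets.\<close>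

definition weakly_superharmonic ::
  "('v, 'a::metric_space, 'e::euclidean_space, 'n::finite) triangulated_polyhedron \<Rightarrow>
     ('a \<Rightarrow> real) \<Rightarrow> bool" where
  "weakly_superharmonic P f \<longleftrightarrow> f \<in> W12_loc P \<and>
     (\<exists>G. has_grad_loc P f G \<and>
        (\<forall>\<rho>\<in>lip_c P UNIV. (\<forall>x. 0 \<le> \<rho> x) \<longrightarrow>
           0 \<le> (\<integral>q. ginner P q (G q) (grad P \<rho> q) \<partial>vol P)))"

section \<open>Capacity\<close>

text \<open>Elements of the Sobolev space are determined only almost everywhere. The condition that \<open>u\<close>
  is at least 1 on \<open>E\<close> is therefore expressed in its standard equivalent form: \<open>u \<le> 1\<close>, and
  \<open>u = 1\<close> on a neighbourhood of \<open>E\<close>.\<close>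

definition capacity ::
  "('v, 'a::metric_space, 'e::euclidean_space, 'n::finite) triangulated_polyhedron \<Rightarrow> 'a set \<Rightarrow>
     'a set \<Rightarrow> ennreal" where
  "capacity P E \<Omega> =
     (INF (u, G)\<in>{(u, G). has_grad0 P \<Omega> u G \<and> (AE q in vol_on P \<Omega>. u (pt P q) \<le> 1) \<and>
                  (\<exists>V. open V \<and> E \<subseteq> V \<and> V \<subseteq> \<Omega> \<and> (AE q in vol_on P V. u (pt P q) = 1))}.
        \<integral>\<^sup>+q. ennreal (ginner P q (G q) (G q)) \<partial>vol_on P \<Omega>)"

definition two_parabolic ::
  "('v, 'a::metric_space, 'e::euclidean_space, 'n::finite) triangulated_polyhedron \<Rightarrow> 'a set \<Rightarrow>
     bool" where
  "two_parabolic P \<Omega> \<longleftrightarrow> (\<forall>D. compact D \<and> D \<subseteq> \<Omega> \<longrightarrow> capacity P D \<Omega> = 0)"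

end

theory Submission
  imports Defs
begin

text \<open>
  The proof is the logarithmic Caccioppoli estimate. Testing superharmonicity of \<open>f\<close> with
  \<open>(sin \<eta>)\<^sup>2 (\<pi>/2 - arctan f)\<close> for a Lipschitz cutoff \<open>\<eta>\<close> bounds
  \<open>\<integral> (sin \<eta>)\<^sup>2 |\<nabla>f|\<^sup>2 / (1 + f\<^sup>2)\<close> by a multiple of \<open>\<integral> |\<nabla>\<eta>|\<^sup>2\<close>. The functions \<open>sin\<close> and
  \<open>\<pi>/2 - arctan\<close> replace the identity and \<open>1/f\<close> of the classical test function: they are smooth,
  bounded and Lipschitz on the whole line, so no truncation is needed when \<open>f\<close> is replaced by its
  Lipschitz approximations. Vanishing capacity provides cutoffs of arbitrarily small energy that tend
  to 1 on a given compact set, hence \<open>\<nabla>f = 0\<close> almost everywhere. A continuous Sobolev function with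
  vanishing gradient is constant on every maximal simplex, and, since open stars of vertices are
  unions of pieces of closed simplexes through the vertex, locally constant on the connected space \<open>X\<close>.
\<close>

text \<open>Superharmonicity is tested only with Lipschitz functions of compact support, while
  \<open>f\<close> is merely a continuous Sobolev function. The test function is therefore built
  from Lipschitz approximations \<open>w k\<close> of \<open>f\<close>, which may be negative
  somewhere and are Lipschitz only on a relatively compact domain. Pairing the gradient of
  \<open>f\<close> with that of \<open>w k\<close> leaves an error controlled by the L2 distance of
  the two gradients. Likewise the cutoffs only approximate a capacity competitor: they need neither
  stay below 1 nor equal 1 on the compact set. A second obstacle is that \<open>grad\<close> is a
  pointwise \<open>deriv\<close> of functions that are Lipschitz for the intrinsic distance. Product
  and chain rule thus require partial derivatives almost everywhere, that is Rademacher's theorem in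
  each coordinate direction, and before it a bound of the intrinsic distance by the Euclidean one
  inside a simplex. The energy constant 16 does not depend on the domain that contains the support
  of the cutoff, so this domain may grow with the cutoff.\<close>

section \<open>Differentiability of Lipschitz functions along lines\<close>

text \<open>Lebesgue: a Vitali cover of \<open>E\<close> by intervals of slope below \<open>p\<close>, refined by a Vitali cover by
  intervals of slope above \<open>q\<close>, gives \<open>q |E| \<le> p |E|\<close>.\<close>

lemma monotone_derivates_null:
  fixes u :: "real \<Rightarrow> real"
  assumes mono: "\<And>x y. x \<le> y \<Longrightarrow> u x \<le> u y" and cont: "continuous_on UNIV u"
    and E: "E \<in> lmeasurable" and pq: "0 \<le> p" "p < q"
    and lo: "\<And>x d. x \<in> E \<Longrightarrow> 0 < d \<Longrightarrow> \<exists>h. 0 < \<bar>h\<bar> \<and> \<bar>h\<bar> < d \<and> (u (x + h) - u x) / h < p"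
    and hi: "\<And>x d. x \<in> E \<Longrightarrow> 0 < d \<Longrightarrow> \<exists>h. 0 < \<bar>h\<bar> \<and> \<bar>h\<bar> < d \<and> q < (u (x + h) - u x) / h"
  shows "negligible E"
proof -
  \<comment> \<open>The Lebesgue-Stieltjes measure of \<open>u\<close>. By continuity it has no
    atoms, so a closed interval has exactly the increment of \<open>u\<close> as its mass, and
    bounds on slopes become comparisons with Lebesgue measure.\<close>
  define \<nu> where "\<nu> = interval_measure u"
  have sets\<nu>: "sets \<nu> = sets borel" by (simp add: \<nu>_def)
  have \<nu>: "emeasure \<nu> (cball a r) = ennreal (u (a + r) - u (a - r))" if "0 < r" for a r
    unfolding \<nu>_def cball_eq_atLeastAtMost using that
    by (intro emeasure_interval_measure_Icc) (auto intro: mono cont)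
  have len: "emeasure lborel (cball a r) = ennreal (2 * r)" if "0 < r" for a r :: real
    using that by (simp add: cball_eq_atLeastAtMost)
  define I where "I = (\<lambda>i::real \<times> real. cball (fst i) (snd i))"
  \<comment> \<open>A step \<open>h\<close> of either sign gives the interval between
    \<open>x\<close> and \<open>x + h\<close>, which is the closed ball around
    \<open>x + h / 2\<close> of radius \<open>\<bar>h\<bar> / 2\<close>. Both kinds of slope
    condition are treated at once through \<open>R\<close>.\<close>
  have pick: "\<exists>i. i \<in> {i. 0 < snd i \<and> I i \<subseteq> T \<and> R (u (fst i + snd i) - u (fst i - snd i)) (c * (2 * snd i))}
      \<and> x \<in> cball (fst i) (snd i) \<and> snd i < d"
    if T: "open T" "x \<in> T" and d: "0 < d"
      and slope: "\<And>d. 0 < d \<Longrightarrow> \<exists>h. 0 < \<bar>h\<bar> \<and> \<bar>h\<bar> < d \<and> R ((u (x + h) - u x) / h) c"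
      and R: "R = (<) \<or> R = (>)" for T x d c and R :: "real \<Rightarrow> real \<Rightarrow> bool"
  proof -
    obtain e where e: "0 < e" "cball x e \<subseteq> T" using T open_contains_cball by blast
    obtain h where h: "0 < \<bar>h\<bar>" "\<bar>h\<bar> < min d e" "R ((u (x + h) - u x) / h) c"
      using slope[of "min d e"] d e by auto
    show ?thesis
    proof (intro exI[of _ "(x + h / 2, \<bar>h\<bar> / 2)"] conjI CollectI)
      show "0 < snd (x + h / 2, \<bar>h\<bar> / 2)" using h by simp
      show "I (x + h / 2, \<bar>h\<bar> / 2) \<subseteq> T"
      proof
        fix y assume "y \<in> I (x + h / 2, \<bar>h\<bar> / 2)"
        then have "\<bar>x + h / 2 - y\<bar> \<le> \<bar>h\<bar> / 2" by (simp add: I_def dist_real_def)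
        then have "\<bar>x - y\<bar> \<le> e" using h(2) by linarith
        then show "y \<in> T" using e(2) by (auto simp: dist_real_def subset_iff)
      qed
      show "x \<in> cball (fst (x + h / 2, \<bar>h\<bar> / 2)) (snd (x + h / 2, \<bar>h\<bar> / 2))"
        by (simp add: dist_real_def)
      show "snd (x + h / 2, \<bar>h\<bar> / 2) < d" using h d by auto
      show "R (u (fst (x + h / 2, \<bar>h\<bar> / 2) + snd (x + h / 2, \<bar>h\<bar> / 2)) - u (fst (x + h / 2, \<bar>h\<bar> / 2) - snd (x + h / 2, \<bar>h\<bar> / 2)))
           (c * (2 * snd (x + h / 2, \<bar>h\<bar> / 2)))"
      proof (cases "0 < h")
        case True
        then have eqs: "x + h / 2 + \<bar>h\<bar> / 2 = x + h" "x + h / 2 - \<bar>h\<bar> / 2 = x" "2 * (\<bar>h\<bar> / 2) = h" by auto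
        show ?thesis unfolding fst_conv snd_conv eqs using h R True by (auto simp: field_simps)
      next
        case False
        then have eqs: "x + h / 2 + \<bar>h\<bar> / 2 = x" "x + h / 2 - \<bar>h\<bar> / 2 = x + h" "2 * (\<bar>h\<bar> / 2) = - h" by auto
        show ?thesis unfolding fst_conv snd_conv eqs using h R False by (auto simp: field_simps)
      qed
    qed
  qed
  have cover_meas: "emeasure M (\<Union>i\<in>C. I i) = (\<integral>\<^sup>+i. emeasure M (I i) \<partial>count_space C)"
    if "countable C" "pairwise (\<lambda>i j. disjnt (I i) (I j)) C" "sets M = sets borel" for C M
    using that by (intro emeasure_UN_countable) (auto simp: I_def disjoint_family_on_def pairwise_def disjnt_def)
  have key: "ennreal q * emeasure lebesgue E \<le> ennreal p * (emeasure lebesgue E + ennreal \<epsilon>)" if "0 < \<epsilon>" for \<epsilon>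
  proof -
    obtain T where T: "open T" "E \<subseteq> T" "T - E \<in> lmeasurable" "emeasure lebesgue (T - E) < ennreal \<epsilon>"
      using sets_lebesgue_outer_open[of E \<epsilon>] E \<open>0 < \<epsilon>\<close> by (metis fmeasurableD)
    define K1 where "K1 = {i. 0 < snd i \<and> I i \<subseteq> T \<and> (u (fst i + snd i) - u (fst i - snd i)) < (p * (2 * snd i))}"
    obtain C1 where C1: "countable C1" "C1 \<subseteq> K1" "pairwise (\<lambda>i j. disjnt (I i) (I j)) C1"
      "negligible (E - (\<Union>i\<in>C1. I i))"
    proof (rule Vitali_covering_theorem_cballs[of K1 snd E fst])
      show "\<exists>i. i \<in> K1 \<and> x \<in> cball (fst i) (snd i) \<and> snd i < d" if "x \<in> E" "0 < d" for x d
        unfolding K1_def using pick[of T x d "(<)" p] lo[OF that(1)] T that by auto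
    qed (auto simp: K1_def I_def)
    \<comment> \<open>Open balls, because the second cover has to be chosen inside an open set; the
      spheres lost in this way are countably many null sets.\<close>
    define T' where "T' = (\<Union>i\<in>C1. ball (fst i) (snd i))"
    define E' where "E' = E \<inter> T'"
    define K2 where "K2 = {i. 0 < snd i \<and> I i \<subseteq> T' \<and> (u (fst i + snd i) - u (fst i - snd i)) > (q * (2 * snd i))}"
    have "open T'" by (auto simp: T'_def)
    obtain C2 where C2: "countable C2" "C2 \<subseteq> K2" "pairwise (\<lambda>i j. disjnt (I i) (I j)) C2"
      "negligible (E' - (\<Union>i\<in>C2. I i))"
    proof (rule Vitali_covering_theorem_cballs[of K2 snd E' fst])
      show "\<exists>i. i \<in> K2 \<and> x \<in> cball (fst i) (snd i) \<and> snd i < d" if "x \<in> E'" "0 < d" for x d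
        unfolding K2_def using pick[of T' x d "(>)" q] hi[of x] \<open>open T'\<close> that by (auto simp: E'_def)
    qed (auto simp: K2_def I_def)
    define A1 A2 where "A1 = (\<Union>i\<in>C1. I i)" and "A2 = (\<Union>i\<in>C2. I i)"
    have bor: "A1 \<in> sets borel" "A2 \<in> sets borel"
      using C1(1) C2(1) by (auto simp: A1_def A2_def I_def intro!: sets.countable_UN')
    have "negligible (\<Union>i\<in>C1. sphere (fst i) (snd i))"
      using C1(1,2) by (intro negligible_countable_Union) (auto simp: negligible_sphere)
    then have "negligible ((E - A1) \<union> (E' - A2) \<union> (\<Union>i\<in>C1. sphere (fst i) (snd i)))"
      using C1(4) C2(4) by (auto simp: A1_def A2_def)
    then have neg: "negligible (E - A2)"
      by (rule negligible_subset) (auto simp: E'_def A1_def T'_def I_def, metis fst_conv snd_conv less_le)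
    have "emeasure lebesgue E \<le> emeasure lebesgue ((E - A2) \<union> A2)"
      using E bor neg by (intro emeasure_mono) (auto simp: fmeasurable_def negligible_imp_sets)
    also have "\<dots> = emeasure lebesgue A2"
      using neg bor by (subst Un_commute, intro emeasure_Un_null_set) (auto simp: negligible_iff_null_sets)
    finally have 1: "emeasure lebesgue E \<le> emeasure lborel A2" using bor by simp
    have 2: "ennreal q * emeasure lborel A2 \<le> emeasure \<nu> A2"
      unfolding A2_def cover_meas[OF C2(1,3) sets\<nu>] cover_meas[OF C2(1,3) sets_lborel]
        nn_integral_cmult[OF borel_measurable_count_space, symmetric]
    proof (intro nn_integral_mono)
      fix i assume "i \<in> space (count_space C2)"
      then have "i \<in> K2" using C2(2) by auto
      then show "ennreal q * emeasure lborel (I i) \<le> emeasure \<nu> (I i)"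
        using pq by (simp add: K2_def I_def len \<nu> ennreal_mult[symmetric] ennreal_leI)
    qed
    have 3: "emeasure \<nu> A1 \<le> ennreal p * emeasure lborel A1"
      unfolding A1_def cover_meas[OF C1(1,3) sets\<nu>] cover_meas[OF C1(1,3) sets_lborel]
        nn_integral_cmult[OF borel_measurable_count_space, symmetric]
    proof (intro nn_integral_mono)
      fix i assume "i \<in> space (count_space C1)"
      then have "i \<in> K1" using C1(2) by auto
      then show "emeasure \<nu> (I i) \<le> ennreal p * emeasure lborel (I i)"
        using pq by (simp add: K1_def I_def len \<nu> ennreal_mult[symmetric] ennreal_leI)
    qed
    have 4: "emeasure \<nu> A2 \<le> emeasure \<nu> A1"
    proof (intro emeasure_mono)
      have "A2 \<subseteq> T'" using C2(2) by (auto simp: A2_def K2_def)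
      also have "T' \<subseteq> A1" by (auto simp: T'_def A1_def I_def)
      finally show "A2 \<subseteq> A1" .
    qed (use bor sets\<nu> in auto)
    have "emeasure lborel A1 \<le> emeasure lborel T"
      using C1(2) T(1) by (intro emeasure_mono) (auto simp: A1_def K1_def)
    also have "\<dots> = emeasure lebesgue (E \<union> (T - E))"
      using T by (auto simp: Un_absorb1)
    also have "\<dots> \<le> emeasure lebesgue E + emeasure lebesgue (T - E)"
      using E T by (intro emeasure_subadditive) (auto simp: fmeasurable_def)
    also have "\<dots> \<le> emeasure lebesgue E + ennreal \<epsilon>"
      using T(4) by (intro add_left_mono) auto
    finally have 5: "emeasure lborel A1 \<le> emeasure lebesgue E + ennreal \<epsilon>" .
    have "ennreal q * emeasure lebesgue E \<le> ennreal q * emeasure lborel A2"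
      using 1 by (intro mult_left_mono) auto
    also note 2 also note 4 also note 3
    also have "ennreal p * emeasure lborel A1 \<le> ennreal p * (emeasure lebesgue E + ennreal \<epsilon>)"
      using 5 by (intro mult_left_mono) auto
    finally show ?thesis .
  qed
  have fin: "emeasure lebesgue E = ennreal (measure lebesgue E)"
    using E by (simp add: emeasure_eq_measure2)
  \<comment> \<open>The tolerance \<open>e / (p + 1)\<close> makes the extra term
    \<open>p * e / (p + 1)\<close> at most \<open>e\<close>, also for \<open>p = 0\<close>.\<close>
  have "q * measure lebesgue E \<le> p * measure lebesgue E + e" if "0 < e" for e
  proof -
    have "q * measure lebesgue E \<le> p * (measure lebesgue E + e / (p + 1))"
      using key[of "e / (p + 1)"] pq that unfolding fin
      by (simp add: ennreal_mult[symmetric] ennreal_plus[symmetric] del: ennreal_plus)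
    also have "\<dots> \<le> p * measure lebesgue E + e"
      using pq that by (simp add: field_simps)
    finally show ?thesis .
  qed
  then have "q * measure lebesgue E \<le> p * measure lebesgue E"
    by (rule field_le_epsilon)
  then have "(q - p) * measure lebesgue E \<le> 0" by (simp add: algebra_simps)
  then have "measure lebesgue E \<le> 0" using pq by (simp add: mult_le_0_iff)
  then have "measure lebesgue E = 0" by (simp add: measure_le_0_iff)
  then show ?thesis using E by (simp add: negligible_iff_measure)
qed

definition dir_quotient :: "('a::real_normed_vector \<Rightarrow> real) \<Rightarrow> 'a \<Rightarrow> 'a \<Rightarrow> real \<Rightarrow> real" where
  "dir_quotient u e x h = (u (x + h *\<^sub>R e) - u x) / h"

text \<open>Points whose lower two-sided derivate along \<open>e\<close> is at most
  \<open>p\<close>, in a slightly sharper form. Restricting the steps to rationals makes the set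
  Borel for continuous \<open>u\<close>.\<close>

definition lower_deriv_set :: "('a::real_normed_vector \<Rightarrow> real) \<Rightarrow> 'a \<Rightarrow> real \<Rightarrow> 'a set" where
  "lower_deriv_set u e p =
     (\<Inter>n. \<Union>h\<in>{h \<in> \<rat>. h \<noteq> 0 \<and> \<bar>h\<bar> < inverse (real (Suc n))}. {x. dir_quotient u e x h < p})"

text \<open>A gap between the lower derivate and the upper one; negating \<open>u\<close> exchanges
  the two.\<close>

definition nondiff_set :: "('a::real_normed_vector \<Rightarrow> real) \<Rightarrow> 'a \<Rightarrow> real \<Rightarrow> real \<Rightarrow> 'a set" where
  "nondiff_set u e p q = lower_deriv_set u e p \<inter> lower_deriv_set (\<lambda>x. - u x) e (- q)"

lemma lower_deriv_set_borel:
  fixes u :: "'a::euclidean_space \<Rightarrow> real"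
  assumes "continuous_on UNIV u"
  shows "lower_deriv_set u e p \<in> sets borel"
proof -
  have "open {x. dir_quotient u e x h < p}" for h
    unfolding dir_quotient_def
    by (intro open_Collect_less) (auto intro!: continuous_intros continuous_on_compose2[OF assms] simp: divide_inverse)
  then show ?thesis
    unfolding lower_deriv_set_def
    by (intro sets.countable_INT'' sets.countable_UN' countable_subset[OF _ countable_rat]) auto
qed

lemma nondiff_set_borel:
  fixes u :: "'a::euclidean_space \<Rightarrow> real"
  assumes "continuous_on UNIV u"
  shows "nondiff_set u e p q \<in> sets borel"
  unfolding nondiff_set_def
  using assms by (intro sets.Int lower_deriv_set_borel continuous_intros)

lemma lower_deriv_setD:
  assumes "x \<in> lower_deriv_set u e p" "0 < d"
  shows "\<exists>h. h \<noteq> 0 \<and> \<bar>h\<bar> < d \<and> dir_quotient u e x h < p"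
proof -
  obtain n where "inverse (real (Suc n)) < d" using reals_Archimedean[OF assms(2)] by auto
  moreover obtain h where "h \<noteq> 0" "\<bar>h\<bar> < inverse (real (Suc n))" "dir_quotient u e x h < p"
    using assms(1) by (auto simp: lower_deriv_set_def)
  ultimately show ?thesis by (intro exI[of _ h]) linarith
qed

text \<open>The steps with difference quotient below \<open>p\<close> form an open set away from 0,
  so a real step can be moved to a nearby rational one.\<close>

lemma lower_deriv_setI:
  fixes u :: "'a::euclidean_space \<Rightarrow> real"
  assumes cont: "continuous_on UNIV u"
    and ex: "\<And>d. 0 < d \<Longrightarrow> \<exists>h. h \<noteq> 0 \<and> \<bar>h\<bar> < d \<and> dir_quotient u e x h < p"
  shows "x \<in> lower_deriv_set u e p"
  unfolding lower_deriv_set_def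
proof (intro INT_I)
  fix n
  obtain h0 where h0: "h0 \<noteq> 0" "\<bar>h0\<bar> < inverse (real (Suc n))" "dir_quotient u e x h0 < p"
    using ex[of "inverse (real (Suc n))"] by auto
  let ?W = "{h \<in> - {0}. dir_quotient u e x h < p} \<inter> {h. \<bar>h\<bar> < inverse (real (Suc n))}"
  have "continuous_on (- {0}) (dir_quotient u e x)"
    unfolding dir_quotient_def
    by (auto intro!: continuous_intros continuous_on_compose2[OF cont])
  then have "open {h \<in> - {0}. dir_quotient u e x h < p}"
    using open_lessThan[of p] unfolding continuous_on_open_vimage[OF open_Compl[OF closed_singleton]]
    by (force simp: vimage_def Int_def conj_commute dest: spec[of _ "{..<p}"])
  then have "open ?W" by (intro open_Int open_Collect_less continuous_intros) auto
  moreover have "h0 \<in> ?W" using h0 by auto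
  ultimately obtain d where d: "0 < d" "ball h0 d \<subseteq> ?W" by (meson openE)
  obtain r where "r \<in> \<rat>" "h0 < r" "r < h0 + d" using Rats_dense_in_real[of h0 "h0 + d"] d by auto
  then have "r \<in> ?W" using d(2) by (auto simp: subset_iff dist_real_def)
  then show "x \<in> (\<Union>h\<in>{h \<in> \<rat>. h \<noteq> 0 \<and> \<bar>h\<bar> < inverse (real (Suc n))}. {x. dir_quotient u e x h < p})"
    using \<open>r \<in> \<rat>\<close> by auto
qed

text \<open>The Lipschitz bound makes the lower derivate \<open>l\<close> finite. Were the upper
  derivate larger, two rationals \<open>p < q\<close> between them would put \<open>x\<close> into
  \<open>nondiff_set u e p q\<close>.\<close>

lemma differentiable_off_nondiff_set:
  fixes u :: "'a::euclidean_space \<Rightarrow> real"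
  assumes lip: "L-lipschitz_on UNIV u"
    and x: "\<And>p q. p \<in> \<rat> \<Longrightarrow> q \<in> \<rat> \<Longrightarrow> p < q \<Longrightarrow> x \<notin> nondiff_set u e p q"
  shows "(\<lambda>t. u (x + t *\<^sub>R e)) differentiable at 0"
proof -
  have cont: "continuous_on UNIV u" using lip by (rule lipschitz_on_continuous_on)
  let ?q = "dir_quotient u e x"
  have bd: "\<bar>?q h\<bar> \<le> L * norm e" for h
  proof -
    have "\<bar>u (x + h *\<^sub>R e) - u x\<bar> \<le> L * (\<bar>h\<bar> * norm e)"
      using lipschitz_onD[OF lip, of "x + h *\<^sub>R e" x] by (simp add: dist_norm)
    moreover have "0 \<le> L * norm e" using lipschitz_on_nonneg[OF lip] by simp
    ultimately show ?thesis
      by (cases "h = 0") (auto simp: dir_quotient_def field_simps abs_mult)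
  qed
  define S where "S = {p. \<exists>d>0. \<forall>h. h \<noteq> 0 \<and> \<bar>h\<bar> < d \<longrightarrow> p \<le> ?q h}"
  define l where "l = Sup S"
  have "- (L * norm e) \<in> S"
  proof -
    have "- (L * norm e) \<le> ?q h" for h using bd[of h] by linarith
    then show ?thesis unfolding S_def by (intro CollectI exI[of _ "1::real"]) simp
  qed
  have "p \<le> L * norm e" if "p \<in> S" for p
  proof -
    obtain d where "0 < d" "\<forall>h. h \<noteq> 0 \<and> \<bar>h\<bar> < d \<longrightarrow> p \<le> ?q h"
      using \<open>p \<in> S\<close> unfolding S_def by blast
    then have "p \<le> ?q (d / 2)" by auto
    with bd[of "d / 2"] show ?thesis by linarith
  qed
  then have "bdd_above S" by (rule bdd_aboveI)
  then have S: "S \<noteq> {}" "bdd_above S" using \<open>- (L * norm e) \<in> S\<close> by auto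
  have low: "eventually (\<lambda>h. p < ?q h) (at 0)" if "p < l" for p
  proof -
    obtain p' where "p < p'" "p' \<in> S" using less_cSupD[OF S(1), of p] \<open>p < l\<close> by (auto simp: l_def)
    obtain d where "0 < d" "\<forall>h. h \<noteq> 0 \<and> \<bar>h\<bar> < d \<longrightarrow> p' \<le> ?q h"
      using \<open>p' \<in> S\<close> unfolding S_def by blast
    then have "p < ?q h" if "h \<noteq> 0" "\<bar>h\<bar> < d" for h
      using that \<open>p < p'\<close> by (meson less_le_trans)
    then show ?thesis unfolding eventually_at using \<open>0 < d\<close>
      by (intro exI[of _ d]) (simp add: dist_real_def)
  qed
  have upp: "eventually (\<lambda>h. ?q h < b) (at 0)" if "l < b" for b
  proof -
    obtain q where q: "q \<in> \<rat>" "l < q" "q < b" using Rats_dense_in_real[OF \<open>l < b\<close>] by auto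
    obtain p where p: "p \<in> \<rat>" "l < p" "p < q" using Rats_dense_in_real[OF q(2)] by auto
    have "p \<notin> S" using cSup_upper[OF _ S(2), of p] p(2) unfolding l_def by linarith
    then have "\<exists>h. h \<noteq> 0 \<and> \<bar>h\<bar> < d \<and> ?q h < p" if "0 < d" for d
      using that unfolding S_def mem_Collect_eq by (meson not_le)
    then have "x \<in> lower_deriv_set u e p"
      by (rule lower_deriv_setI[OF cont])
    then have "x \<notin> lower_deriv_set (\<lambda>x. - u x) e (- q)"
      using x[OF p(1) q(1) p(3)] by (auto simp: nondiff_set_def)
    then have "\<exists>d>0. \<forall>h. h \<noteq> 0 \<and> \<bar>h\<bar> < d \<longrightarrow> \<not> dir_quotient (\<lambda>x. - u x) e x h < - q"
      by (rule contrapos_np) (rule lower_deriv_setI[OF continuous_on_minus[OF cont]], blast)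
    then obtain d where d: "0 < d"
      "\<And>h. h \<noteq> 0 \<Longrightarrow> \<bar>h\<bar> < d \<Longrightarrow> \<not> dir_quotient (\<lambda>x. - u x) e x h < - q"
      by blast
    have "dir_quotient (\<lambda>x. - u x) e x h = - ?q h" for h
      using minus_divide_left[of "u (x + h *\<^sub>R e) - u x" h] by (simp add: dir_quotient_def)
    then have "?q h < b" if "h \<noteq> 0" "\<bar>h\<bar> < d" for h using d(2)[OF that] q(3) by simp
    then show ?thesis unfolding eventually_at using d(1)
      by (intro exI[of _ d]) (simp add: dist_real_def)
  qed
  have "(?q \<longlongrightarrow> l) (at 0)" by (rule order_tendstoI) (use low upp in auto)
  then have "((\<lambda>t. u (x + t *\<^sub>R e)) has_real_derivative l) (at 0)"
    by (simp add: has_field_derivative_iff dir_quotient_def[abs_def])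
  then show ?thesis by (auto simp: real_differentiable_def)
qed

lemma nondiff_set_null_real:
  fixes u :: "real \<Rightarrow> real"
  assumes lip: "L-lipschitz_on UNIV u" and pq: "p < q"
  shows "negligible (nondiff_set u 1 p q)"
proof -
  \<comment> \<open>The linear term shifts every difference quotient by the same constant. The
    summand \<open>L\<close> makes \<open>v\<close> monotone, the summand
    \<open>\<bar>p\<bar>\<close> makes the shifted lower slope nonnegative.\<close>
  define v where "v = (\<lambda>x. u x + (L + \<bar>p\<bar>) * x)"
  have cont: "continuous_on UNIV u" using lip by (rule lipschitz_on_continuous_on)
  have L: "0 \<le> L" using lip by (rule lipschitz_on_nonneg)
  have quot: "(v (x + h) - v x) / h = dir_quotient u 1 x h + (L + \<bar>p\<bar>)" if "h \<noteq> 0" for x h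
    using that by (simp add: v_def dir_quotient_def field_simps)
  have neg: "negligible (nondiff_set u 1 p q \<inter> cball 0 (real n))" for n
  proof (rule monotone_derivates_null[of v _ "p + (L + \<bar>p\<bar>)" "q + (L + \<bar>p\<bar>)"])
    show "v x \<le> v y" if "x \<le> y" for x y
    proof -
      have "u x - u y \<le> L * (y - x)"
        using lipschitz_onD[OF lip, of x y] that by (simp add: dist_real_def)
      moreover have "0 \<le> \<bar>p\<bar> * (y - x)" using that by simp
      ultimately show ?thesis unfolding v_def by (simp add: algebra_simps)
    qed
    show "continuous_on UNIV v" unfolding v_def by (intro continuous_intros cont)
    have "nondiff_set u 1 p q \<inter> cball 0 (real n) \<in> sets lebesgue"
      using nondiff_set_borel[OF cont] by auto
    then show "nondiff_set u 1 p q \<inter> cball 0 (real n) \<in> lmeasurable"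
      by (rule bounded_set_imp_lmeasurable[rotated]) auto
    show "\<exists>h. 0 < \<bar>h\<bar> \<and> \<bar>h\<bar> < d \<and> (v (x + h) - v x) / h < p + (L + \<bar>p\<bar>)"
      if xd: "x \<in> nondiff_set u 1 p q \<inter> cball 0 (real n)" "0 < d" for x d
    proof -
      obtain h where h: "h \<noteq> 0" "\<bar>h\<bar> < d" "dir_quotient u 1 x h < p"
        using lower_deriv_setD[of x u 1 p d] xd unfolding nondiff_set_def by blast
      then show ?thesis using quot[OF h(1)] by (intro exI[of _ h]) simp
    qed
    show "\<exists>h. 0 < \<bar>h\<bar> \<and> \<bar>h\<bar> < d \<and> q + (L + \<bar>p\<bar>) < (v (x + h) - v x) / h"
      if xd: "x \<in> nondiff_set u 1 p q \<inter> cball 0 (real n)" "0 < d" for x d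
    proof -
      obtain h where h: "h \<noteq> 0" "\<bar>h\<bar> < d" "dir_quotient (\<lambda>x. - u x) 1 x h < - q"
        using lower_deriv_setD[of x "\<lambda>x. - u x" 1 "- q" d] xd unfolding nondiff_set_def by blast
      have "dir_quotient (\<lambda>x. - u x) 1 x h = - dir_quotient u 1 x h"
        using minus_divide_left[of "u (x + h) - u x" h] by (simp add: dir_quotient_def)
      then show ?thesis using h quot[OF h(1)] by (intro exI[of _ h]) simp
    qed
  qed (use pq L in auto)
  have "nondiff_set u 1 p q = (\<Union>n. nondiff_set u 1 p q \<inter> cball 0 (real n))"
    by (auto simp: dist_real_def) (meson real_arch_simple)
  moreover have "negligible (\<Union>n. nondiff_set u 1 p q \<inter> cball 0 (real n))"
    using neg by (intro negligible_countable_Union) auto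
  ultimately show ?thesis by (rule ssubst)
qed

text \<open>Integrate the indicator of \<open>x + t *\<^sub>R e \<in> B\<close> over
  \<open>t\<close> in the unit interval and all \<open>x\<close>. For fixed \<open>t\<close>,
  translation invariance gives the measure of \<open>B\<close>; for fixed \<open>x\<close> the
  integral vanishes.\<close>

lemma null_if_lines_null:
  fixes e :: "'a::euclidean_space"
  assumes B: "B \<in> sets borel" and null: "\<And>x. negligible {t. x + t *\<^sub>R e \<in> B}"
  shows "negligible B"
proof -
  let ?F = "\<lambda>(t::real, x). indicator {0..1} t * indicator B (x + t *\<^sub>R e) :: ennreal"
  have m: "(\<lambda>(t::real, x). x + t *\<^sub>R e) \<in> borel_measurable (lborel \<Otimes>\<^sub>M lborel)"
    unfolding split_beta' by measurable
  have F: "?F \<in> borel_measurable (lborel \<Otimes>\<^sub>M lborel)"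
    using B by measurable
  have in_t: "(\<integral>\<^sup>+t. ?F (t, x) \<partial>lborel) = 0" for x
  proof -
    have "AE t in lebesgue. x + t *\<^sub>R e \<notin> B"
      using null[of x] AE_not_in[of "{t. x + t *\<^sub>R e \<in> B}" lebesgue] by (simp add: negligible_iff_null_sets)
    then have "AE t in lborel. x + t *\<^sub>R e \<notin> B"
      by (simp add: AE_completion_iff)
    then have "(\<integral>\<^sup>+t. ?F (t, x) \<partial>lborel) = (\<integral>\<^sup>+t. 0 \<partial>(lborel::real measure))"
      by (intro nn_integral_cong_AE) (auto elim!: eventually_mono)
    then show ?thesis by simp
  qed
  have in_x: "(\<integral>\<^sup>+x. ?F (t, x) \<partial>lborel) = indicator {0..1} t * emeasure lborel B" for t
  proof -
    have "(\<integral>\<^sup>+x. indicator B (x + t *\<^sub>R e) \<partial>lborel) = (\<integral>\<^sup>+x. indicator B x \<partial>distr lborel borel ((+) (t *\<^sub>R e)))"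
      using B by (subst nn_integral_distr) (auto simp: add.commute)
    also have "\<dots> = emeasure lborel B" using B by (simp add: lborel_distr_plus)
    finally show ?thesis using B by (simp add: nn_integral_cmult)
  qed
  have "emeasure lborel B = (\<integral>\<^sup>+t. indicator {0..1} t * emeasure lborel B \<partial>(lborel :: real measure))"
    by (simp add: nn_integral_multc)
  also have "\<dots> = (\<integral>\<^sup>+t. (\<integral>\<^sup>+x. ?F (t, x) \<partial>lborel) \<partial>lborel)" by (simp only: in_x)
  also have "\<dots> = (\<integral>\<^sup>+x. (\<integral>\<^sup>+t. ?F (t, x) \<partial>lborel) \<partial>lborel)"
    using lborel_pair.Fubini'[OF F] by simp
  also have "\<dots> = 0" by (simp only: in_t) simp
  finally show ?thesis using B by (auto simp: negligible_iff_null_sets null_sets_def)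
qed

lemma nondiff_set_null:
  fixes u :: "'a::euclidean_space \<Rightarrow> real"
  assumes lip: "L-lipschitz_on UNIV u" and pq: "p < q"
  shows "negligible (nondiff_set u e p q)"
proof (rule null_if_lines_null)
  show "nondiff_set u e p q \<in> sets borel"
    using lip by (intro nondiff_set_borel lipschitz_on_continuous_on)
  fix x
  define v where "v = (\<lambda>t. u (x + t *\<^sub>R e))"
  have "dir_quotient v 1 t h = dir_quotient u e (x + t *\<^sub>R e) h"
    "dir_quotient (\<lambda>t. - v t) 1 t h = dir_quotient (\<lambda>x. - u x) e (x + t *\<^sub>R e) h" for t h
    by (simp_all add: dir_quotient_def v_def algebra_simps)
  then have "{t. x + t *\<^sub>R e \<in> nondiff_set u e p q} = nondiff_set v 1 p q"
    by (simp add: set_eq_iff nondiff_set_def lower_deriv_set_def)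
  moreover have "(L * norm e)-lipschitz_on UNIV v"
  proof (rule lipschitz_onI)
    show "dist (v s) (v t) \<le> L * norm e * dist s t" for s t
    proof -
      have "dist (v s) (v t) \<le> L * dist (x + s *\<^sub>R e) (x + t *\<^sub>R e)"
        unfolding v_def by (rule lipschitz_onD[OF lip]) auto
      also have "dist (x + s *\<^sub>R e) (x + t *\<^sub>R e) = norm e * dist s t"
        by (simp add: dist_norm scaleR_diff_left[symmetric])
      finally show ?thesis by (simp add: mult_ac)
    qed
  qed (use lipschitz_on_nonneg[OF lip] in simp)
  ultimately show "negligible {t. x + t *\<^sub>R e \<in> nondiff_set u e p q}"
    using nondiff_set_null_real[OF _ pq] by simp
qed

text \<open>McShane's extension by the infimum of the cones
  \<open>u y + L * dist x y\<close>.\<close>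

lemma lipschitz_extension:
  fixes u :: "'a::metric_space \<Rightarrow> real"
  assumes lip: "L-lipschitz_on W u"
  obtains v where "L-lipschitz_on UNIV v" "\<And>x. x \<in> W \<Longrightarrow> v x = u x"
proof (cases "W = {}")
  case True
  then show ?thesis using that[of "\<lambda>_. 0"] lipschitz_on_nonneg[OF lip] by (simp add: lipschitz_on_def)
next
  case False
  have L: "0 \<le> L" using lip by (rule lipschitz_on_nonneg)
  have ineq: "u z \<le> u y + L * dist z y" if "y \<in> W" "z \<in> W" for y z
    using lipschitz_onD[OF lip that(2,1)] by (simp add: dist_real_def)
  obtain z where z: "z \<in> W" using False by blast
  define v where "v x = (INF y\<in>W. u y + L * dist x y)" for x
  have bdd: "bdd_below ((\<lambda>y. u y + L * dist x y) ` W)" for x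
  proof (rule bdd_belowI2)
    fix y assume y: "y \<in> W"
    have "L * dist z y \<le> L * (dist x z + dist x y)"
      using L dist_triangle[of z y x] by (intro mult_left_mono) (auto simp: dist_commute)
    then show "u z - L * dist x z \<le> u y + L * dist x y"
      using ineq[OF y z] by (simp add: algebra_simps)
  qed
  have le: "v x \<le> v x' + L * dist x x'" for x x'
  proof -
    have "v x - L * dist x x' \<le> v x'"
      unfolding v_def[of x']
    proof (rule cINF_greatest[OF False])
      fix y assume y: "y \<in> W"
      have "v x \<le> u y + L * dist x y" unfolding v_def by (rule cINF_lower[OF bdd y])
      also have "L * dist x y \<le> L * (dist x x' + dist x' y)"
        using L by (intro mult_left_mono dist_triangle) auto
      finally show "v x - L * dist x x' \<le> u y + L * dist x' y" by (simp add: algebra_simps)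
    qed
    then show ?thesis by simp
  qed
  show ?thesis
  proof (rule that[of v])
    show "L-lipschitz_on UNIV v"
    proof (rule lipschitz_onI)
      show "dist (v x) (v y) \<le> L * dist x y" for x y
        using le[of x y] le[of y x] by (simp add: dist_real_def dist_commute abs_le_iff)
    qed (rule L)
    show "v x = u x" if x: "x \<in> W" for x
    proof (rule antisym)
      show "v x \<le> u x" using cINF_lower[OF bdd x, of x] by (simp add: v_def)
      show "u x \<le> v x" unfolding v_def by (rule cINF_greatest[OF False]) (rule ineq[OF _ x])
    qed
  qed
qed

text \<open>The exceptional sets for the countably many rational pairs have a null union. Since
  \<open>W\<close> is open, small steps from a point of \<open>W\<close> see \<open>u\<close> itself
  and not the rest of its extension.\<close>

proposition lipschitz_AE_directionally_differentiable:
  fixes u :: "'a::euclidean_space \<Rightarrow> real"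
  assumes lip: "L-lipschitz_on W u" and W: "open W"
  shows "negligible {x \<in> W. \<not> (\<lambda>t. u (x + t *\<^sub>R e)) differentiable at 0}"
proof -
  obtain v where v: "L-lipschitz_on UNIV v" "\<And>x. x \<in> W \<Longrightarrow> v x = u x"
    using lipschitz_extension[OF lip] by blast
  define I where "I = {(p, q). p \<in> \<rat> \<and> q \<in> \<rat> \<and> p < (q::real)}"
  define N where "N = \<Union> ((\<lambda>(p, q). nondiff_set v e p q) ` I)"
  have "countable I"
    by (rule countable_subset[of _ "\<rat> \<times> \<rat>"]) (auto simp: I_def countable_rat)
  then have "negligible N"
    unfolding N_def using nondiff_set_null[OF v(1)]
    by (intro negligible_countable_Union countable_image) (auto simp: I_def)
  moreover have "(\<lambda>t. u (x + t *\<^sub>R e)) differentiable at 0" if x: "x \<in> W" "x \<notin> N" for x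
  proof -
    have "(\<lambda>t. v (x + t *\<^sub>R e)) differentiable at 0"
      using x(2) by (intro differentiable_off_nondiff_set[OF v(1)]) (auto simp: N_def I_def)
    then obtain D where D: "((\<lambda>t. v (x + t *\<^sub>R e)) has_derivative D) (at 0)"
      by (auto simp: differentiable_def)
    have "eventually (\<lambda>t. x + t *\<^sub>R e \<in> W) (at 0)"
      by (rule topological_tendstoD[OF _ W]) (use x in \<open>auto intro!: tendsto_eq_intros\<close>)
    then have "eventually (\<lambda>t. v (x + t *\<^sub>R e) = u (x + t *\<^sub>R e)) (at 0)"
      by (rule eventually_mono) (rule v)
    from has_derivative_transform_eventually[OF D this] show ?thesis
      using v(2)[OF x(1)] by (auto simp: differentiable_def)
  qed
  ultimately show ?thesis by (elim negligible_subset) auto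
qed

section \<open>Charts of a Riemannian polyhedron\<close>

text \<open>Stated for bare distance functions, because \<open>barycentric_dist\<close> is not the
  distance of a metric type. The condition \<open>d x x = 0\<close> lets the centre \<open>a\<close>
  be one of the two compared points.\<close>

lemma locally_lipschitz_compose:
  assumes f: "locally_lipschitz A d d' f" and g: "locally_lipschitz B d' d'' g" and fAB: "f ` A \<subseteq> B"
    and d0: "\<And>x. x \<in> A \<Longrightarrow> d x x = 0" and d_nn: "\<And>x y. 0 \<le> d x y" and d'_nn: "\<And>x y. 0 \<le> d' x y"
  shows "locally_lipschitz A d d'' (g \<circ> f)"
  unfolding locally_lipschitz_def
proof
  fix a assume a: "a \<in> A"
  obtain r L where r: "0 < r" and L: "\<And>x y. x \<in> A \<Longrightarrow> y \<in> A \<Longrightarrow> d a x < r \<Longrightarrow> d a y < r \<Longrightarrow> d' (f x) (f y) \<le> L * d x y"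
    using f a unfolding locally_lipschitz_def by meson
  have "f a \<in> B" using a fAB by auto
  then obtain r' L' where r': "0 < r'" and L': "\<And>x y. x \<in> B \<Longrightarrow> y \<in> B \<Longrightarrow> d' (f a) x < r' \<Longrightarrow> d' (f a) y < r' \<Longrightarrow> d'' (g x) (g y) \<le> L' * d' x y"
    using g unfolding locally_lipschitz_def by meson
  \<comment> \<open>On the \<open>R\<close>-ball around \<open>a\<close> the map \<open>f\<close>
    stays within \<open>r'\<close> of \<open>f a\<close>. The denominator
    \<open>\<bar>L\<bar> + 1\<close> is positive whatever the sign of \<open>L\<close>.\<close>
  define R where "R = min r (r' / (\<bar>L\<bar> + 1))"
  have R: "0 < R" using r r' by (simp add: R_def)
  have near: "d' (f a) (f x) < r'" if "x \<in> A" "d a x < R" for x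
  proof -
    have "d' (f a) (f x) \<le> L * d a x" using that a d0[OF a] r by (intro L) (auto simp: R_def)
    also have "\<dots> \<le> (\<bar>L\<bar> + 1) * d a x" using d_nn by (intro mult_right_mono) auto
    also have "\<dots> < r'"
    proof -
      have "d a x < r' / (\<bar>L\<bar> + 1)" using that by (simp add: R_def)
      then show ?thesis by (simp add: pos_less_divide_eq mult.commute)
    qed
    finally show ?thesis .
  qed
  have "d'' (g (f x)) (g (f y)) \<le> (\<bar>L'\<bar> * L) * d x y" if x: "x \<in> A" "d a x < R" and y: "y \<in> A" "d a y < R" for x y
  proof -
    have "d'' (g (f x)) (g (f y)) \<le> L' * d' (f x) (f y)"
      using x y near fAB by (intro L') auto
    also have "\<dots> \<le> \<bar>L'\<bar> * d' (f x) (f y)" using d'_nn by (intro mult_right_mono) auto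
    also have "\<dots> \<le> \<bar>L'\<bar> * (L * d x y)" using x y by (intro mult_left_mono L) (auto simp: R_def)
    finally show ?thesis by (simp add: mult_ac)
  qed
  then show "\<exists>r>0. \<exists>L. \<forall>x\<in>A. \<forall>y\<in>A. d a x < r \<and> d a y < r \<longrightarrow> d'' ((g \<circ> f) x) ((g \<circ> f) y) \<le> L * d x y"
    using R by (intro exI[of _ R] conjI exI[of _ "\<bar>L'\<bar> * L"]) auto
qed

lemma locally_lipschitz_continuous_on:
  fixes f :: "'p::metric_space \<Rightarrow> 'q::metric_space"
  assumes "locally_lipschitz A dist dist f"
  shows "continuous_on A f"
  unfolding continuous_on_iff
proof (intro ballI allI impI)
  fix a and e :: real assume a: "a \<in> A" and e: "0 < e"
  obtain r L where r: "0 < r" and L: "\<And>x y. x \<in> A \<Longrightarrow> y \<in> A \<Longrightarrow> dist a x < r \<Longrightarrow> dist a y < r \<Longrightarrow> dist (f x) (f y) \<le> L * dist x y"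
    using assms a unfolding locally_lipschitz_def by meson
  have "dist (f x) (f a) < e" if "x \<in> A" "dist x a < min r (e / (\<bar>L\<bar> + 1))" for x
  proof -
    have "dist (f x) (f a) \<le> L * dist x a" using that a r by (intro L) (auto simp: dist_commute)
    also have "\<dots> \<le> (\<bar>L\<bar> + 1) * dist x a" by (intro mult_right_mono) auto
    also have "\<dots> < e" using that(2) by (simp add: pos_less_divide_eq mult.commute)
    finally show ?thesis .
  qed
  then show "\<exists>d>0. \<forall>x\<in>A. dist x a < d \<longrightarrow> dist (f x) (f a) < e"
    using r e by (intro exI[of _ "min r (e / (\<bar>L\<bar> + 1))"]) auto
qed

lemma locally_lipschitz_imp_lipschitz_on_compact:
  fixes f :: "'p::metric_space \<Rightarrow> 'q::metric_space"
  assumes f: "locally_lipschitz A dist dist f" and C: "compact C" "C \<subseteq> A"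
  shows "\<exists>L. L-lipschitz_on C f"
proof -
  \<comment> \<open>\<open>local_lipschitz\<close> speaks of time-dependent maps; the time is frozen
    to the single value 0.\<close>
  have "local_lipschitz {0::real} C (\<lambda>_. f)"
  proof (rule local_lipschitzI)
    fix t a assume "t \<in> {0::real}" "a \<in> C"
    then obtain r L where r: "0 < r" and L: "\<And>x y. x \<in> A \<Longrightarrow> y \<in> A \<Longrightarrow> dist a x < r \<Longrightarrow> dist a y < r \<Longrightarrow> dist (f x) (f y) \<le> L * dist x y"
      using f C(2) unfolding locally_lipschitz_def by (meson subsetD)
    have "\<bar>L\<bar>-lipschitz_on (cball a (r / 2) \<inter> C) f"
    proof (rule lipschitz_onI)
      fix x y assume "x \<in> cball a (r / 2) \<inter> C" "y \<in> cball a (r / 2) \<inter> C"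
      then have "dist (f x) (f y) \<le> L * dist x y" using C(2) r by (intro L) auto
      also have "\<dots> \<le> \<bar>L\<bar> * dist x y" by (intro mult_right_mono) auto
      finally show "dist (f x) (f y) \<le> \<bar>L\<bar> * dist x y" .
    qed auto
    then show "\<exists>u>0. \<exists>L. \<forall>t\<in>cball t u \<inter> {0}. L-lipschitz_on (cball a u \<inter> C) f"
      using r by (intro exI[of _ "r / 2"]) auto
  qed
  then obtain L where "L-lipschitz_on C f"
    using local_lipschitz_compact_implies_lipschitz[OF \<open>local_lipschitz {0::real} C (\<lambda>_. f)\<close> C(1)] by auto
  then show ?thesis by blast
qed

text \<open>Polarization turns preserved distances into preserved inner products, after which the
  defects of additivity and homogeneity have norm zero. This suits \<open>euc P s\<close>, whose
  range is only an affine subspace of the ambient space.\<close>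

lemma isometry_affine:
  fixes T :: "'a::real_inner \<Rightarrow> 'b::real_inner"
  assumes "\<And>x y. dist (T x) (T y) = dist x y"
  shows "linear (\<lambda>x. T x - T 0)"
proof -
  define f where "f x = T x - T 0" for x
  have nf: "norm (f x - f y) = norm (x - y)" for x y
    using assms[of x y] by (simp add: f_def dist_norm)
  have f0: "f 0 = 0" by (simp add: f_def)
  have nf0: "norm (f x) = norm x" for x using nf[of x 0] by (simp add: f0)
  have inner: "f x \<bullet> f y = x \<bullet> y" for x y
  proof -
    have "(norm (f x - f y))\<^sup>2 = (norm (x - y))\<^sup>2" by (simp add: nf)
    moreover have "(norm (f x))\<^sup>2 = (norm x)\<^sup>2" "(norm (f y))\<^sup>2 = (norm y)\<^sup>2" by (simp_all add: nf0)
    ultimately show ?thesis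
      by (simp add: power2_norm_eq_inner inner_diff inner_commute)
  qed
  have "f (x + y) = f x + f y" for x y
  proof -
    have "(f (x + y) - f x - f y) \<bullet> (f (x + y) - f x - f y) = 0"
      by (simp add: inner_diff inner inner_add inner_commute)
    then have "f (x + y) - f x - f y = 0" by simp
    then show ?thesis by (simp add: algebra_simps)
  qed
  moreover have "f (c *\<^sub>R x) = c *\<^sub>R f x" for c x
  proof -
    have "(f (c *\<^sub>R x) - c *\<^sub>R f x) \<bullet> (f (c *\<^sub>R x) - c *\<^sub>R f x) = 0"
      by (simp add: inner_diff inner)
    then show ?thesis by simp
  qed
  ultimately show ?thesis unfolding f_def[symmetric] by (intro linearI)
qed

lemma barycentric_dist_nonneg: "0 \<le> barycentric_dist \<alpha> \<beta>"
  by (simp add: barycentric_dist_def sum_nonneg)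

lemma barycentric_dist_self [simp]: "barycentric_dist \<alpha> \<alpha> = 0"
  by (simp add: barycentric_dist_def)

lemma abs_diff_le_barycentric_dist:
  assumes "\<alpha> \<in> realization K" "\<beta> \<in> realization K" "abstract_complex K"
  shows "\<bar>\<alpha> v - \<beta> v\<bar> \<le> barycentric_dist \<alpha> \<beta>"
proof (cases "v \<in> supp \<alpha> \<union> supp \<beta>")
  case True
  have "finite (supp \<alpha> \<union> supp \<beta>)"
    using assms by (auto simp: realization_def abstract_complex_def)
  then have "(\<alpha> v - \<beta> v)\<^sup>2 \<le> (\<Sum>v\<in>supp \<alpha> \<union> supp \<beta>. (\<alpha> v - \<beta> v)\<^sup>2)"
    using True by (intro member_le_sum) auto
  then have "sqrt ((\<alpha> v - \<beta> v)\<^sup>2) \<le> barycentric_dist \<alpha> \<beta>"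
    unfolding barycentric_dist_def by (rule real_sqrt_le_mono)
  then show ?thesis by simp
next
  case False
  then show ?thesis using barycentric_dist_nonneg[of \<alpha> \<beta>] by (simp add: supp_def)
qed

section \<open>The embedded complex and its barycentric coordinates\<close>

locale riem_poly =
  fixes P :: "('v, 'a::metric_space, 'e::euclidean_space, 'n::finite) triangulated_polyhedron"
  assumes riemannian: "riemannian_polyhedron P"
begin

abbreviation "K \<equiv> cplx P"
abbreviation "R \<equiv> realization K"
abbreviation "pos \<equiv> affine_map (vpos P)"
definition "E = pos ` R"
definition "vhull s = convex hull (vpos P ` s)"
text \<open>Barycentric coordinates of a point of the embedded complex \<open>E\<close>. Through
  them \<open>chart\<close> leads from \<open>E\<close> to the polyhedron, and \<open>place\<close>
  leads back.\<close>

definition "unpos = inv_into R pos"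
definition "chart y = tri P (unpos y)"
definition "place q = pos (bary P q)"

lemma lipschitz_poly: "lipschitz_polyhedron P" and embedded: "euclidean_embedded P"
  using riemannian by (auto simp: riemannian_polyhedron_def)

lemma abstract_cplx: "abstract_complex K"
  using lipschitz_poly by (simp add: lipschitz_polyhedron_def)

lemma finite_simplex: "s \<in> K \<Longrightarrow> finite s" and nonempty_simplex: "s \<in> K \<Longrightarrow> s \<noteq> {}"
  using abstract_cplx by (auto simp: abstract_complex_def)

lemma face: "s \<in> K \<Longrightarrow> t \<subseteq> s \<Longrightarrow> t \<noteq> {} \<Longrightarrow> t \<in> K"
  using abstract_cplx unfolding abstract_complex_def by blast

lemma max_simplexD: "s \<in> max_simplexes P \<Longrightarrow> s \<in> K"
  by (simp add: maximal_simplexes_def)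

lemma countable_max: "countable (max_simplexes P)"
  using lipschitz_poly by (auto simp: lipschitz_polyhedron_def maximal_simplexes_def intro: countable_subset)

text \<open>Cardinalities of simplexes are bounded, so among the simplexes containing
  \<open>s\<close> one has the most vertices, and it cannot be enlarged.\<close>

lemma ex_max_simplex:
  assumes "s \<in> K" shows "\<exists>t\<in>max_simplexes P. s \<subseteq> t"
proof -
  obtain d where "\<forall>s\<in>K. card s \<le> d + 1"
    using lipschitz_poly unfolding lipschitz_polyhedron_def finite_dimensional_complex_def by blast
  then have d: "card s < d + 2" if "s \<in> K" for s using that by fastforce
  obtain t where t: "t \<in> K \<and> s \<subseteq> t" "\<And>t'. t' \<in> K \<and> s \<subseteq> t' \<Longrightarrow> card t' \<le> card t"
    using ex_has_greatest_nat[of "\<lambda>t. t \<in> K \<and> s \<subseteq> t" s card "d + 2"] assms d by auto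
  have "t' = t" if "t' \<in> K" "t \<subseteq> t'" for t'
    using t(2)[of t'] t(1) that card_seteq[of t' t] finite_simplex by auto
  then show ?thesis using t(1) by (auto simp: maximal_simplexes_def)
qed

text \<open>Sums over a fixed simplex replace sums over the support, which changes from point to
  point; this makes coordinates of two points of one closed simplex addable.\<close>

lemma realizationI:
  assumes "s \<in> K" "supp c \<subseteq> s" "\<And>v. 0 \<le> c v" "(\<Sum>v\<in>s. c v) = 1"
  shows "c \<in> R" "pos c = (\<Sum>v\<in>s. c v *\<^sub>R vpos P v)"
proof -
  have fin: "finite s" using assms finite_simplex by auto
  have s: "(\<Sum>v\<in>supp c. c v) = (\<Sum>v\<in>s. c v)"
    using assms fin by (intro sum.mono_neutral_left) (auto simp: supp_def)
  then have "supp c \<noteq> {}" using assms(4) by auto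
  then show "c \<in> R" using s assms face by (auto simp: realization_def)
  show "pos c = (\<Sum>v\<in>s. c v *\<^sub>R vpos P v)" unfolding affine_map_def
    using assms fin by (intro sum.mono_neutral_left) (auto simp: supp_def)
qed

lemma realizationD:
  assumes "c \<in> R" "s \<in> K" "supp c \<subseteq> s"
  shows "(\<Sum>v\<in>s. c v) = 1" "\<And>v. 0 \<le> c v"
proof -
  have "(\<Sum>v\<in>supp c. c v) = (\<Sum>v\<in>s. c v)"
    using assms finite_simplex by (intro sum.mono_neutral_left) (auto simp: supp_def)
  then show "(\<Sum>v\<in>s. c v) = 1" "\<And>v. 0 \<le> c v" using assms by (auto simp: realization_def)
qed

lemma convex_combination_realization:
  assumes "s \<in> K" "a \<in> R" "supp a \<subseteq> s" "b \<in> R" "supp b \<subseteq> s" "0 \<le> l" "0 \<le> m" "l + m = 1"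
  defines "c \<equiv> \<lambda>v. l * a v + m * b v"
  shows "c \<in> R" "supp c \<subseteq> s" "pos c = l *\<^sub>R pos a + m *\<^sub>R pos b"
proof -
  show sc: "supp c \<subseteq> s" using assms(3,5) by (fastforce simp: supp_def c_def)
  have nn: "0 \<le> c v" for v
    using realizationD[OF assms(2,1,3)] realizationD[OF assms(4,1,5)] assms(6,7) by (simp add: c_def)
  have sm: "(\<Sum>v\<in>s. c v) = 1"
    using realizationD[OF assms(2,1,3)] realizationD[OF assms(4,1,5)] assms(8)
    by (simp add: c_def sum.distrib sum_distrib_left[symmetric])
  note a = realizationI(2)[OF assms(1,3) realizationD(2)[OF assms(2,1,3)] realizationD(1)[OF assms(2,1,3)]]
  note b = realizationI(2)[OF assms(1,5) realizationD(2)[OF assms(4,1,5)] realizationD(1)[OF assms(4,1,5)]]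
  show "c \<in> R" by (rule realizationI[OF assms(1) sc nn sm])
  show "pos c = l *\<^sub>R pos a + m *\<^sub>R pos b"
    unfolding realizationI(2)[OF assms(1) sc nn sm] a b
    by (simp add: c_def scaleR_add_left sum.distrib scaleR_sum_right)
qed

lemma vertex_realization:
  assumes "s \<in> K" "v \<in> s"
  shows "indicator {v} \<in> R" "supp (indicator {v}) = {v}" "pos (indicator {v}) = vpos P v"
proof -
  show s: "supp (indicator {v}) = {v}" by (auto simp: supp_def indicator_def)
  have "{v} \<in> K" using face[OF assms(1), of "{v}"] assms(2) by auto
  then show "indicator {v} \<in> R" "pos (indicator {v}) = vpos P v"
    using realizationI[of "{v}" "indicator {v}"] s by auto
qed

text \<open>The image of a closed simplex is convex and contains the vertices, hence contains their
  hull; the other inclusion reads the coordinates as convex weights.\<close>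

lemma pos_simplex:
  assumes s: "s \<in> K" shows "pos ` {\<alpha> \<in> R. supp \<alpha> \<subseteq> s} = vhull s"
proof
  show "pos ` {\<alpha> \<in> R. supp \<alpha> \<subseteq> s} \<subseteq> vhull s"
  proof safe
    fix a assume a: "a \<in> R" "supp a \<subseteq> s"
    note ra = realizationD[OF a(1) s a(2)]
    show "pos a \<in> vhull s" unfolding realizationI(2)[OF s a(2) ra(2) ra(1)] vhull_def
      using ra finite_simplex[OF s]
      by (intro convex_sum[OF _ convex_convex_hull]) (auto intro: hull_inc)
  qed
  show "vhull s \<subseteq> pos ` {\<alpha> \<in> R. supp \<alpha> \<subseteq> s}"
    unfolding vhull_def
  proof (rule hull_minimal)
    show "vpos P ` s \<subseteq> pos ` {\<alpha> \<in> R. supp \<alpha> \<subseteq> s}"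
    proof safe
      fix v assume v: "v \<in> s"
      show "vpos P v \<in> pos ` {\<alpha> \<in> R. supp \<alpha> \<subseteq> s}"
        using vertex_realization[OF s v] v by (intro image_eqI[of _ _ "indicator {v}"]) auto
    qed
    show "convex (pos ` {\<alpha> \<in> R. supp \<alpha> \<subseteq> s})"
    proof (rule convexI, safe)
      fix a b and l m :: real assume *: "a \<in> R" "supp a \<subseteq> s" "b \<in> R" "supp b \<subseteq> s" "0 \<le> l" "0 \<le> m" "l + m = 1"
      from convex_combination_realization[OF s this]
      show "l *\<^sub>R pos a + m *\<^sub>R pos b \<in> pos ` {\<alpha> \<in> R. supp \<alpha> \<subseteq> s}"
        by (intro image_eqI[of _ _ "\<lambda>v. l * a v + m * b v"]) auto
    qed
  qed
qed

lemma vhull_subset_E: "s \<in> K \<Longrightarrow> vhull s \<subseteq> E"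
  using pos_simplex[of s] by (auto simp: E_def)

lemma inj_pos: "inj_on pos R"
  using embedded by (auto simp: euclidean_embedded_def lipschitz_homeomorphism_def Let_def bij_betw_def)

lemma unpos_pos [simp]: "\<alpha> \<in> R \<Longrightarrow> unpos (pos \<alpha>) = \<alpha>"
  unfolding unpos_def using inj_pos by (rule inv_into_f_f)

lemma pos_unpos [simp]: "y \<in> E \<Longrightarrow> pos (unpos y) = y"
  by (simp add: unpos_def E_def f_inv_into_f)

lemma unpos_in [simp]: "y \<in> E \<Longrightarrow> unpos y \<in> R"
  by (simp add: unpos_def E_def inv_into_into)

lemma supp_unpos: "s \<in> K \<Longrightarrow> y \<in> vhull s \<Longrightarrow> supp (unpos y) \<subseteq> s"
  using pos_simplex[of s] by (metis (mono_tags, lifting) imageE mem_Collect_eq unpos_pos)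

lemma tri_bij: "bij_betw (tri P) R UNIV"
  using lipschitz_poly by (auto simp: lipschitz_polyhedron_def lipschitz_homeomorphism_def)

lemma bary_in [simp]: "bary P q \<in> R"
  unfolding bary_def using tri_bij by (metis bij_betw_def inv_into_into UNIV_I)

lemma tri_bary [simp]: "tri P (bary P q) = q"
  unfolding bary_def using tri_bij by (metis bij_betw_def f_inv_into_f UNIV_I)

lemma bary_tri [simp]: "\<alpha> \<in> R \<Longrightarrow> bary P (tri P \<alpha>) = \<alpha>"
  unfolding bary_def using tri_bij by (metis bij_betw_def inv_into_f_f)

lemma place_chart [simp]: "y \<in> E \<Longrightarrow> place (chart y) = y"
  by (simp add: chart_def place_def)

lemma bary_chart: "y \<in> E \<Longrightarrow> bary P (chart y) = unpos y"
  by (simp add: chart_def)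

lemma chart_loc_lipschitz: "locally_lipschitz E dist dist chart"
proof -
  have "locally_lipschitz E dist dist (tri P \<circ> unpos)"
  proof (rule locally_lipschitz_compose)
    show "locally_lipschitz E dist barycentric_dist unpos"
      using embedded by (auto simp: euclidean_embedded_def lipschitz_homeomorphism_def Let_def unpos_def E_def)
    show "locally_lipschitz R barycentric_dist dist (tri P)"
      using lipschitz_poly by (auto simp: lipschitz_polyhedron_def lipschitz_homeomorphism_def)
  qed (auto simp: barycentric_dist_nonneg)
  then show ?thesis by (simp add: chart_def[abs_def] comp_def)
qed

lemma bary_loc_lipschitz: "locally_lipschitz UNIV dist barycentric_dist (bary P)"
  using lipschitz_poly by (auto simp: lipschitz_polyhedron_def lipschitz_homeomorphism_def bary_def[abs_def])

lemma chart_continuous: "continuous_on E chart"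
  by (rule locally_lipschitz_continuous_on[OF chart_loc_lipschitz])

text \<open>A single coordinate is 1-Lipschitz for \<open>barycentric_dist\<close>. This is what
  makes vertex stars open.\<close>

lemma bary_coord_continuous: "continuous_on UNIV (\<lambda>q. bary P q v)"
proof (rule locally_lipschitz_continuous_on)
  have "locally_lipschitz UNIV dist dist ((\<lambda>\<alpha>. \<alpha> v) \<circ> bary P)"
  proof (rule locally_lipschitz_compose[OF bary_loc_lipschitz])
    have "dist (\<alpha> v) (\<beta> v) \<le> 1 * barycentric_dist \<alpha> \<beta>" if "\<alpha> \<in> R" "\<beta> \<in> R" for \<alpha> \<beta>
      using abs_diff_le_barycentric_dist[OF that abstract_cplx] by (simp add: dist_real_def)
    then show "locally_lipschitz R barycentric_dist dist (\<lambda>\<alpha>. \<alpha> v)"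
      unfolding locally_lipschitz_def by (meson zero_less_one)
  qed (auto simp: barycentric_dist_nonneg)
  then show "locally_lipschitz UNIV dist dist (\<lambda>q. bary P q v)" by (simp add: comp_def)
qed

end

lemma null_if_dilations_null:
  fixes B :: "'a::euclidean_space set"
  assumes N: "negligible N" and a: "0 < a" shows "negligible {v::'a. b + a *\<^sub>R v \<in> N}"
proof -
  have "{v. b + a *\<^sub>R v \<in> N} = (\<lambda>x. (1 / a) *\<^sub>R (x - b)) ` N"
    using a by (auto simp: image_iff intro!: bexI[of _ "b + a *\<^sub>R _"])
  then show ?thesis
    using N by (auto intro!: negligible_differentiable_image_negligible derivative_intros)
qed

section \<open>Coordinate simplexes: full dimension, interior and parametrization\<close>

context riem_poly
begin

definition "S s = coord_simplex P s"

lemma euc_dist: "s \<in> max_simplexes P \<Longrightarrow> dist (euc P s x) (euc P s y) = dist x y"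
  and euc_range: "s \<in> max_simplexes P \<Longrightarrow> range (euc P s) = affine hull (vpos P ` s)"
  and gmat_meas: "s \<in> max_simplexes P \<Longrightarrow> gmat P s \<in> borel_measurable (lebesgue_on (S s))"
  using riemannian by (auto simp: riemannian_polyhedron_def S_def)

lemma euc_affine:
  assumes "s \<in> max_simplexes P"
  obtains f where "linear f" "\<And>x. euc P s x = euc P s 0 + f x"
proof (rule that[of "\<lambda>x. euc P s x - euc P s 0"])
  show "linear (\<lambda>x. euc P s x - euc P s 0)" by (rule isometry_affine) (rule euc_dist[OF assms])
qed simp

lemma inj_euc: "s \<in> max_simplexes P \<Longrightarrow> inj (euc P s)"
  using euc_dist by (metis (no_types, lifting) dist_eq_0_iff injI)

lemma S_iff: "x \<in> S s \<longleftrightarrow> euc P s x \<in> vhull s"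
  by (simp add: S_def coord_simplex_def vhull_def)

lemma euc_S: assumes "s \<in> max_simplexes P" shows "euc P s ` S s = vhull s"
proof -
  have "vhull s \<subseteq> range (euc P s)"
    unfolding euc_range[OF assms] vhull_def by (rule convex_hull_subset_affine_hull)
  then show ?thesis by (auto simp: S_iff)
qed

lemma euc_continuous: "s \<in> max_simplexes P \<Longrightarrow> continuous_on A (euc P s)"
  by (auto simp: continuous_on_iff euc_dist)

lemma compact_vhull: "s \<in> K \<Longrightarrow> compact (vhull s)"
  unfolding vhull_def by (intro finite_imp_compact_convex_hull) (auto simp: finite_simplex)

lemma euc_combination:
  assumes "s \<in> max_simplexes P" "l + m = 1"
  shows "euc P s (l *\<^sub>R x + m *\<^sub>R y) = l *\<^sub>R euc P s x + m *\<^sub>R euc P s y"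
proof -
  obtain f where f: "linear f" "\<And>x. euc P s x = euc P s 0 + f x" using euc_affine[OF assms(1)] by blast
  have "euc P s (l *\<^sub>R x + m *\<^sub>R y) = (l + m) *\<^sub>R euc P s 0 + f (l *\<^sub>R x + m *\<^sub>R y)"
    using f(2)[of "l *\<^sub>R x + m *\<^sub>R y"] assms(2) by simp
  also have "\<dots> = l *\<^sub>R (euc P s 0 + f x) + m *\<^sub>R (euc P s 0 + f y)"
    by (simp add: linear_add[OF f(1)] linear_scale[OF f(1)] algebra_simps)
  finally show ?thesis by (simp only: f(2)[symmetric])
qed

lemma convex_S: assumes "s \<in> max_simplexes P" shows "convex (S s)"
proof (rule convexI)
  fix x y and l m :: real assume *: "x \<in> S s" "y \<in> S s" "0 \<le> l" "0 \<le> m" "l + m = 1"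
  then show "l *\<^sub>R x + m *\<^sub>R y \<in> S s"
    unfolding S_iff euc_combination[OF assms *(5)] vhull_def
    by (intro convexD[OF convex_convex_hull])
qed

lemma compact_S: assumes "s \<in> max_simplexes P" shows "compact (S s)"
proof -
  have "closed (vhull s)" using compact_vhull max_simplexD assms by (auto intro: compact_imp_closed)
  then have "closed (S s)"
    using continuous_closed_vimage[of "vhull s" "euc P s"] euc_continuous[OF assms]
    by (auto simp: S_iff vimage_def continuous_on_eq_continuous_within S_def coord_simplex_def vhull_def)
  moreover have "bounded (S s)"
  proof -
    have "bounded (vhull s)" using compact_vhull max_simplexD assms by (auto intro: compact_imp_bounded)
    then obtain B where B: "\<And>y. y \<in> vhull s \<Longrightarrow> dist (euc P s 0) y \<le> B" by (metis bounded_any_center)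
    have "dist 0 x \<le> B" if "x \<in> S s" for x
      using B[of "euc P s x"] that euc_dist[OF assms, of 0 x] by (simp add: S_iff)
    then show ?thesis by (metis bounded_any_center)
  qed
  ultimately show ?thesis by (simp add: compact_eq_bounded_closed)
qed

text \<open>The coordinates range over exactly the affine hull of the vertices, so
  \<open>S s\<close> affinely spans the coordinate space. Its relative interior, nonempty by
  convexity, is therefore its interior.\<close>

lemma interior_S_nonempty:
  assumes "s \<in> max_simplexes P" shows "interior (S s) \<noteq> {}"
proof -
  obtain f where f: "linear f" "\<And>x. euc P s x = euc P s 0 + f x" using euc_affine[OF assms] by blast
  have im: "euc P s ` A = (+) (euc P s 0) ` (f ` A)" for A
  proof -
    have "euc P s ` A = (\<lambda>x. euc P s 0 + f x) ` A" by (rule image_cong[OF refl]) (rule f(2))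
    then show ?thesis by (simp only: image_image)
  qed
  have "euc P s ` (affine hull S s) = affine hull (euc P s ` S s)"
    unfolding im by (simp add: affine_hull_translation affine_hull_linear_image[OF linear_conv_bounded_linear[THEN iffD1, OF f(1)]])
  also have "\<dots> = range (euc P s)"
    by (simp add: euc_S[OF assms] vhull_def affine_hull_convex_hull euc_range[OF assms])
  finally have "affine hull S s = UNIV"
    using inj_euc[OF assms] by (metis inj_image_eq_iff)
  then have "rel_interior (S s) = interior (S s)" by (rule rel_interior_interior)
  moreover have "S s \<noteq> {}"
    using euc_S[OF assms] nonempty_simplex[OF max_simplexD[OF assms]]
    by (metis convex_hull_eq_empty image_is_empty vhull_def)
  ultimately show ?thesis using rel_interior_eq_empty[OF convex_S[OF assms]] by auto
qed

lemma closure_interior_S: "s \<in> max_simplexes P \<Longrightarrow> closure (interior (S s)) = S s"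
  using convex_closure_interior[OF convex_S interior_S_nonempty] compact_S
  by (simp add: compact_imp_closed)

lemma negligible_boundary_S: "s \<in> max_simplexes P \<Longrightarrow> negligible (S s - interior (S s))"
  using negligible_convex_frontier[OF convex_S] compact_S
  by (simp add: frontier_def compact_imp_closed)

lemma S_measurable: "s \<in> max_simplexes P \<Longrightarrow> S s \<in> sets borel"
  using compact_S by (simp add: borel_compact)

lemma pt_eq: "pt P (s, x) = chart (euc P s x)"
  by (simp add: pt_def chart_def unpos_def)

lemma euc_in_E: "s \<in> max_simplexes P \<Longrightarrow> x \<in> S s \<Longrightarrow> euc P s x \<in> E"
  using vhull_subset_E max_simplexD by (auto simp: S_iff)

lemma place_pt: "s \<in> max_simplexes P \<Longrightarrow> x \<in> S s \<Longrightarrow> place (pt P (s, x)) = euc P s x"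
  by (simp add: pt_eq euc_in_E)

lemma loc_pt: "s \<in> max_simplexes P \<Longrightarrow> x \<in> S s \<Longrightarrow> loc P s (pt P (s, x)) = x"
  using place_pt inj_euc by (simp add: loc_def place_def inv_f_f)

lemma pt_loc_lipschitz:
  assumes "s \<in> max_simplexes P" shows "locally_lipschitz (S s) dist dist (\<lambda>x. pt P (s, x))"
proof -
  have "locally_lipschitz (S s) dist dist (chart \<circ> euc P s)"
  proof (rule locally_lipschitz_compose[OF _ chart_loc_lipschitz])
    show "locally_lipschitz (S s) dist dist (euc P s)"
      unfolding locally_lipschitz_def euc_dist[OF assms] by (metis mult_1 order_refl zero_less_one)
  qed (use euc_in_E assms in auto)
  then show ?thesis by (simp add: pt_eq comp_def)
qed

lemma pt_continuous: "s \<in> max_simplexes P \<Longrightarrow> continuous_on (S s) (\<lambda>x. pt P (s, x))"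
  by (rule locally_lipschitz_continuous_on[OF pt_loc_lipschitz])

lemma pt_lipschitz: "s \<in> max_simplexes P \<Longrightarrow> \<exists>L. L-lipschitz_on (S s) (\<lambda>x. pt P (s, x))"
  by (rule locally_lipschitz_imp_lipschitz_on_compact[OF pt_loc_lipschitz compact_S]) auto

lemma closed_cell_eq: assumes "s \<in> max_simplexes P" shows "(\<lambda>x. pt P (s, x)) ` S s = closed_cell P s"
proof -
  have "(\<lambda>x. pt P (s, x)) ` S s = chart ` (euc P s ` S s)" by (auto simp: pt_eq)
  also have "\<dots> = chart ` (pos ` {\<alpha> \<in> R. supp \<alpha> \<subseteq> s})"
    using euc_S[OF assms] pos_simplex[OF max_simplexD[OF assms]] by simp
  also have "\<dots> = closed_cell P s"
    unfolding closed_cell_def image_image by (intro image_cong) (auto simp: chart_def)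
  finally show ?thesis .
qed

lemma compact_closed_cell: "s \<in> max_simplexes P \<Longrightarrow> compact (closed_cell P s)"
  using compact_continuous_image[OF pt_continuous compact_S] closed_cell_eq by metis

text \<open>From an interior point one can move a little away from any vertex \<open>w\<close>
  without leaving the simplex. The point is then a convex combination of the new point and
  \<open>w\<close> with positive weight on \<open>w\<close>, so the coordinate at that vertex is
  positive.\<close>

lemma supp_interior:
  assumes s: "s \<in> max_simplexes P" and x: "x \<in> interior (S s)"
  shows "supp (unpos (euc P s x)) = s"
proof
  have sK: "s \<in> K" using s by (rule max_simplexD)
  have xS: "x \<in> S s" using x interior_subset by auto
  let ?a = "unpos (euc P s x)"
  show "supp ?a \<subseteq> s" using supp_unpos[OF sK] xS by (simp add: S_iff)
  obtain f where f: "linear f" "\<And>x. euc P s x = euc P s 0 + f x" using euc_affine[OF s] by blast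
  show "s \<subseteq> supp ?a"
  proof
    fix v assume v: "v \<in> s"
    note vr = vertex_realization[OF sK v]
    have "vpos P v \<in> vhull s" using v by (auto simp: vhull_def intro: hull_inc)
    then obtain w where w: "w \<in> S s" "euc P s w = vpos P v" using euc_S[OF s] by (metis imageE)
    obtain r where r: "0 < r" "ball x r \<subseteq> S s" using x by (auto simp: mem_interior)
    \<comment> \<open>Chosen so that the displacement \<open>e *\<^sub>R (w - x)\<close> is shorter
      than \<open>r\<close>, also when \<open>w = x\<close>.\<close>
    define e where "e = r / (2 * (norm (w - x) + 1))"
    have pos: "0 < norm (w - x) + 1" by (simp add: add_nonneg_pos)
    then have e: "0 < e" using r(1) unfolding e_def
      by (intro divide_pos_pos mult_pos_pos) (assumption | rule zero_less_numeral)+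
    define x' where "x' = x - e *\<^sub>R (w - x)"
    have "norm (e *\<^sub>R (w - x)) < r"
    proof -
      have quot: "norm (w - x) / (norm (w - x) + 1) \<le> 1"
        unfolding divide_le_eq_1_pos[OF pos] by simp
      have "norm (e *\<^sub>R (w - x)) = e * norm (w - x)" using e by simp
      also have "\<dots> = r / 2 * (norm (w - x) / (norm (w - x) + 1))"
        using e by (simp add: e_def)
      also have "\<dots> \<le> r / 2 * 1" using mult_left_mono[OF quot, of "r / 2"] r(1) by simp
      also have "\<dots> < r" using r by simp
      finally show ?thesis .
    qed
    then have x': "x' \<in> S s" using r by (auto simp: x'_def dist_norm subset_iff)
    \<comment> \<open>Normalized weights of the identity
      \<open>(1 + e) *\<^sub>R x = x' + e *\<^sub>R w\<close>.\<close>
    define l m where "l = 1 / (1 + e)" and "m = e / (1 + e)"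
    have lm: "0 < l" "0 < m" "l + m = 1" using e by (auto simp: l_def m_def field_simps)
    have xx: "x = l *\<^sub>R x' + m *\<^sub>R w"
    proof -
      have "(1 + e) *\<^sub>R x = x' + e *\<^sub>R w" by (simp add: x'_def algebra_simps)
      then have "l *\<^sub>R ((1 + e) *\<^sub>R x) = l *\<^sub>R (x' + e *\<^sub>R w)" by simp
      then show ?thesis using e by (simp add: l_def m_def scaleR_add_right)
    qed
    have ex: "euc P s x = l *\<^sub>R euc P s x' + m *\<^sub>R euc P s w"
      by (subst xx) (rule euc_combination[OF s lm(3)])
    let ?b = "unpos (euc P s x')"
    have b: "?b \<in> R" "supp ?b \<subseteq> s" "pos ?b = euc P s x'"
      using euc_in_E[OF s x'] supp_unpos[OF sK] x' by (auto simp: S_iff)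
    note comb = convex_combination_realization[OF sK b(1,2) vr(1), of l m]
    have "pos (\<lambda>u. l * ?b u + m * indicator {v} u) = euc P s x"
      using comb(3) lm v vr b(3) ex w(2) by auto
    then have "?a = (\<lambda>u. l * ?b u + m * indicator {v} u)"
      using comb(1) lm v vr by (metis unpos_pos less_imp_le empty_subsetI insert_subset)
    moreover have "0 \<le> ?b v" using realizationD(2)[OF b(1) sK b(2)] .
    ultimately have "?a v > 0" using lm by (simp add: add_nonneg_pos)
    then show "v \<in> supp ?a" by (simp add: supp_def)
  qed
qed

end

section \<open>Uniformly elliptic matrices and the volume measure\<close>

lemma sigma_finite_lebesgue: "sigma_finite_measure (lebesgue :: 'a::euclidean_space measure)"
proof
  show "\<exists>A. countable A \<and> A \<subseteq> sets (lebesgue :: 'a measure) \<and> \<Union> A = space lebesgue \<and> (\<forall>a\<in>A. emeasure lebesgue a \<noteq> \<infinity>)"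
  proof (intro exI conjI)
    show "\<Union> (range (\<lambda>n. cball (0::'a) (real n))) = space lebesgue"
      by (auto simp: real_arch_simple)
    show "\<forall>a\<in>range (\<lambda>n. cball (0::'a) (real n)). emeasure lebesgue a \<noteq> \<infinity>"
    proof safe
      fix n assume "emeasure lebesgue (cball (0::'a) (real n)) = \<infinity>"
      then show False using emeasure_lborel_cball_finite[of "0::'a" "real n"] by simp
    qed
  qed auto
qed

text \<open>Completeness of Lebesgue measure: whatever \<open>f\<close> does on \<open>N\<close>,
  the part of a preimage inside \<open>N\<close> is measurable.\<close>

lemma borel_measurable_lebesgue_negligible:
  fixes f g :: "'a::euclidean_space \<Rightarrow> 'b::topological_space"
  assumes g: "g \<in> borel_measurable lebesgue" and N: "negligible N" and eq: "\<And>x. x \<notin> N \<Longrightarrow> f x = g x"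
  shows "f \<in> borel_measurable lebesgue"
proof (rule measurableI)
  fix B :: "'b set" assume B: "B \<in> sets borel"
  have "f -` B \<inter> space lebesgue = (g -` B - N) \<union> (f -` B \<inter> N)"
    using eq by auto
  moreover have "g -` B \<in> sets lebesgue" using measurable_sets[OF g B] by simp
  moreover have "N \<in> sets lebesgue" "f -` B \<inter> N \<in> sets lebesgue"
    using N by (auto intro: negligible_imp_sets negligible_subset)
  ultimately show "f -` B \<inter> space lebesgue \<in> sets lebesgue" by (metis sets.Un sets.Diff)
qed auto

lemma borel_measurable_lebesgue_on_negligible:
  fixes f g :: "'a::euclidean_space \<Rightarrow> 'b::real_normed_vector"
  assumes S: "S \<in> sets lebesgue" and g: "g \<in> borel_measurable (lebesgue_on S)"
    and N: "negligible N" and eq: "\<And>x. x \<in> S \<Longrightarrow> x \<notin> N \<Longrightarrow> f x = g x"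
  shows "f \<in> borel_measurable (lebesgue_on S)"
proof -
  have "(\<lambda>x. indicator S x *\<^sub>R g x) \<in> borel_measurable lebesgue"
    using g S by (simp add: borel_measurable_restrict_space_iff)
  then have "(\<lambda>x. indicator S x *\<^sub>R f x) \<in> borel_measurable lebesgue"
    by (rule borel_measurable_lebesgue_negligible[OF _ N]) (auto simp: indicator_def eq)
  then show ?thesis using S by (simp add: borel_measurable_restrict_space_iff)
qed

lemma continuous_on_det: "continuous_on A (det :: real^'n^'n \<Rightarrow> real)"
  unfolding det_def[abs_def] by (intro continuous_intros)

lemma matrix_inv_mult:
  fixes A :: "'a::field^'n^'n"
  assumes "invertible A" shows "A ** matrix_inv A = mat 1" "matrix_inv A ** A = mat 1"
  using someI_ex[OF assms[unfolded invertible_def]] by (auto simp: matrix_inv_def)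

definition elliptic :: "real \<Rightarrow> real^'n^'n \<Rightarrow> bool" where
  "elliptic L g \<longleftrightarrow> transpose g = g \<and>
     (\<forall>\<xi>. inverse (L\<^sup>2) * (norm \<xi>)\<^sup>2 \<le> \<xi> \<bullet> (g *v \<xi>) \<and> \<xi> \<bullet> (g *v \<xi>) \<le> L\<^sup>2 * (norm \<xi>)\<^sup>2)"

text \<open>Every matrix on the segment from the identity to \<open>g\<close> is positive definite,
  hence nonsingular. The determinant starts at 1 and never vanishes along the segment, so it stays
  positive.\<close>

lemma positive_definite_det_pos:
  fixes g :: "real^'n^'n"
  assumes "\<And>\<xi>. \<xi> \<noteq> 0 \<Longrightarrow> 0 < \<xi> \<bullet> (g *v \<xi>)"
  shows "0 < det g"
proof -
  let ?h = "\<lambda>t::real. (1 - t) *\<^sub>R mat 1 + t *\<^sub>R g"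
  have quad: "\<xi> \<bullet> (?h t *v \<xi>) = (1 - t) * (\<xi> \<bullet> \<xi>) + t * (\<xi> \<bullet> (g *v \<xi>))" for t \<xi>
    by (simp add: matrix_vector_mult_add_rdistrib inner_add scaleR_matrix_vector_assoc[symmetric])
  have nz: "det (?h t) \<noteq> 0" if t: "0 \<le> t" "t \<le> 1" for t
  proof
    assume "det (?h t) = 0"
    then have "\<not> invertible (?h t)" by (simp add: invertible_det_nz)
    then obtain \<xi> where \<xi>: "\<xi> \<noteq> 0" "?h t *v \<xi> = 0"
      unfolding invertible_left_inverse matrix_left_invertible_ker by blast
    have "0 < (1 - t) * (\<xi> \<bullet> \<xi>) + t * (\<xi> \<bullet> (g *v \<xi>))"
    proof (cases "t = 1")
      case True
      then show ?thesis using assms[OF \<xi>(1)] by simp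
    next
      case False
      then have "0 < (1 - t) * (\<xi> \<bullet> \<xi>)" using t \<xi>(1) by (intro mult_pos_pos) auto
      moreover have "0 \<le> t * (\<xi> \<bullet> (g *v \<xi>))" using t assms[OF \<xi>(1)] by simp
      ultimately show ?thesis by simp
    qed
    then show False using quad[of \<xi> t] \<xi>(2) by simp
  qed
  show ?thesis
  proof (rule ccontr)
    assume "\<not> 0 < det g"
    moreover have "continuous_on {0..1} (\<lambda>t. det (?h t))"
      by (intro continuous_on_compose2[OF continuous_on_det[of UNIV]] continuous_intros) auto
    ultimately obtain t where "0 \<le> t" "t \<le> 1" "det (?h t) = 0"
      using IVT2'[of "\<lambda>t. det (?h t)" 1 0 0] by (auto simp: det_I)
    then show False using nz by blast
  qed
qed

lemma elliptic_pos: "elliptic L g \<Longrightarrow> 0 < L \<Longrightarrow> \<xi> \<noteq> 0 \<Longrightarrow> 0 < \<xi> \<bullet> (g *v \<xi>)"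
  unfolding elliptic_def
  by (rule less_le_trans[of _ "inverse (L\<^sup>2) * (norm \<xi>)\<^sup>2"]) auto

lemma elliptic_nonneg: "elliptic L g \<Longrightarrow> 0 \<le> \<xi> \<bullet> (g *v \<xi>)"
  unfolding elliptic_def by (rule order_trans[of _ "inverse (L\<^sup>2) * (norm \<xi>)\<^sup>2"]) auto

lemma elliptic_det_pos: "elliptic L g \<Longrightarrow> 0 < L \<Longrightarrow> 0 < det g"
  by (rule positive_definite_det_pos) (rule elliptic_pos)

lemma elliptic_invertible: "elliptic L g \<Longrightarrow> 0 < L \<Longrightarrow> invertible g"
  using elliptic_det_pos by (force simp: invertible_det_nz)

lemma elliptic_symmetric: "elliptic L g \<Longrightarrow> \<xi> \<bullet> (g *v \<eta>) = \<eta> \<bullet> (g *v \<xi>)"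
  by (metis dot_lmul_matrix elliptic_def inner_commute transpose_matrix_vector vector_transpose_matrix)

text \<open>Polarization on the sum of two axis vectors, whose norm is at most 2: the quadratic form
  there lies between 0 and \<open>4 * L\<^sup>2\<close>, and the diagonal entries lie between 0 and
  \<open>L\<^sup>2\<close>.\<close>

lemma elliptic_entry_bound:
  assumes "elliptic L g" shows "\<bar>g $ i $ j\<bar> \<le> 2 * L\<^sup>2"
proof -
  have entry: "axis i 1 \<bullet> (g *v axis j 1) = g $ i $ j" for i j
    by (simp add: inner_axis' matrix_vector_mul_component inner_axis)
  have diag: "0 \<le> g $ i $ i" "g $ i $ i \<le> L\<^sup>2" for i
    using assms elliptic_nonneg[OF assms, of "axis i 1"] entry[of i i]
    unfolding elliptic_def by (auto dest!: spec[of _ "axis i 1"])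
  let ?z = "axis i 1 + axis j 1 :: real^'a"
  have "g $ j $ i = g $ i $ j"
    using elliptic_symmetric[OF assms, of "axis i 1" "axis j 1"] by (simp add: entry)
  then have z: "?z \<bullet> (g *v ?z) = g $ i $ i + 2 * g $ i $ j + g $ j $ j"
    by (simp add: matrix_vector_right_distrib inner_add entry)
  have "norm ?z \<le> 2" using norm_triangle_ineq[of "axis i 1" "axis j 1 :: real^'a"] by simp
  then have "(norm ?z)\<^sup>2 \<le> 2\<^sup>2" by (intro power_mono) auto
  then have "?z \<bullet> (g *v ?z) \<le> L\<^sup>2 * 2\<^sup>2"
    using assms unfolding elliptic_def by (meson mult_left_mono order_trans zero_le_power2)
  moreover have "0 \<le> ?z \<bullet> (g *v ?z)" by (rule elliptic_nonneg[OF assms])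
  ultimately show ?thesis using diag[of i] diag[of j] unfolding z by (simp add: abs_le_iff)
qed

lemma compact_elliptic: "compact {g::real^'n^'n. elliptic L g}"
  unfolding compact_eq_bounded_closed
proof
  show "bounded {g::real^'n^'n. elliptic L g}"
  proof (rule boundedI)
    fix g :: "real^'n^'n" assume "g \<in> {g. elliptic L g}"
    then have g: "elliptic L g" by simp
    have "norm g \<le> (\<Sum>i\<in>UNIV. norm (g $ i))" by (simp add: norm_vec_def L2_set_le_sum)
    also have "\<dots> \<le> (\<Sum>i\<in>(UNIV::'n set). \<Sum>j\<in>(UNIV::'n set). 2 * L\<^sup>2)"
    proof (rule sum_mono)
      fix i
      have "norm (g $ i) \<le> (\<Sum>j\<in>UNIV. \<bar>g $ i $ j\<bar>)" by (rule norm_le_l1_cart)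
      also have "\<dots> \<le> (\<Sum>j\<in>(UNIV::'n set). 2 * L\<^sup>2)" by (intro sum_mono elliptic_entry_bound[OF g])
      finally show "norm (g $ i) \<le> (\<Sum>j\<in>(UNIV::'n set). 2 * L\<^sup>2)" .
    qed
    finally show "norm g \<le> (\<Sum>i\<in>(UNIV::'n set). \<Sum>j\<in>(UNIV::'n set). 2 * L\<^sup>2)" .
  qed
  have cv: "continuous_on UNIV (\<lambda>g::real^'n^'n. \<xi> \<bullet> (g *v \<xi>))" for \<xi>
    unfolding matrix_vector_mult_def inner_vec_def by (intro continuous_intros)
  have ct: "continuous_on UNIV (transpose :: real^'n^'n \<Rightarrow> _)"
    unfolding transpose_def[abs_def] by (intro continuous_intros)
  show "closed {g::real^'n^'n. elliptic L g}"
    unfolding elliptic_def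
    by (intro closed_Collect_conj closed_Collect_all closed_Collect_eq closed_Collect_le ct cv continuous_intros)
qed

text \<open>The determinant is continuous and positive on the compact set of elliptic matrices, so
  it attains a positive minimum. This bounds the volume density from below, uniformly over all
  simplexes.\<close>

lemma elliptic_det_lower:
  assumes "0 < L"
  shows "\<exists>\<delta>>0. \<forall>g::real^'n^'n. elliptic L g \<longrightarrow> \<delta> \<le> det g"
proof (cases "{g::real^'n^'n. elliptic L g} = {}")
  case True
  then show ?thesis by (intro exI[of _ 1]) auto
next
  case False
  have "\<exists>g0\<in>{g::real^'n^'n. elliptic L g}. \<forall>g\<in>{g::real^'n^'n. elliptic L g}. det g0 \<le> det g"
    by (rule continuous_attains_inf[OF compact_elliptic False continuous_on_det])
  then obtain g0 :: "real^'n^'n" where g0: "elliptic L g0" "\<forall>g::real^'n^'n. elliptic L g \<longrightarrow> det g0 \<le> det g"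
    by auto
  then show ?thesis using elliptic_det_pos[OF g0(1) assms] by (intro exI[of _ "det g0"]) auto
qed

section \<open>The volume measure, simplex by simplex\<close>

context riem_poly
begin

definition "Lam = (SOME L. 0 < L \<and> (\<forall>s\<in>max_simplexes P. AE x in lebesgue_on (S s). elliptic L (gmat P s x)))"

lemma Lam: "0 < Lam" "s \<in> max_simplexes P \<Longrightarrow> AE x in lebesgue_on (S s). elliptic Lam (gmat P s x)"
proof -
  have "\<exists>L. 0 < L \<and> (\<forall>s\<in>max_simplexes P. AE x in lebesgue_on (S s). elliptic L (gmat P s x))"
    using riemannian unfolding riemannian_polyhedron_def S_def elliptic_def by blast
  from someI_ex[OF this] show "0 < Lam" "s \<in> max_simplexes P \<Longrightarrow> AE x in lebesgue_on (S s). elliptic Lam (gmat P s x)"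
    by (auto simp: Lam_def)
qed

definition "M0 = count_space (max_simplexes P) \<Otimes>\<^sub>M (lebesgue :: (real^'n) measure)"

text \<open>There are only countably many maximal simplexes, so a set with measurable slices is a
  countable union of rectangles \<open>{s} \<times> _\<close>.\<close>

lemma sets_M0_iff:
  "A \<in> sets M0 \<longleftrightarrow> A \<subseteq> max_simplexes P \<times> UNIV \<and> (\<forall>s\<in>max_simplexes P. {x. (s, x) \<in> A} \<in> sets lebesgue)"
proof safe
  fix s x assume "A \<in> sets M0" "(s, x) \<in> A"
  then show "s \<in> max_simplexes P" using sets.sets_into_space[of A M0] by (auto simp: M0_def space_pair_measure)
next
  fix s assume "A \<in> sets M0"
  then show "{x. (s, x) \<in> A} \<in> sets lebesgue"
    using sets_Pair1[of A "count_space (max_simplexes P)" lebesgue s] by (simp add: M0_def vimage_def)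
next
  assume A: "A \<subseteq> max_simplexes P \<times> UNIV" "\<forall>s\<in>max_simplexes P. {x. (s, x) \<in> A} \<in> sets lebesgue"
  have "A = (\<Union>s\<in>max_simplexes P. {s} \<times> {x. (s, x) \<in> A})" using A(1) by auto
  also have "\<dots> \<in> sets M0" unfolding M0_def
    using A(2) by (intro sets.countable_UN' countable_max pair_measureI) auto
  finally show "A \<in> sets M0" .
qed simp

text \<open>Counting measure gives \<open>{s}\<close> mass one, so slices of a null set are null;
  conversely, countably many null slices have a null union.\<close>

lemma AE_M0_iff: "(AE q in M0. Q q) \<longleftrightarrow> (\<forall>s\<in>max_simplexes P. AE x in lebesgue. Q (s, x))"
proof safe
  interpret sigma_finite_measure "lebesgue :: (real^'n) measure" by (rule sigma_finite_lebesgue)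
  fix s assume ae: "AE q in M0. Q q" and s: "s \<in> max_simplexes P"
  obtain N where N: "\<And>q. q \<in> space M0 - N \<Longrightarrow> Q q" "N \<in> null_sets M0"
    using AE_E3[OF ae] by blast
  have m: "{x. (s, x) \<in> N} \<in> sets lebesgue" using N(2) s sets_M0_iff by (auto simp: null_sets_def)
  have "emeasure lebesgue {x. (s, x) \<in> N} = emeasure M0 ({s} \<times> {x. (s, x) \<in> N})"
    using m s unfolding M0_def by (subst emeasure_pair_measure_Times) auto
  also have "\<dots> \<le> emeasure M0 N" using N(2) by (intro emeasure_mono) (auto simp: null_sets_def)
  also have "\<dots> = 0" using N(2) by (auto simp: null_sets_def)
  finally have "{x. (s, x) \<in> N} \<in> null_sets lebesgue" using m by (auto simp: null_sets_def)
  then show "AE x in lebesgue. Q (s, x)"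
    by (rule AE_I') (use N(1)[of "(s, _)"] s in \<open>auto simp: M0_def space_pair_measure\<close>)
next
  interpret sigma_finite_measure "lebesgue :: (real^'n) measure" by (rule sigma_finite_lebesgue)
  assume a: "\<forall>s\<in>max_simplexes P. AE x in lebesgue. Q (s, x)"
  have "\<exists>N. N \<in> null_sets lebesgue \<and> {x. \<not> Q (s, x)} \<subseteq> N" if s: "s \<in> max_simplexes P" for s
  proof -
    obtain N where "\<And>x. x \<in> space lebesgue - N \<Longrightarrow> Q (s, x)" "N \<in> null_sets lebesgue"
      using AE_E3[OF a[rule_format, OF s]] by blast
    then show ?thesis by (intro exI[of _ N]) auto
  qed
  then obtain N where N: "\<And>s. s \<in> max_simplexes P \<Longrightarrow> N s \<in> null_sets lebesgue \<and> {x. \<not> Q (s, x)} \<subseteq> N s"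
    by metis
  have "(\<Union>s\<in>max_simplexes P. {s} \<times> N s) \<in> null_sets M0"
  proof (rule null_sets_UN'[OF countable_max])
    fix s assume "s \<in> max_simplexes P"
    then show "{s} \<times> N s \<in> null_sets M0"
      using N unfolding M0_def by (intro times_in_null_sets2) auto
  qed
  then show "AE q in M0. Q q"
    by (rule AE_I') (use N in \<open>auto simp: M0_def space_pair_measure\<close>)
qed

lemma S_lebesgue: "s \<in> max_simplexes P \<Longrightarrow> S s \<in> sets lebesgue"
  using S_measurable by simp

definition "allq = over P UNIV"

lemma allq_iff: "(s, x) \<in> allq \<longleftrightarrow> s \<in> max_simplexes P \<and> x \<in> S s"
  by (simp add: allq_def over_def S_def)

lemma over_iff: "(s, x) \<in> over P U \<longleftrightarrow> s \<in> max_simplexes P \<and> x \<in> S s \<and> pt P (s, x) \<in> U"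
  by (simp add: over_def S_def)

lemma allq_sets: "allq \<in> sets M0"
proof -
  have "{x. (s, x) \<in> allq} = S s" if "s \<in> max_simplexes P" for s using that by (auto simp: allq_iff)
  then show ?thesis using S_lebesgue by (auto simp: sets_M0_iff allq_iff)
qed

lemma measurable_allq:
  fixes F :: "'v set \<times> (real^'n) \<Rightarrow> 'z::topological_space"
  assumes F: "\<And>s. s \<in> max_simplexes P \<Longrightarrow> (\<lambda>x. F (s, x)) \<in> borel_measurable (lebesgue_on (S s))"
  shows "F \<in> borel_measurable (restrict_space M0 allq)"
proof -
  \<comment> \<open>The codomain is only a topological space and may lack a zero, so the extension
    beyond \<open>allq\<close> uses an arbitrary fixed value.\<close>
  define c :: 'z where "c = undefined"
  have "(\<lambda>q. if q \<in> allq then F q else c) \<in> borel_measurable M0"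
    unfolding M0_def
  proof (rule measurable_pair_measure_countable1[OF countable_max])
    fix s assume s: "s \<in> max_simplexes P"
    have "(\<lambda>x. if x \<in> S s then F (s, x) else c) \<in> borel_measurable lebesgue"
      using F[OF s] S_lebesgue[OF s] by (subst (asm) measurable_restrict_space_iff[where c = c]) auto
    then show "(\<lambda>x. if (s, x) \<in> allq then F (s, x) else c) \<in> borel_measurable lebesgue"
      using s by (simp add: allq_iff)
  qed
  then show ?thesis using allq_sets
    by (subst measurable_restrict_space_iff[where c = c]) (auto dest: sets.sets_into_space)
qed

definition "dens q = (case q of (s, x) \<Rightarrow> ennreal (sqrt (det (gmat P s x))))"

lemma vol_eq: "vol P = density (restrict_space M0 allq) dens"
  by (simp add: vol_def M0_def allq_def dens_def[abs_def])

lemma det_meas: "s \<in> max_simplexes P \<Longrightarrow> (\<lambda>x. det (gmat P s x)) \<in> borel_measurable (lebesgue_on (S s))"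
  by (rule measurable_compose[OF gmat_meas borel_measurable_continuous_onI[OF continuous_on_det]])

lemma dens_meas: "dens \<in> borel_measurable (restrict_space M0 allq)"
  using det_meas by (intro measurable_allq) (auto simp: dens_def intro!: measurable_compose[OF _ measurable_ennreal] measurable_compose[OF _ borel_measurable_sqrt])

lemma vol_measurable:
  assumes "\<And>s. s \<in> max_simplexes P \<Longrightarrow> (\<lambda>x. F (s, x)) \<in> borel_measurable (lebesgue_on (S s))"
  shows "F \<in> borel_measurable (vol P)"
  using measurable_allq[OF assms] by (simp add: vol_eq)

lemma space_vol: "space (vol P) = allq"
  using allq_sets by (auto simp: vol_eq space_restrict_space dest: sets.sets_into_space)

lemma sets_vol_iff: "A \<in> sets (vol P) \<longleftrightarrow> A \<subseteq> allq \<and> (\<forall>s\<in>max_simplexes P. {x. (s, x) \<in> A} \<in> sets lebesgue)"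
  using allq_sets by (auto simp: vol_eq sets_restrict_space_iff sets_M0_iff allq_iff)

lemma AE_allq_iff: "(AE q in restrict_space M0 allq. Q q) \<longleftrightarrow> (\<forall>s\<in>max_simplexes P. AE x in lebesgue. x \<in> S s \<longrightarrow> Q (s, x))"
proof -
  have "allq \<inter> space M0 \<in> sets M0" using allq_sets by auto
  then have "(AE q in restrict_space M0 allq. Q q) \<longleftrightarrow> (AE q in M0. q \<in> allq \<longrightarrow> Q q)"
    by (rule AE_restrict_space_iff)
  then show ?thesis by (simp add: AE_M0_iff allq_iff)
qed

lemma AE_elliptic:
  assumes "s \<in> max_simplexes P"
  shows "AE x in lebesgue. x \<in> S s \<longrightarrow> elliptic Lam (gmat P s x)"
  using Lam(2)[OF assms] S_lebesgue[OF assms] by (subst (asm) AE_restrict_space_iff) auto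

text \<open>The density is positive almost everywhere by ellipticity, so the null sets of the volume
  are exactly the slicewise Lebesgue null sets.\<close>

lemma AE_vol_iff: "(AE q in vol P. Q q) \<longleftrightarrow> (\<forall>s\<in>max_simplexes P. AE x in lebesgue. x \<in> S s \<longrightarrow> Q (s, x))"
proof -
  have "(AE q in vol P. Q q) \<longleftrightarrow> (AE q in restrict_space M0 allq. 0 < dens q \<longrightarrow> Q q)"
    unfolding vol_eq using dens_meas by (rule AE_density)
  also have "\<dots> \<longleftrightarrow> (AE q in restrict_space M0 allq. Q q)"
  proof (rule eventually_subst)
    show "AE q in restrict_space M0 allq. (0 < dens q \<longrightarrow> Q q) \<longleftrightarrow> Q q"
      unfolding AE_allq_iff
    proof
      fix s assume "s \<in> max_simplexes P"
      from AE_elliptic[OF this] show "AE x in lebesgue. x \<in> S s \<longrightarrow> (0 < dens (s, x) \<longrightarrow> Q (s, x)) \<longleftrightarrow> Q (s, x)"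
        by eventually_elim (auto simp: dens_def dest: elliptic_det_pos[OF _ Lam(1)])
    qed
  qed
  finally show ?thesis by (simp add: AE_allq_iff)
qed

lemma AE_vol_elliptic: "AE q in vol P. elliptic Lam (gmat P (fst q) (snd q))"
  using AE_elliptic by (auto simp: AE_vol_iff)

lemma AE_vol_interior: "AE q in vol P. fst q \<in> max_simplexes P \<and> snd q \<in> interior (S (fst q))"
  unfolding AE_vol_iff
proof
  fix s assume s: "s \<in> max_simplexes P"
  have "AE x in lebesgue. x \<notin> S s - interior (S s)"
    using negligible_boundary_S[OF s] by (intro AE_not_in) (simp add: negligible_iff_null_sets)
  then show "AE x in lebesgue. x \<in> S s \<longrightarrow> fst (s, x) \<in> max_simplexes P \<and> snd (s, x) \<in> interior (S (fst (s, x)))"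
    by eventually_elim (use s in auto)
qed

lemma over_open_sets: assumes "open U" shows "over P U \<in> sets (vol P)"
  unfolding sets_vol_iff
proof (intro conjI ballI)
  show "over P U \<subseteq> allq" by (auto simp: over_iff allq_iff)
  fix s assume s: "s \<in> max_simplexes P"
  obtain T where T: "open T" "(\<lambda>x. pt P (s, x)) -` U \<inter> S s = T \<inter> S s"
    using pt_continuous[OF s] assms by (metis continuous_on_open_invariant)
  have "{x. (s, x) \<in> over P U} = T \<inter> S s" using s T(2) by (auto simp: over_iff)
  then show "{x. (s, x) \<in> over P U} \<in> sets lebesgue" using T(1) S_lebesgue[OF s] by auto
qed

lemma over_closed_sets: assumes "closed C" shows "over P C \<in> sets (vol P)"
proof -
  have "over P C = space (vol P) - over P (- C)" by (auto simp: space_vol over_iff allq_iff)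
  then show ?thesis using over_open_sets[of "- C"] assms by auto
qed

lemma null_over:
  assumes "over P Z \<in> null_sets (vol P)" "s \<in> max_simplexes P"
  shows "negligible {x \<in> S s. pt P (s, x) \<in> Z}"
proof -
  have "AE q in vol P. q \<notin> over P Z" by (rule AE_not_in[OF assms(1)])
  then have "AE x in lebesgue. x \<in> S s \<longrightarrow> (s, x) \<notin> over P Z" using assms(2) by (simp add: AE_vol_iff)
  then have "AE x in lebesgue. x \<notin> {x \<in> S s. pt P (s, x) \<in> Z}"
    using assms(2) by (auto simp: over_iff)
  then show ?thesis
    by (simp add: negligible_iff_null_sets completion.AE_iff_null_sets)
qed

text \<open>One summand of the sum over all simplexes, with density at least
  \<open>sqrt \<delta>\<close>. It converts smallness in the Sobolev norm into smallness for
  Lebesgue measure in coordinates.\<close>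

lemma integral_simplex_le:
  assumes F: "F \<in> borel_measurable (vol P)" and s: "s \<in> max_simplexes P"
    and \<delta>: "0 < \<delta>" "\<And>g::real^'n^'n. elliptic Lam g \<Longrightarrow> \<delta> \<le> det g"
  shows "(\<integral>\<^sup>+x. F (s, x) * indicator (S s) x \<partial>lebesgue) \<le> ennreal (1 / sqrt \<delta>) * (\<integral>\<^sup>+q. F q \<partial>vol P)"
proof -
  interpret sigma_finite_measure "lebesgue :: (real^'n) measure" by (rule sigma_finite_lebesgue)
  have F': "F \<in> borel_measurable (restrict_space M0 allq)" using F by (simp add: vol_eq)
  have all: "allq \<inter> space M0 \<in> sets M0" using allq_sets by auto
  let ?H = "\<lambda>q. dens q * F q * indicator allq q"
  have H: "?H \<in> borel_measurable M0"
    using F' dens_meas allq_sets by (subst borel_measurable_restrict_space_iff_ennreal[OF all, symmetric]) auto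
  have "ennreal (sqrt \<delta>) * (\<integral>\<^sup>+x. F (s, x) * indicator (S s) x \<partial>lebesgue)
      \<le> (\<integral>\<^sup>+x. ennreal (sqrt \<delta>) * (F (s, x) * indicator (S s) x) \<partial>lebesgue)"
  proof -
    have "(\<lambda>x. F (s, x) * indicator (S s) x) \<in> borel_measurable lebesgue"
    proof -
      have "(\<lambda>q. F q * indicator allq q) \<in> borel_measurable M0"
        using F' by (subst (asm) borel_measurable_restrict_space_iff_ennreal[OF all]) auto
      then have "(\<lambda>x. F (s, x) * indicator allq (s, x)) \<in> borel_measurable lebesgue"
        unfolding M0_def by (rule measurable_Pair2) (use s in auto)
      then show ?thesis using s by (simp add: indicator_def allq_iff)
    qed
    then show ?thesis by (simp add: nn_integral_cmult)
  qed
  also have "\<dots> \<le> (\<integral>\<^sup>+x. ?H (s, x) \<partial>lebesgue)"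
  proof (rule nn_integral_mono_AE)
    from AE_elliptic[OF s] show "AE x in lebesgue. ennreal (sqrt \<delta>) * (F (s, x) * indicator (S s) x) \<le> ?H (s, x)"
    proof eventually_elim
      fix x assume x: "x \<in> S s \<longrightarrow> elliptic Lam (gmat P s x)"
      show "ennreal (sqrt \<delta>) * (F (s, x) * indicator (S s) x) \<le> ?H (s, x)"
      proof (cases "x \<in> S s")
        case True
        then have "ennreal (sqrt \<delta>) \<le> dens (s, x)" using x \<delta>(2) by (auto simp: dens_def intro!: ennreal_leI)
        then show ?thesis using True s by (auto simp: allq_iff intro: mult_right_mono)
      qed simp
    qed
  qed
  also have "\<dots> \<le> (\<integral>\<^sup>+s. \<integral>\<^sup>+x. ?H (s, x) \<partial>lebesgue \<partial>count_space (max_simplexes P))"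
    by (rule nn_integral_ge_point[OF s])
  also have "\<dots> = (\<integral>\<^sup>+q. ?H q \<partial>M0)"
    using H unfolding M0_def by (rule nn_integral_fst)
  also have "\<dots> = (\<integral>\<^sup>+q. F q \<partial>vol P)"
    unfolding vol_eq using dens_meas F' by (simp add: nn_integral_density nn_integral_restrict_space[OF all])
  finally have le: "ennreal (sqrt \<delta>) * (\<integral>\<^sup>+x. F (s, x) * indicator (S s) x \<partial>lebesgue) \<le> (\<integral>\<^sup>+q. F q \<partial>vol P)" .
  have "(\<integral>\<^sup>+x. F (s, x) * indicator (S s) x \<partial>lebesgue)
     = ennreal (1 / sqrt \<delta>) * (ennreal (sqrt \<delta>) * (\<integral>\<^sup>+x. F (s, x) * indicator (S s) x \<partial>lebesgue))"
    using \<delta>(1) by (simp add: mult.assoc[symmetric] ennreal_mult[symmetric])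
  also have "\<dots> \<le> ennreal (1 / sqrt \<delta>) * (\<integral>\<^sup>+q. F q \<partial>vol P)"
    using le by (rule mult_left_mono) simp
  finally show ?thesis .
qed

end

section \<open>Comparison of the intrinsic and the Euclidean distance\<close>

lemma null_sets_lebesgue_if_AE:
  fixes A :: "'a::euclidean_space set"
  assumes "AE t in lebesgue. t \<notin> A" shows "A \<in> null_sets lebesgue"
  using assms by (simp add: completion.AE_iff_null_sets)

lemma AE_lborel_ex_in_open:
  fixes V :: "'a::euclidean_space set"
  assumes "AE v in lborel. Q v" "open V" "V \<noteq> {}"
  shows "\<exists>v\<in>V. Q v"
proof (rule ccontr)
  assume "\<not> ?thesis"
  with assms(1) have "AE v in lborel. v \<notin> V" by (auto elim!: eventually_mono)
  then have "AE v in lebesgue. v \<notin> V" by (rule AE_completion)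
  then have "negligible V" by (simp add: negligible_iff_null_sets completion.AE_iff_null_sets)
  then show False using open_not_negligible assms by blast
qed

text \<open>Every point other than the end points of the parabola is a dilation of \<open>v\<close>, so for each time almost every \<open>v\<close>
  avoids \<open>N\<close>; Fubini exchanges the quantifiers.\<close>

lemma generic_parabola:
  fixes x y :: "'a::euclidean_space"
  assumes N: "negligible N" and V: "open V" "V \<noteq> {}"
  shows "\<exists>v\<in>V. AE t in lebesgue. 0 < t \<and> t < 1 \<longrightarrow> (1 - t) *\<^sub>R x + t *\<^sub>R y + (t * (1 - t)) *\<^sub>R v \<notin> N"
proof -
  let ?c = "\<lambda>t v. (1 - t) *\<^sub>R x + t *\<^sub>R y + (t * (1 - t)) *\<^sub>R v"
  \<comment> \<open>A Borel null set containing \<open>N\<close>: exchanging the quantifiers by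
    Fubini requires joint measurability in \<open>t\<close> and \<open>v\<close>.\<close>
  obtain N' where N': "N' \<in> null_sets lborel" "N \<subseteq> N'"
    using N by (auto simp: negligible_iff_null_sets null_sets_completion_iff2)
  then have [measurable]: "N' \<in> sets borel" by auto
  let ?Q = "\<lambda>t v. 0 < t \<and> t < 1 \<longrightarrow> ?c t v \<notin> N'"
  have "AE t in (lborel::real measure). AE v in lborel. ?Q t v"
  proof (rule AE_I2)
    fix t :: real
    show "AE v in lborel. ?Q t v"
    proof (cases "0 < t \<and> t < 1")
      case True
      have "negligible N'" using N' by (auto simp: negligible_iff_null_sets null_sets_completionI)
      then have "negligible {v. ?c t v \<in> N'}"
        using null_if_dilations_null[of N' "t * (1 - t)" "(1 - t) *\<^sub>R x + t *\<^sub>R y"] True by simp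
      then have "AE v in lebesgue. v \<notin> {v. ?c t v \<in> N'}"
        by (intro AE_not_in) (simp add: negligible_iff_null_sets)
      then show ?thesis by (auto simp: AE_completion_iff elim!: eventually_mono)
    qed auto
  qed
  moreover have "{p \<in> space (lborel \<Otimes>\<^sub>M lborel). ?Q (fst p) (snd p)} \<in> sets (lborel \<Otimes>\<^sub>M lborel)"
    by measurable
  ultimately have "AE v in lborel. AE t in lborel. ?Q t v"
    using lborel_pair.AE_commute[of "?Q"] by simp
  then obtain v where "v \<in> V" "AE t in lborel. ?Q t v"
    using AE_lborel_ex_in_open[OF _ V] by blast
  moreover from this(2) have "AE t in lebesgue. ?Q t v" by (rule AE_completion)
  ultimately show ?thesis using N'(2) by (intro bexI[of _ v]) (auto elim!: eventually_mono)
qed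

context riem_poly
begin

text \<open>The supremum in the intrinsic distance requires paths that avoid a given null set and the null set where the
  metric is not elliptic: these are the parabolas above.\<close>

lemma intrinsic_dist_le:
  assumes s: "s \<in> max_simplexes P" and x: "x \<in> interior (S s)" and y: "y \<in> interior (S s)"
  shows "intrinsic_dist P (pt P (s, x)) (pt P (s, y)) \<le> ennreal (Lam * dist x y)"
proof (rule ennreal_le_epsilon)
  fix e :: real assume e: "0 < e"
  \<comment> \<open>The slack in Euclidean length that costs exactly \<open>e\<close> after
    multiplication by \<open>Lam\<close>.\<close>
  define e' where "e' = e / Lam"
  have e': "0 < e'" using e Lam(1) by (simp add: e'_def)
  obtain r where r: "0 < r" "ball x r \<subseteq> interior (S s)"
    using x open_interior openE by blast
  have bound: "(INF \<gamma>\<in>transversal_paths Z (pt P (s, x)) (pt P (s, y)). glength P \<gamma>) \<le> ennreal (Lam * (dist x y + e'))"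
    if Z: "over P Z \<in> null_sets (vol P)" for Z
  proof -
    let ?B = "{z. \<not> (z \<in> S s \<longrightarrow> elliptic Lam (gmat P s z))}"
    define N where "N = {z \<in> S s. pt P (s, z) \<in> Z} \<union> ?B"
    have "AE z in lebesgue. z \<notin> ?B" using AE_elliptic[OF s] by simp
    then have "negligible ?B" by (simp add: negligible_iff_null_sets completion.AE_iff_null_sets)
    then have N: "negligible N" unfolding N_def using null_over[OF Z s] by auto
    have ne: "ball (0 :: real^'n) (min r e') \<noteq> {}" using r e' by auto
    \<comment> \<open>The bound \<open>r\<close> keeps the parabola in the interior of the simplex,
      the bound \<open>e'\<close> keeps its speed below \<open>dist x y + e'\<close>.\<close>
    obtain v where v: "v \<in> ball 0 (min r e')"
      "AE t in lebesgue. 0 < t \<and> t < 1 \<longrightarrow> (1 - t) *\<^sub>R x + t *\<^sub>R y + (t * (1 - t)) *\<^sub>R v \<notin> N"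
      using generic_parabola[OF N open_ball ne, of x y] by blast
    define c where "c t = (1 - t) *\<^sub>R x + t *\<^sub>R y + (t * (1 - t)) *\<^sub>R v" for t
    define \<gamma> where "\<gamma> t = pt P (s, c t)" for t
    \<comment> \<open>The parabola is rewritten as the convex combination of
      \<open>x + t *\<^sub>R v\<close>, which lies in the ball around \<open>x\<close>, and of
      \<open>y\<close>.\<close>
    have cint: "c t \<in> interior (S s)" if t: "0 \<le> t" "t \<le> 1" for t
    proof -
      have "norm (t *\<^sub>R v) \<le> norm v" using t by (simp add: mult_left_le_one_le)
      then have "x + t *\<^sub>R v \<in> ball x r" using v(1) by (simp add: dist_norm)
      then have "(1 - t) *\<^sub>R (x + t *\<^sub>R v) + t *\<^sub>R y \<in> interior (S s)"
        using r(2) y t by (intro convexD[OF convex_interior[OF convex_S[OF s]]]) auto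
      also have "(1 - t) *\<^sub>R (x + t *\<^sub>R v) + t *\<^sub>R y = c t" by (simp add: c_def algebra_simps)
      finally show ?thesis .
    qed
    have cS: "c t \<in> S s" if "0 \<le> t" "t \<le> 1" for t using cint[OF that] interior_subset by auto
    have c': "(c has_vector_derivative ((y - x) + (1 - 2 * t) *\<^sub>R v)) (at t)" for t
      unfolding c_def[abs_def] by (auto intro!: derivative_eq_intros simp: algebra_simps)
    have c'n: "norm ((y - x) + (1 - 2 * t) *\<^sub>R v) \<le> dist x y + e'" if t: "0 \<le> t" "t \<le> 1" for t
    proof -
      have "norm ((1 - 2 * t) *\<^sub>R v) \<le> 1 * norm v"
        unfolding norm_scaleR using t by (intro mult_right_mono) auto
      then show ?thesis using v(1) norm_triangle_ineq[of "y - x" "(1 - 2 * t) *\<^sub>R v"]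
        by (simp add: dist_norm norm_minus_commute)
    qed
    have c'n': "\<bar>h\<bar> * norm ((y - x) + (1 - 2 * t) *\<^sub>R v) \<le> (dist x y + e') * \<bar>h\<bar>" if "0 \<le> t" "t \<le> 1" for t h
      using mult_right_mono[OF c'n[OF that], of "\<bar>h\<bar>"] by (simp add: mult.commute)
    have "\<gamma> \<in> transversal_paths Z (pt P (s, x)) (pt P (s, y))"
      unfolding transversal_paths_def
    proof (intro CollectI conjI)
      obtain L where L: "L-lipschitz_on (S s) (\<lambda>x. pt P (s, x))" using pt_lipschitz[OF s] by blast
      have "(dist x y + e')-lipschitz_on {0..1} c"
        by (rule bounded_derivative_imp_lipschitz[where f' = "\<lambda>t h. h *\<^sub>R ((y - x) + (1 - 2 * t) *\<^sub>R v)"])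
          (use c' c'n' e' in \<open>auto simp: has_vector_derivative_def has_derivative_at_withinI
              intro!: onorm_bound\<close>)
      then have "(L * (dist x y + e'))-lipschitz_on {0..1} \<gamma>"
        unfolding \<gamma>_def using cS
        by (intro lipschitz_on_compose2[OF _ lipschitz_on_subset[OF L]]) auto
      then show "\<exists>L. L-lipschitz_on {0..1} \<gamma>" by blast
      show "\<gamma> 0 = pt P (s, x)" "\<gamma> 1 = pt P (s, y)" by (simp_all add: \<gamma>_def c_def)
      \<comment> \<open>At the end points the parabola does not depend on \<open>v\<close>, so they
        may lie in \<open>Z\<close>; two parameter values form a null set.\<close>
      have "AE t in lebesgue. t \<notin> {0, 1::real}"
        by (intro AE_not_in) (simp add: negligible_iff_null_sets[symmetric])
      with v(2) have "AE t in lebesgue. t \<notin> {t \<in> {0..1}. \<gamma> t \<in> Z}"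
        by eventually_elim (use cS in \<open>auto simp: N_def \<gamma>_def c_def\<close>)
      then show "{t \<in> {0..1}. \<gamma> t \<in> Z} \<in> null_sets lebesgue"
        by (rule null_sets_lebesgue_if_AE)
    qed
    then have "(INF \<gamma>\<in>transversal_paths Z (pt P (s, x)) (pt P (s, y)). glength P \<gamma>) \<le> glength P \<gamma>"
      by (rule INF_lower)
    also have "\<dots> \<le> (\<integral>\<^sup>+t. ennreal (Lam * (dist x y + e')) \<partial>lebesgue_on {0..1::real})"
      unfolding glength_def
    proof (rule nn_integral_mono_AE)
      have "AE t in lebesgue. t \<notin> {0, 1::real}"
        by (intro AE_not_in) (simp add: negligible_iff_null_sets[symmetric])
      with v(2) have "AE t in lebesgue. t \<in> {0..1} \<longrightarrow> ennreal (gspeed P \<gamma> t) \<le> ennreal (Lam * (dist x y + e'))"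
      proof eventually_elim
        fix t :: real
        assume t1: "0 < t \<and> t < 1 \<longrightarrow> (1 - t) *\<^sub>R x + t *\<^sub>R y + (t * (1 - t)) *\<^sub>R v \<notin> N" and t2: "t \<notin> {0, 1}"
        show "t \<in> {0..1} \<longrightarrow> ennreal (gspeed P \<gamma> t) \<le> ennreal (Lam * (dist x y + e'))"
        proof
          assume "t \<in> {0..1}"
          then have t: "0 < t" "t < 1" using t2 by auto
          have ell: "elliptic Lam (gmat P s (c t))"
            using t1 t cS[of t] by (auto simp: N_def c_def)
          \<comment> \<open>\<open>gspeed\<close> reads the simplex off the support of the
            barycentric coordinates; at interior points this is \<open>s\<close>, so the metric of
            \<open>s\<close> is evaluated.\<close>
          have supp: "supp (bary P (\<gamma> t)) = s"
            using supp_interior[OF s cint[of t]] euc_in_E[OF s cS[of t]] t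
            by (simp add: \<gamma>_def pt_eq bary_chart)
          let ?w = "(y - x) + (1 - 2 * t) *\<^sub>R v"
          have "((\<lambda>\<tau>. loc P s (\<gamma> \<tau>)) has_vector_derivative ?w) (at t)"
            by (rule has_vector_derivative_transform_within_open[OF c', where S = "{0<..<1}"])
              (use t cS loc_pt[OF s] in \<open>auto simp: \<gamma>_def\<close>)
          then have w: "vector_derivative (\<lambda>\<tau>. loc P s (\<gamma> \<tau>)) (at t) = ?w"
            by (rule vector_derivative_at)
          have locg: "loc P s (\<gamma> t) = c t"
            unfolding \<gamma>_def using t by (intro loc_pt[OF s] cS) auto
          have "gspeed P \<gamma> t = sqrt (?w \<bullet> (gmat P s (c t) *v ?w))"
            unfolding gspeed_def Let_def supp w locg using s by (simp add: ginner_def)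
          also have "\<dots> \<le> sqrt (Lam\<^sup>2 * (norm ?w)\<^sup>2)"
            using ell by (simp add: elliptic_def)
          also have "\<dots> = Lam * norm ?w" using Lam(1) by (simp add: real_sqrt_mult)
          also have "\<dots> \<le> Lam * (dist x y + e')" using c'n[of t] t Lam(1) by (intro mult_left_mono) auto
          finally show "ennreal (gspeed P \<gamma> t) \<le> ennreal (Lam * (dist x y + e'))" by (rule ennreal_leI)
        qed
      qed
      then show "AE t in lebesgue_on {0..1}. ennreal (gspeed P \<gamma> t) \<le> ennreal (Lam * (dist x y + e'))"
        by (subst AE_restrict_space_iff) auto
    qed
    also have "\<dots> = ennreal (Lam * (dist x y + e'))"
      by (simp add: emeasure_restrict_space)
    finally show ?thesis .
  qed
  have "intrinsic_dist P (pt P (s, x)) (pt P (s, y)) \<le> ennreal (Lam * (dist x y + e'))"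
    unfolding intrinsic_dist_def by (rule SUP_least) (use bound in auto)
  also have "Lam * (dist x y + e') = Lam * dist x y + e"
    using Lam(1) by (simp add: e'_def algebra_simps)
  also have "ennreal (Lam * dist x y + e) = ennreal (Lam * dist x y) + ennreal e"
    using e Lam(1) by (intro ennreal_plus) auto
  finally show "intrinsic_dist P (pt P (s, x)) (pt P (s, y)) \<le> ennreal (Lam * dist x y) + ennreal e" .
qed

text \<open>Interior points only: there the intrinsic distance is bounded by the Euclidean one, and
  partial derivatives can be taken in all directions.\<close>

definition "W s U = {x \<in> interior (S s). pt P (s, x) \<in> U}"

lemma open_W: assumes "s \<in> max_simplexes P" "open U" shows "open (W s U)"
proof -
  have "continuous_on (interior (S s)) (\<lambda>x. pt P (s, x))"
    using pt_continuous[OF assms(1)] interior_subset by (rule continuous_on_subset)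
  then have "open ((\<lambda>x. pt P (s, x)) -` U \<inter> interior (S s))"
    using assms(2) by (simp add: continuous_on_open_vimage)
  also have "(\<lambda>x. pt P (s, x)) -` U \<inter> interior (S s) = W s U" by (auto simp: W_def)
  finally show ?thesis .
qed

text \<open>Any two points of \<open>W s U\<close> are interior points of the convex set
  \<open>S s\<close>, so \<open>intrinsic_dist_le\<close> applies even if the connecting paths leave
  \<open>U\<close>. The constant is the same for all simplexes.\<close>

lemma lipschitz_functions_slice:
  assumes u: "u \<in> lipschitz_functions P U"
  obtains L where "\<And>s. s \<in> max_simplexes P \<Longrightarrow> L-lipschitz_on (W s U) (\<lambda>x. u (pt P (s, x)))"
proof -
  obtain L0 where L0: "\<And>x y. x \<in> U \<Longrightarrow> y \<in> U \<Longrightarrow> ennreal \<bar>u x - u y\<bar> \<le> ennreal L0 * intrinsic_dist P x y"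
    using u unfolding lipschitz_functions_def by blast
  show ?thesis
  \<comment> \<open>\<open>L0\<close> may be negative; \<open>ennreal\<close> then truncates it to
    0.\<close>
  proof (rule that[of "max 0 L0 * Lam"])
    fix s assume s: "s \<in> max_simplexes P"
    show "(max 0 L0 * Lam)-lipschitz_on (W s U) (\<lambda>x. u (pt P (s, x)))"
    proof (rule lipschitz_onI)
      fix x y assume xy: "x \<in> W s U" "y \<in> W s U"
      have "ennreal \<bar>u (pt P (s, x)) - u (pt P (s, y))\<bar> \<le> ennreal L0 * intrinsic_dist P (pt P (s, x)) (pt P (s, y))"
        using xy by (intro L0) (auto simp: W_def)
      also have "\<dots> \<le> ennreal (max 0 L0) * ennreal (Lam * dist x y)"
        using xy by (intro mult_mono intrinsic_dist_le[OF s] ennreal_leI) (auto simp: W_def)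
      also have "\<dots> = ennreal (max 0 L0 * Lam * dist x y)"
        using Lam(1) by (simp add: ennreal_mult[symmetric] mult.assoc)
      finally show "dist (u (pt P (s, x))) (u (pt P (s, y))) \<le> max 0 L0 * Lam * dist x y"
        using Lam(1) by (subst (asm) ennreal_le_iff) (auto simp: dist_real_def)
    qed (use Lam(1) in auto)
  qed
qed

end

section \<open>Partial derivatives of Lipschitz functions\<close>

text \<open>Difference quotients of a global Lipschitz extension along the steps
  \<open>1 / real (Suc i)\<close> are Borel, hence so is their \<open>lim\<close>; it is the
  derivative wherever the derivative exists.\<close>

lemma lipschitz_partial_derivative:
  fixes u :: "'a::euclidean_space \<Rightarrow> real"
  assumes lip: "L-lipschitz_on W u" and W: "open W"
  obtains g N where "g \<in> borel_measurable borel" "negligible N"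
    "\<And>x. x \<in> W \<Longrightarrow> x \<notin> N \<Longrightarrow> ((\<lambda>t. u (x + t *\<^sub>R e)) has_real_derivative g x) (at 0)"
proof -
  obtain v where v: "L-lipschitz_on UNIV v" "\<And>x. x \<in> W \<Longrightarrow> v x = u x"
    using lipschitz_extension[OF lip] by blast
  have cont: "continuous_on UNIV v" by (rule lipschitz_on_continuous_on[OF v(1)])
  have [measurable]: "v \<in> borel_measurable borel" by (rule borel_measurable_continuous_onI[OF cont])
  define q where "q i x = real (Suc i) * (v (x + (1 / real (Suc i)) *\<^sub>R e) - v x)" for i x
  define g where "g x = lim (\<lambda>i. q i x)" for x
  define N where "N = {x \<in> W. \<not> (\<lambda>t. u (x + t *\<^sub>R e)) differentiable at 0}"
  show ?thesis
  proof (rule that[of g N])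
    have "q i \<in> borel_measurable borel" for i unfolding q_def[abs_def] by measurable
    then show "g \<in> borel_measurable borel" unfolding g_def[abs_def] by (rule borel_measurable_lim_metric)
    show "negligible N" unfolding N_def by (rule lipschitz_AE_directionally_differentiable[OF lip W])
    fix x assume x: "x \<in> W" "x \<notin> N"
    then obtain D where D: "((\<lambda>t. u (x + t *\<^sub>R e)) has_real_derivative D) (at 0)"
      by (auto simp: N_def real_differentiable_def)
    have "(\<lambda>i. x + (1 / real (Suc i)) *\<^sub>R e) \<longlonglongrightarrow> x + 0 *\<^sub>R e"
      by (intro tendsto_intros LIMSEQ_Suc[OF lim_1_over_n])
    then have "eventually (\<lambda>i. x + (1 / real (Suc i)) *\<^sub>R e \<in> W) sequentially"
      by (rule topological_tendstoD[OF _ W]) (use x in simp)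
    then have ev: "eventually (\<lambda>i. (u (x + (1 / real (Suc i)) *\<^sub>R e) - u x) / (1 / real (Suc i)) = q i x) sequentially"
      by eventually_elim (use x in \<open>simp add: q_def v(2)\<close>)
    have "((\<lambda>t. (u (x + t *\<^sub>R e) - u x) / t) \<longlongrightarrow> D) (at 0)"
      using D by (simp add: has_field_derivative_iff)
    moreover have "filterlim (\<lambda>i. 1 / real (Suc i)) (at 0) sequentially"
      by (intro filterlim_atI LIMSEQ_Suc[OF lim_1_over_n]) auto
    ultimately have "(\<lambda>i. (u (x + (1 / real (Suc i)) *\<^sub>R e) - u x) / (1 / real (Suc i))) \<longlonglongrightarrow> D"
      by (rule filterlim_compose)
    then have "(\<lambda>i. q i x) \<longlonglongrightarrow> D" using ev by (rule Lim_transform_eventually)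
    then have "g x = D" unfolding g_def by (rule limI)
    then show "((\<lambda>t. u (x + t *\<^sub>R e)) has_real_derivative g x) (at 0)" using D by simp
  qed
qed

text \<open>The increment is split into \<open>m\<close> equal steps, which turns the left-hand side into the integral of a difference
  quotient with step \<open>1/m\<close>; dominated convergence then replaces absolute continuity on lines.\<close>

lemma translation_increment_le:
  fixes u :: "'a::euclidean_space \<Rightarrow> real"
  assumes lip: "L-lipschitz_on W u" and W: "open W" and B': "compact B'" "B' \<subseteq> W" and B: "B \<in> sets borel"
    and sweep: "\<And>x \<tau>. x \<in> B \<Longrightarrow> 0 \<le> \<tau> \<Longrightarrow> \<tau> \<le> 1 \<Longrightarrow> x + \<tau> *\<^sub>R e \<in> B'"
    and D: "D \<in> borel_measurable lebesgue"
    and der: "AE x in lebesgue. x \<in> B' \<longrightarrow> ((\<lambda>t. u (x + t *\<^sub>R e)) has_real_derivative D x) (at 0)"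
  shows "(\<integral>\<^sup>+x. ennreal \<bar>u (x + e) - u x\<bar> * indicator B x \<partial>lebesgue)
      \<le> (\<integral>\<^sup>+x. ennreal \<bar>D x\<bar> * indicator B' x \<partial>lebesgue)"
proof -
  obtain v where v: "L-lipschitz_on UNIV v" "\<And>x. x \<in> W \<Longrightarrow> v x = u x"
    using lipschitz_extension[OF lip] by blast
  have cont: "continuous_on UNIV v" by (rule lipschitz_on_continuous_on[OF v(1)])
  have vm [measurable]: "v \<in> borel_measurable borel" by (rule borel_measurable_continuous_onI[OF cont])
  have L: "0 \<le> L" by (rule lipschitz_on_nonneg[OF lip])
  have B'm [measurable]: "B' \<in> sets borel" using B'(1) by (rule borel_compact)
  note B [measurable]
  define h where "h m x = \<bar>v (x + (1 / real (Suc m)) *\<^sub>R e) - v x\<bar>" for m x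
  have hm [measurable]: "h m \<in> borel_measurable borel" for m unfolding h_def[abs_def] by measurable
  let ?I = "\<integral>\<^sup>+x. ennreal \<bar>u (x + e) - u x\<bar> * indicator B x \<partial>lebesgue"
  have step: "?I \<le> (\<integral>\<^sup>+x. ennreal (real (Suc m) * h m x) * indicator B' x \<partial>lebesgue)" for m
  proof -
    let ?n = "real (Suc m)"
    have pointwise: "ennreal \<bar>u (x + e) - u x\<bar> * indicator B x
        \<le> (\<Sum>i<Suc m. ennreal (h m (x + (real i / ?n) *\<^sub>R e)) * indicator B' (x + (real i / ?n) *\<^sub>R e))" for x
    proof (cases "x \<in> B")
      case True
      have inB': "x + (real i / ?n) *\<^sub>R e \<in> B'" if "i \<le> Suc m" for i
        using that by (intro sweep[OF True]) (auto simp: divide_le_eq_1)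
      have "x \<in> B'" "x + e \<in> B'" using sweep[OF True, of 0] sweep[OF True, of 1] by auto
      then have "u (x + e) - u x = v (x + e) - v x" using v(2)[of x] v(2)[of "x + e"] B'(2) by (simp add: subset_iff)
      also have "\<dots> = (\<Sum>i<Suc m. v (x + (real (Suc i) / ?n) *\<^sub>R e) - v (x + (real i / ?n) *\<^sub>R e))"
        by (subst sum_lessThan_telescope) simp
      finally have "\<bar>u (x + e) - u x\<bar> \<le> (\<Sum>i<Suc m. \<bar>v (x + (real (Suc i) / ?n) *\<^sub>R e) - v (x + (real i / ?n) *\<^sub>R e)\<bar>)"
        by (simp only: sum_abs)
      also have "\<dots> = (\<Sum>i<Suc m. h m (x + (real i / ?n) *\<^sub>R e))"
      proof (rule sum.cong[OF refl])
        fix i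
        have "x + (real (Suc i) / ?n) *\<^sub>R e = x + (real i / ?n) *\<^sub>R e + (1 / ?n) *\<^sub>R e"
          by (simp add: add_divide_distrib scaleR_add_left)
        then show "\<bar>v (x + (real (Suc i) / ?n) *\<^sub>R e) - v (x + (real i / ?n) *\<^sub>R e)\<bar> = h m (x + (real i / ?n) *\<^sub>R e)"
          by (simp only: h_def)
      qed
      finally have "ennreal \<bar>u (x + e) - u x\<bar> \<le> ennreal (\<Sum>i<Suc m. h m (x + (real i / ?n) *\<^sub>R e))"
        by (rule ennreal_leI)
      also have "\<dots> = (\<Sum>i<Suc m. ennreal (h m (x + (real i / ?n) *\<^sub>R e)))"
        by (rule sum_ennreal[symmetric]) (simp add: h_def)
      also have "\<dots> = (\<Sum>i<Suc m. ennreal (h m (x + (real i / ?n) *\<^sub>R e)) * indicator B' (x + (real i / ?n) *\<^sub>R e))"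
        using inB' by (intro sum.cong refl) (simp add: indicator_def)
      finally show ?thesis using True by simp
    qed simp
    \<comment> \<open>By translation invariance all \<open>Suc m\<close> terms of the telescoping
      sum have the same integral, so the sum becomes the factor of the difference quotient.\<close>
    have shift: "(\<integral>\<^sup>+x. F (x + a) \<partial>lborel) = (\<integral>\<^sup>+x. F x \<partial>lborel)" if [measurable]: "F \<in> borel_measurable borel"
      for F :: "'a \<Rightarrow> ennreal" and a
    proof -
      have "(\<integral>\<^sup>+x. F x \<partial>lborel) = (\<integral>\<^sup>+x. F x \<partial>distr lborel borel ((+) a))" by (simp add: lborel_distr_plus)
      also have "\<dots> = (\<integral>\<^sup>+x. F (x + a) \<partial>lborel)" by (subst nn_integral_distr) (auto simp: add.commute)
      finally show ?thesis by simp
    qed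
    have "?I \<le> (\<integral>\<^sup>+x. (\<Sum>i<Suc m. ennreal (h m (x + (real i / ?n) *\<^sub>R e)) * indicator B' (x + (real i / ?n) *\<^sub>R e)) \<partial>lebesgue)"
      by (intro nn_integral_mono pointwise)
    also have "\<dots> = (\<integral>\<^sup>+x. (\<Sum>i<Suc m. ennreal (h m (x + (real i / ?n) *\<^sub>R e)) * indicator B' (x + (real i / ?n) *\<^sub>R e)) \<partial>lborel)"
      by (rule nn_integral_completion)
    also have "\<dots> = (\<Sum>i<Suc m. \<integral>\<^sup>+x. ennreal (h m (x + (real i / ?n) *\<^sub>R e)) * indicator B' (x + (real i / ?n) *\<^sub>R e) \<partial>lborel)"
      by (rule nn_integral_sum) measurable
    also have "\<dots> = (\<Sum>i<Suc m. \<integral>\<^sup>+x. ennreal (h m x) * indicator B' x \<partial>lborel)"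
      by (intro sum.cong refl shift[of "\<lambda>x. ennreal (h m x) * indicator B' x"]) measurable
    also have "\<dots> = ennreal ?n * (\<integral>\<^sup>+x. ennreal (h m x) * indicator B' x \<partial>lborel)"
      by (simp add: ennreal_of_nat_eq_real_of_nat)
    also have "\<dots> = (\<integral>\<^sup>+x. ennreal ?n * (ennreal (h m x) * indicator B' x) \<partial>lborel)"
      by (rule nn_integral_cmult[symmetric]) measurable
    also have "\<dots> = (\<integral>\<^sup>+x. ennreal (?n * h m x) * indicator B' x \<partial>lborel)"
      by (intro nn_integral_cong) (simp add: ennreal_mult' h_def mult.assoc)
    also have "\<dots> = (\<integral>\<^sup>+x. ennreal (?n * h m x) * indicator B' x \<partial>lebesgue)"
      by (rule nn_integral_completion[symmetric])
    finally show ?thesis .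
  qed
  have lim: "(\<lambda>m. \<integral>\<^sup>+x. ennreal (real (Suc m) * h m x) * indicator B' x \<partial>lebesgue)
     \<longlonglongrightarrow> (\<integral>\<^sup>+x. ennreal \<bar>D x\<bar> * indicator B' x \<partial>lebesgue)"
  \<comment> \<open>The Lipschitz constant bounds all difference quotients by
    \<open>L * norm e\<close>, which is integrable over the compact set \<open>B'\<close>.\<close>
  proof (rule nn_integral_dominated_convergence[where w = "\<lambda>x. ennreal (L * norm e) * indicator B' x"])
    show "(\<lambda>x. ennreal (real (Suc m) * h m x) * indicator B' x) \<in> borel_measurable lebesgue" for m
      by (rule measurable_completion) measurable
    show "(\<lambda>x. ennreal \<bar>D x\<bar> * indicator B' x) \<in> borel_measurable lebesgue"
      using B'm by (intro borel_measurable_times_ennreal measurable_compose[OF _ measurable_ennreal]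
          borel_measurable_abs D borel_measurable_indicator) simp
    show "(\<lambda>x. ennreal (L * norm e) * indicator B' x) \<in> borel_measurable lebesgue"
      by (rule measurable_completion) measurable
    have "emeasure lborel B' < \<infinity>" using emeasure_compact_finite[OF B'(1)] by simp
    then show "(\<integral>\<^sup>+x. ennreal (L * norm e) * indicator B' x \<partial>lebesgue) < \<infinity>"
      by (simp add: nn_integral_cmult_indicator ennreal_mult_less_top)
    show "AE x in lebesgue. ennreal (real (Suc m) * h m x) * indicator B' x \<le> ennreal (L * norm e) * indicator B' x" for m
    proof (rule AE_I2)
      fix x
      have "h m x \<le> L * dist (x + (1 / real (Suc m)) *\<^sub>R e) x"
        using lipschitz_onD[OF v(1), of "x + (1 / real (Suc m)) *\<^sub>R e" x] by (simp add: h_def dist_real_def)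
      then have "real (Suc m) * h m x \<le> real (Suc m) * (L * (norm e / real (Suc m)))"
        by (intro mult_left_mono) (auto simp: dist_norm)
      then have "real (Suc m) * h m x \<le> L * norm e" by simp
      then show "ennreal (real (Suc m) * h m x) * indicator B' x \<le> ennreal (L * norm e) * indicator B' x"
        by (intro mult_right_mono ennreal_leI) auto
    qed
    show "AE x in lebesgue. (\<lambda>m. ennreal (real (Suc m) * h m x) * indicator B' x) \<longlonglongrightarrow> ennreal \<bar>D x\<bar> * indicator B' x"
      using der
    proof eventually_elim
      fix x assume d: "x \<in> B' \<longrightarrow> ((\<lambda>t. u (x + t *\<^sub>R e)) has_real_derivative D x) (at 0)"
      show "(\<lambda>m. ennreal (real (Suc m) * h m x) * indicator B' x) \<longlonglongrightarrow> ennreal \<bar>D x\<bar> * indicator B' x"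
      proof (cases "x \<in> B'")
        case True
        then have xW: "x \<in> W" using B'(2) by auto
        have "(\<lambda>i. x + (1 / real (Suc i)) *\<^sub>R e) \<longlonglongrightarrow> x + 0 *\<^sub>R e"
          by (intro tendsto_intros LIMSEQ_Suc[OF lim_1_over_n])
        then have "eventually (\<lambda>i. x + (1 / real (Suc i)) *\<^sub>R e \<in> W) sequentially"
          by (rule topological_tendstoD[OF _ W]) (use xW in simp)
        then have ev: "eventually (\<lambda>i. \<bar>(u (x + (1 / real (Suc i)) *\<^sub>R e) - u x) / (1 / real (Suc i))\<bar> = real (Suc i) * h i x) sequentially"
          by eventually_elim (use xW in \<open>simp add: h_def v(2) abs_mult\<close>)
        have "((\<lambda>t. (u (x + t *\<^sub>R e) - u x) / t) \<longlongrightarrow> D x) (at 0)"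
          using d True by (simp add: has_field_derivative_iff)
        moreover have "filterlim (\<lambda>i. 1 / real (Suc i)) (at 0) sequentially"
          by (intro filterlim_atI LIMSEQ_Suc[OF lim_1_over_n]) auto
        ultimately have "(\<lambda>i. (u (x + (1 / real (Suc i)) *\<^sub>R e) - u x) / (1 / real (Suc i))) \<longlonglongrightarrow> D x"
          by (rule filterlim_compose)
        then have "(\<lambda>i. \<bar>(u (x + (1 / real (Suc i)) *\<^sub>R e) - u x) / (1 / real (Suc i))\<bar>) \<longlonglongrightarrow> \<bar>D x\<bar>"
          by (rule tendsto_rabs)
        then have "(\<lambda>i. real (Suc i) * h i x) \<longlonglongrightarrow> \<bar>D x\<bar>" using ev by (rule Lim_transform_eventually)
        then show ?thesis using True by (simp add: tendsto_ennrealI)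
      qed simp
    qed
  qed
  show ?thesis by (rule LIMSEQ_le_const[OF lim]) (use step in auto)
qed

lemma borel_measurable_vec_lambda:
  assumes "\<And>i. (\<lambda>x. f x i) \<in> borel_measurable M"
  shows "(\<lambda>x. (\<chi> i. f x i) :: real^'n) \<in> borel_measurable M"
proof -
  have "(\<chi> i. f x i) = (\<Sum>i\<in>UNIV. f x i *\<^sub>R axis i 1)" for x
    by (simp add: vec_eq_iff axis_def if_distrib cong: if_cong)
  then show ?thesis using assms by simp
qed

lemma borel_measurable_matrix_vector_mult:
  fixes A :: "'x \<Rightarrow> real^'n^'m"
  assumes "A \<in> borel_measurable M" "b \<in> borel_measurable M"
  shows "(\<lambda>x. A x *v b x) \<in> borel_measurable M"
proof (rule borel_measurable_continuous_Pair[OF assms])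
  show "continuous_on UNIV (\<lambda>z::(real^'n^'m) \<times> (real^'n). fst z *v snd z)"
    unfolding matrix_vector_mult_def by (intro continuous_intros)
qed

text \<open>Cramer's rule writes the components as quotients of determinants, which depend
  continuously on the matrix and the vector.\<close>

lemma borel_measurable_matrix_inv_mult:
  fixes A :: "'x \<Rightarrow> real^'n^'n"
  assumes A: "A \<in> borel_measurable M" and b: "b \<in> borel_measurable M"
  shows "(\<lambda>x. matrix_inv (A x) *v b x) \<in> borel_measurable M"
proof -
  let ?c = "\<lambda>x. (\<chi> k. det (\<chi> i j. if j = k then b x $ i else A x $ i $ j) / det (A x)) :: real^'n"
  have "(\<lambda>x. det (\<chi> i j. if j = k then b x $ i else A x $ i $ j)) \<in> borel_measurable M" for k
  proof (rule borel_measurable_continuous_Pair[OF A b])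
    have "continuous_on UNIV (\<lambda>z::(real^'n^'n) \<times> (real^'n). (\<chi> i j. if j = k then snd z $ i else fst z $ i $ j) :: real^'n^'n)"
    proof (intro continuous_on_vec_lambda)
      fix i j
      show "continuous_on UNIV (\<lambda>z::(real^'n^'n) \<times> (real^'n). if j = k then snd z $ i else fst z $ i $ j)"
        by (cases "j = k") (auto intro!: continuous_intros)
    qed
    then show "continuous_on UNIV (\<lambda>z::(real^'n^'n) \<times> (real^'n). det (\<chi> i j. if j = k then snd z $ i else fst z $ i $ j))"
      by (rule continuous_on_compose2[OF continuous_on_det[of UNIV]]) auto
  qed
  moreover have d: "(\<lambda>x. det (A x)) \<in> borel_measurable M"
    by (rule measurable_compose[OF A borel_measurable_continuous_onI[OF continuous_on_det]])
  ultimately have c: "?c \<in> borel_measurable M"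
    by (intro borel_measurable_vec_lambda borel_measurable_divide)
  \<comment> \<open>For a singular matrix, \<open>matrix_inv\<close> is a choice from the empty set, hence the same matrix for all of them.\<close>
  define junk where "junk = (SOME A' :: real^'n^'n. False)"
  have eq: "matrix_inv (A x) *v b x = (if det (A x) = 0 then junk *v b x else ?c x)" for x
  proof (cases "det (A x) = 0")
    case True
    then have "(\<lambda>A'. A x ** A' = mat 1 \<and> A' ** A x = mat 1) = (\<lambda>A'. False)"
      using invertible_det_nz[of "A x"] unfolding invertible_def by blast
    then show ?thesis using True unfolding matrix_inv_def junk_def by simp
  next
    case False
    then have inv: "invertible (A x)" by (simp add: invertible_det_nz)
    have "A x *v (matrix_inv (A x) *v b x) = b x"
      using matrix_inv_mult[OF inv] by (simp add: matrix_vector_mul_assoc)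
    then show ?thesis using cramer[OF False, of "matrix_inv (A x) *v b x" "b x"] False by simp
  qed
  show ?thesis unfolding eq
    by (rule measurable_If[OF borel_measurable_matrix_vector_mult[OF measurable_const b] c]) (use d in measurable)
qed

section \<open>The logarithmic Caccioppoli inequality\<close>

text \<open>The factor of the test function that depends on \<open>f\<close>. What makes the estimate work is
  \<open>decay\<^sup>2 \<le> 4 |decay'|\<close> on the positive half-line.\<close>

definition decay :: "real \<Rightarrow> real" where "decay t = pi / 2 - arctan t"

lemma decay_pos: "0 < decay t" and decay_le: "decay t \<le> pi"
  using arctan_ubound[of t] arctan_lbound[of t] by (auto simp: decay_def)

lemma decay_derivative: "(decay has_real_derivative - inverse (1 + t\<^sup>2)) (at t)"
  unfolding decay_def[abs_def] by (auto intro!: derivative_eq_intros)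

lemma decay_lipschitz: "\<bar>decay a - decay b\<bar> \<le> \<bar>a - b\<bar>"
proof -
  have "norm (decay a - decay b) \<le> 1 * norm (a - b)"
  proof (rule field_differentiable_bound[of UNIV decay "\<lambda>t. - inverse (1 + t\<^sup>2)"])
    show "norm (- inverse (1 + t\<^sup>2)) \<le> 1" for t :: real
      using le_add_same_cancel1[of 1 "t\<^sup>2"] by (simp add: inverse_le_1_iff)
  qed (auto intro: decay_derivative)
  then show ?thesis by simp
qed

text \<open>For positive \<open>t\<close>, \<open>decay t\<close> is \<open>arctan (1 / t)\<close>,
  hence at most \<open>1 / t\<close>; it is also at most 1.7. The two squares add up to
  \<open>1 + 2.89\<close>, below 4.\<close>

lemma decay_square: assumes "0 < t" shows "(decay t)\<^sup>2 * (1 + t\<^sup>2) \<le> 4"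
proof -
  have "decay t = arctan (1 / t)"
    using arctan_inverse[of t] assms by (simp add: decay_def inverse_eq_divide)
  also have "arctan (1 / t) \<le> 1 / t"
    using decay_lipschitz[of "1 / t" 0] assms by (simp add: decay_def)
  finally have "decay t * t \<le> 1" using assms by (simp add: field_simps)
  then have "(decay t * t)\<^sup>2 \<le> 1\<^sup>2" using decay_pos[of t] assms by (intro power_mono) auto
  moreover have "decay t \<le> 1.7"
  proof -
    have "0 < arctan t" "pi \<le> 3.2" using assms pi_approx by simp_all
    then show ?thesis unfolding decay_def by linarith
  qed
  then have "(decay t)\<^sup>2 \<le> 1.7\<^sup>2" using decay_pos[of t] by (intro power_mono) auto
  ultimately show ?thesis by (simp add: power_mult_distrib algebra_simps power2_eq_square)
qed

lemma sin_lipschitz: "\<bar>sin a - sin b\<bar> \<le> \<bar>a - b :: real\<bar>"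
proof -
  have "norm (sin a - sin b) \<le> 1 * norm (a - b)"
    by (rule field_differentiable_bound[of UNIV sin cos]) (auto intro: derivative_eq_intros)
  then show ?thesis by simp
qed

lemma sin_square_lipschitz: "\<bar>(sin a)\<^sup>2 - (sin b)\<^sup>2\<bar> \<le> 2 * \<bar>a - b :: real\<bar>"
proof -
  have "\<bar>(sin a)\<^sup>2 - (sin b)\<^sup>2\<bar> = \<bar>sin a - sin b\<bar> * \<bar>sin a + sin b\<bar>"
    by (simp add: power2_eq_square abs_mult[symmetric] algebra_simps)
  also have "\<dots> \<le> \<bar>a - b\<bar> * 2"
    using sin_lipschitz[of a b] abs_sin_le_one[of a] abs_sin_le_one[of b]
    by (intro mult_mono) (auto simp del: abs_sin_le_one)
  finally show ?thesis by simp
qed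

text \<open>The arithmetic-geometric mean inequality with a free weight \<open>s\<close>, to be
  chosen small where \<open>d\<close> tends to zero.\<close>

lemma abs_le_weighted:
  fixes c :: real
  assumes "c\<^sup>2 \<le> N * d" "0 \<le> N" "0 \<le> d" "0 < s"
  shows "\<bar>c\<bar> \<le> s * N + d / s"
proof (rule power2_le_imp_le)
  have "\<bar>c\<bar>\<^sup>2 \<le> N * d" using assms by simp
  also have "\<dots> \<le> (s * N)\<^sup>2 + (d / s)\<^sup>2 + 2 * (N * d)" using assms by simp
  also have "\<dots> = (s * N + d / s)\<^sup>2" using assms by (simp add: power2_sum)
  finally show "\<bar>c\<bar>\<^sup>2 \<le> (s * N + d / s)\<^sup>2" .
qed (use assms in auto)

text \<open>Squaring the left-hand side and inserting \<open>decay_square\<close> gives at most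
  \<open>16 * b * e\<close>, where \<open>b\<close> is the weighted energy of \<open>f\<close>.
  Since \<open>16 * b * e\<close> is the difference of the squares of \<open>b / 2 + 8 * e\<close>
  and \<open>b / 2 - 8 * e\<close>, half of \<open>b\<close> suffices at the price of
  \<open>8 * e\<close>.\<close>

lemma weighted_cross_term:
  fixes N e m f \<eta> :: real
  assumes "m\<^sup>2 \<le> N * e" "0 \<le> N" "0 \<le> e" "0 < f"
  shows "2 * sin \<eta> * cos \<eta> * decay f * m \<le> (sin \<eta>)\<^sup>2 / (1 + f\<^sup>2) * N / 2 + 8 * e"
proof -
  define b where "b = (sin \<eta>)\<^sup>2 / (1 + f\<^sup>2) * N"
  have pos: "0 < 1 + f\<^sup>2" by (simp add: add_pos_nonneg)
  have b: "0 \<le> b" using assms pos by (simp add: b_def)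
  have "(2 * sin \<eta> * cos \<eta> * decay f * m)\<^sup>2 = 4 * (sin \<eta>)\<^sup>2 * (cos \<eta>)\<^sup>2 * (decay f)\<^sup>2 * m\<^sup>2"
    by (simp add: power_mult_distrib)
  also have "\<dots> \<le> 4 * (sin \<eta>)\<^sup>2 * 1 * (4 / (1 + f\<^sup>2)) * (N * e)"
    using assms decay_square[OF assms(4)] pos
    by (intro mult_mono) (auto simp: field_simps abs_square_le_1)
  also have "\<dots> = 16 * b * e" by (simp add: b_def)
  also have "\<dots> \<le> (b / 2 + 8 * e)\<^sup>2"
  proof -
    have "0 \<le> (b / 2 - 8 * e)\<^sup>2" by simp
    then show ?thesis by (simp add: power2_eq_square algebra_simps)
  qed
  finally have "\<bar>2 * sin \<eta> * cos \<eta> * decay f * m\<bar> \<le> \<bar>b / 2 + 8 * e\<bar>"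
    by (simp add: abs_le_square_iff)
  then show ?thesis using b assms(3) unfolding b_def[symmetric] by linarith
qed

text \<open>The passage to the limit, freed from geometry. With \<open>G\<close> the gradient of
  \<open>f\<close>: \<open>N\<close> is the square of \<open>G\<close>, \<open>e\<close> the square
  of the gradient of \<open>\<eta>\<close>, and \<open>m\<close> the product of \<open>G\<close>
  with the latter. With the error vector \<open>grad (w k) - G\<close>: \<open>c k\<close> is its
  product with \<open>G\<close> and \<open>d k\<close> its square. The assumption
  \<open>super\<close> is superharmonicity tested with
  \<open>(sin \<eta>)\<^sup>2 * decay (w k)\<close>.\<close>

lemma caccioppoli_abstract:
  fixes \<eta> f N e m :: "'q \<Rightarrow> real" and w c d :: "nat \<Rightarrow> 'q \<Rightarrow> real"
  assumes meas [measurable]: "\<eta> \<in> borel_measurable M" "f \<in> borel_measurable M" "m \<in> borel_measurable M"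
      "\<And>k. w k \<in> borel_measurable M" "\<And>k. c k \<in> borel_measurable M"
    and N: "integrable M N" "AE q in M. 0 \<le> N q"
    and e: "integrable M e" "AE q in M. 0 \<le> e q"
    and d: "\<And>k. integrable M (d k)" "\<And>k. AE q in M. 0 \<le> d k q" "(\<lambda>k. \<integral>q. d k q \<partial>M) \<longlonglongrightarrow> 0"
    and w: "\<And>k. integrable M (\<lambda>q. (w k q - f q)\<^sup>2)" "(\<lambda>k. \<integral>q. (w k q - f q)\<^sup>2 \<partial>M) \<longlonglongrightarrow> 0"
    and m: "AE q in M. (m q)\<^sup>2 \<le> N q * e q" and c: "\<And>k. AE q in M. (c k q)\<^sup>2 \<le> N q * d k q"
    and f: "AE q in M. 0 < f q"
    and super: "\<And>k. 0 \<le> (\<integral>q. 2 * sin (\<eta> q) * cos (\<eta> q) * decay (w k q) * m q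
                            - (sin (\<eta> q))\<^sup>2 / (1 + (w k q)\<^sup>2) * (N q + c k q) \<partial>M)"
  shows "integrable M (\<lambda>q. (sin (\<eta> q))\<^sup>2 / (1 + (f q)\<^sup>2) * N q)"
    and "(\<integral>q. (sin (\<eta> q))\<^sup>2 / (1 + (f q)\<^sup>2) * N q \<partial>M) \<le> 16 * (\<integral>q. e q \<partial>M)"
proof -
  have [measurable]: "N \<in> borel_measurable M" "e \<in> borel_measurable M" "\<And>k. d k \<in> borel_measurable M"
    using N e d by auto
  have [measurable]: "decay \<in> borel_measurable borel"
    by (intro borel_measurable_continuous_onI) (auto simp: decay_def[abs_def] intro!: continuous_intros)
  have quot: "\<bar>(sin x)\<^sup>2 / (1 + t\<^sup>2)\<bar> \<le> 1" for x t :: real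
  proof -
    have "(sin x)\<^sup>2 \<le> 1 + t\<^sup>2" using abs_sin_le_one[of x] by (simp add: abs_square_le_1 add_increasing2)
    then show ?thesis by (simp add: divide_le_eq_1 add_pos_nonneg)
  qed
  \<comment> \<open>L2 convergence yields pointwise convergence only along a subsequence, which
    suffices for dominated convergence.\<close>
  obtain r where r: "strict_mono r" "AE q in M. (\<lambda>k. (w (r k) q - f q)\<^sup>2) \<longlonglongrightarrow> 0"
  proof -
    have "(\<lambda>k. \<integral>q. norm ((w k q - f q)\<^sup>2) \<partial>M) \<longlonglongrightarrow> 0" using w(2) by simp
    from tendsto_L1_AE_subseq[OF w(1) this] show ?thesis using that by blast
  qed
  have conv: "AE q in M. (\<lambda>k. w (r k) q) \<longlonglongrightarrow> f q"
    using r(2)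
  proof eventually_elim
    fix q assume "(\<lambda>k. (w (r k) q - f q)\<^sup>2) \<longlonglongrightarrow> 0"
    then have "(\<lambda>k. sqrt ((w (r k) q - f q)\<^sup>2)) \<longlonglongrightarrow> sqrt 0" by (rule tendsto_real_sqrt)
    then have "(\<lambda>k. w (r k) q - f q) \<longlonglongrightarrow> 0" by (simp add: tendsto_rabs_zero_iff)
    then show "(\<lambda>k. w (r k) q) \<longlonglongrightarrow> f q" by (rule LIM_zero_cancel)
  qed
  define a where "a k q = 2 * sin (\<eta> q) * cos (\<eta> q) * decay (w (r k) q) * m q" for k q
  define a' where "a' q = 2 * sin (\<eta> q) * cos (\<eta> q) * decay (f q) * m q" for q
  define b where "b k q = (sin (\<eta> q))\<^sup>2 / (1 + (w (r k) q)\<^sup>2) * N q" for k q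
  define b' where "b' q = (sin (\<eta> q))\<^sup>2 / (1 + (f q)\<^sup>2) * N q" for q
  define \<rho> where "\<rho> k q = (sin (\<eta> q))\<^sup>2 / (1 + (w (r k) q)\<^sup>2) * c (r k) q" for k q
  have [measurable]: "a k \<in> borel_measurable M" "b k \<in> borel_measurable M" "\<rho> k \<in> borel_measurable M" for k
    unfolding a_def[abs_def] b_def[abs_def] \<rho>_def[abs_def] by measurable
  have [measurable]: "a' \<in> borel_measurable M" "b' \<in> borel_measurable M"
    unfolding a'_def[abs_def] b'_def[abs_def] by measurable
  \<comment> \<open>Dominating function for the cross term: \<open>decay\<close> is at most
    \<open>pi\<close>, and the modulus of \<open>m\<close> is at most \<open>N + e\<close>.\<close>
  have Ne: "integrable M (\<lambda>q. 2 * pi * (N q + e q))" using N e by auto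
  have a_bd: "AE q in M. norm (a k q) \<le> 2 * pi * (N q + e q)" for k
    using m N(2) e(2)
  proof eventually_elim
    fix q assume q: "(m q)\<^sup>2 \<le> N q * e q" "0 \<le> N q" "0 \<le> e q"
    have "\<bar>m q\<bar> \<le> N q + e q" using abs_le_weighted[OF q, of 1] by simp
    moreover have "\<bar>2 * sin (\<eta> q) * cos (\<eta> q) * decay (w (r k) q)\<bar> \<le> 2 * 1 * 1 * pi"
      unfolding abs_mult using decay_pos[of "w (r k) q"] decay_le[of "w (r k) q"]
      by (intro mult_mono) auto
    ultimately show "norm (a k q) \<le> 2 * pi * (N q + e q)"
      unfolding a_def real_norm_def abs_mult[of _ "m q"] by (intro mult_mono) (use q in auto)
  qed
  have b_bd: "AE q in M. norm (b k q) \<le> N q" for k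
    using N(2)
  proof eventually_elim
    fix q assume q: "0 \<le> N q"
    show "norm (b k q) \<le> N q"
      unfolding b_def real_norm_def abs_mult using mult_right_mono[OF quot q] q by simp
  qed
  have decay_cont: "isCont decay t" for t using decay_derivative by (rule DERIV_isCont)
  have a_lim: "AE q in M. (\<lambda>k. a k q) \<longlonglongrightarrow> a' q"
    using conv by eventually_elim (auto simp: a_def a'_def intro!: tendsto_intros isCont_tendsto_compose[OF decay_cont])
  have b_lim: "AE q in M. (\<lambda>k. b k q) \<longlonglongrightarrow> b' q"
    using conv by eventually_elim (auto simp: b_def b'_def intro!: tendsto_intros, smt (verit) zero_le_power2)
  have ia: "integrable M (a k)" "integrable M a'" "(\<lambda>k. \<integral>q. a k q \<partial>M) \<longlonglongrightarrow> (\<integral>q. a' q \<partial>M)" for k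
    by (rule integrable_dominated_convergence2[OF _ _ Ne a_lim a_bd]
        integrable_dominated_convergence[OF _ _ Ne a_lim a_bd]
        integral_dominated_convergence[OF _ _ Ne a_lim a_bd]; measurable)+
  have ib: "integrable M (b k)" "integrable M b'" "(\<lambda>k. \<integral>q. b k q \<partial>M) \<longlonglongrightarrow> (\<integral>q. b' q \<partial>M)" for k
    by (rule integrable_dominated_convergence2[OF _ _ N(1) b_lim b_bd]
        integrable_dominated_convergence[OF _ _ N(1) b_lim b_bd]
        integral_dominated_convergence[OF _ _ N(1) b_lim b_bd]; measurable)+
  define D where "D k = (\<integral>q. d (r k) q \<partial>M)" for k
  have D0: "0 \<le> D k" for k unfolding D_def using d(2) by (rule integral_nonneg_AE)
  have Dlim: "D \<longlonglongrightarrow> 0" unfolding D_def using LIMSEQ_subseq_LIMSEQ[OF d(3) r(1)] by (simp add: comp_def)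
  \<comment> \<open>A weight that tends to 0, stays positive even if \<open>D k = 0\<close>, and is
    at least \<open>sqrt (D k)\<close>, so that \<open>D k / s k\<close> tends to 0 as well.\<close>
  define s where "s k = sqrt (D k) + 1 / real (Suc k)" for k
  have s: "0 < s k" "sqrt (D k) \<le> s k" for k using D0[of k] by (auto simp: s_def add_nonneg_pos)
  have \<rho>_bd: "AE q in M. norm (\<rho> k q) \<le> s k * N q + d (r k) q / s k" for k
    using N(2) c[of "r k"] d(2)[of "r k"]
  proof eventually_elim
    fix q assume q: "0 \<le> N q" "(c (r k) q)\<^sup>2 \<le> N q * d (r k) q" "0 \<le> d (r k) q"
    have "norm (\<rho> k q) \<le> 1 * \<bar>c (r k) q\<bar>"
      unfolding \<rho>_def real_norm_def abs_mult by (rule mult_right_mono[OF quot]) simp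
    also have "\<dots> \<le> s k * N q + d (r k) q / s k" using abs_le_weighted[OF q(2,1,3) s(1)[of k]] by simp
    finally show "norm (\<rho> k q) \<le> s k * N q + d (r k) q / s k" .
  qed
  have dom: "integrable M (\<lambda>q. s k * N q + d (r k) q / s k)" for k using N d by auto
  have i\<rho>: "integrable M (\<rho> k)" for k
    by (rule Bochner_Integration.integrable_bound[OF dom[of k]]) (use \<rho>_bd[of k] in \<open>auto elim!: eventually_mono\<close>)
  have \<rho>_le: "norm (\<integral>q. \<rho> k q \<partial>M) \<le> s k * (\<integral>q. N q \<partial>M) + sqrt (D k)" for k
  proof -
    have "norm (\<integral>q. \<rho> k q \<partial>M) \<le> (\<integral>q. norm (\<rho> k q) \<partial>M)" by (rule integral_norm_bound)
    also have "\<dots> \<le> (\<integral>q. s k * N q + d (r k) q / s k \<partial>M)"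
      by (rule integral_mono_AE[OF integrable_norm[OF i\<rho>] dom \<rho>_bd])
    also have "\<dots> = s k * (\<integral>q. N q \<partial>M) + D k / s k"
      using N d by (simp add: D_def)
    also have "D k / s k \<le> sqrt (D k)"
    proof -
      have "D k = sqrt (D k) * sqrt (D k)" using D0[of k] by simp
      also have "\<dots> \<le> sqrt (D k) * s k" using D0[of k] s(2) by (intro mult_left_mono) auto
      finally show ?thesis using s(1)[of k] by (simp add: divide_le_eq)
    qed
    finally show ?thesis by simp
  qed
  have "(\<lambda>k. s k * (\<integral>q. N q \<partial>M) + sqrt (D k)) \<longlonglongrightarrow> (sqrt 0 + 0) * (\<integral>q. N q \<partial>M) + sqrt 0"
    unfolding s_def by (intro tendsto_intros Dlim LIMSEQ_Suc[OF lim_1_over_n])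
  then have slim: "(\<lambda>k. s k * (\<integral>q. N q \<partial>M) + sqrt (D k)) \<longlonglongrightarrow> 0" by simp
  have "(\<lambda>k. \<integral>q. \<rho> k q \<partial>M) \<longlonglongrightarrow> 0"
    by (rule Lim_null_comparison[OF _ slim]) (rule always_eventually, rule allI, rule \<rho>_le)
  then have lim: "(\<lambda>k. (\<integral>q. a k q \<partial>M) - (\<integral>q. b k q \<partial>M) - (\<integral>q. \<rho> k q \<partial>M)) \<longlonglongrightarrow> (\<integral>q. a' q \<partial>M) - (\<integral>q. b' q \<partial>M) - 0"
    by (intro tendsto_diff ia ib)
  have "0 \<le> (\<integral>q. a k q \<partial>M) - (\<integral>q. b k q \<partial>M) - (\<integral>q. \<rho> k q \<partial>M)" for k
  proof -
    have "(\<integral>q. a k q \<partial>M) - (\<integral>q. b k q \<partial>M) - (\<integral>q. \<rho> k q \<partial>M) = (\<integral>q. a k q - b k q - \<rho> k q \<partial>M)"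
      using ia(1) ib(1) i\<rho> by simp
    also have "\<dots> = (\<integral>q. 2 * sin (\<eta> q) * cos (\<eta> q) * decay (w (r k) q) * m q
                            - (sin (\<eta> q))\<^sup>2 / (1 + (w (r k) q)\<^sup>2) * (N q + c (r k) q) \<partial>M)"
      by (intro Bochner_Integration.integral_cong) (auto simp: a_def b_def \<rho>_def ring_distribs)
    finally show ?thesis using super[of "r k"] by simp
  qed
  then have ba: "(\<integral>q. b' q \<partial>M) \<le> (\<integral>q. a' q \<partial>M)"
    using LIMSEQ_le_const[OF lim, of 0] by auto
  \<comment> \<open>Positivity of \<open>f\<close> enters here, through \<open>decay_square\<close>.
    Half of the finite integral of \<open>b'\<close> is absorbed into the left-hand side, which
    doubles 8 to 16.\<close>
  have "(\<integral>q. a' q \<partial>M) \<le> (\<integral>q. b' q / 2 + 8 * e q \<partial>M)"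
  proof (rule integral_mono_AE)
    show "AE q in M. a' q \<le> b' q / 2 + 8 * e q"
      using m N(2) e(2) f by eventually_elim (unfold a'_def b'_def, rule weighted_cross_term)
  qed (use ia ib e in auto)
  also have "\<dots> = (\<integral>q. b' q \<partial>M) / 2 + 8 * (\<integral>q. e q \<partial>M)" using ib e by simp
  finally have "(\<integral>q. b' q \<partial>M) \<le> 16 * (\<integral>q. e q \<partial>M)" using ba by simp
  then show "(\<integral>q. (sin (\<eta> q))\<^sup>2 / (1 + (f q)\<^sup>2) * N q \<partial>M) \<le> 16 * (\<integral>q. e q \<partial>M)"
    by (simp add: b'_def)
  show "integrable M (\<lambda>q. (sin (\<eta> q))\<^sup>2 / (1 + (f q)\<^sup>2) * N q)" using ib(2) by (simp add: b'_def[abs_def])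
qed

section \<open>Gradients in coordinates and the test function\<close>

context riem_poly
begin

definition "gm q = gmat P (fst q) (snd q)"

definition dvec :: "('a \<Rightarrow> real) \<Rightarrow> 'v set \<times> (real^'n) \<Rightarrow> real^'n" where
  "dvec u q = (\<chi> j. deriv (\<lambda>t. u (pt P (fst q, snd q + t *\<^sub>R axis j 1))) 0)"

text \<open>\<open>deriv\<close> has some value even at points where the derivative does not exist,
  so existence is recorded separately from \<open>dvec\<close>.\<close>

definition "has_partials u q \<longleftrightarrow>
  (\<forall>j. ((\<lambda>t. u (pt P (fst q, snd q + t *\<^sub>R axis j 1))) has_real_derivative dvec u q $ j) (at 0))"

lemma has_partialsI:
  assumes "\<And>j. ((\<lambda>t. u (pt P (fst q, snd q + t *\<^sub>R axis j 1))) has_real_derivative D $ j) (at 0)"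
  shows "has_partials u q" "dvec u q = D"
proof -
  show "dvec u q = D" using assms by (auto simp: dvec_def vec_eq_iff intro: DERIV_imp_deriv)
  then show "has_partials u q" using assms by (simp add: has_partials_def)
qed

lemma grad_eq: "grad P u q = matrix_inv (gm q) *v dvec u q"
  by (cases q) (simp add: grad_def gm_def dvec_def)

lemma ginner_eq: "ginner P q a b = a \<bullet> (gm q *v b)"
  by (cases q) (simp add: ginner_def gm_def)

abbreviation gsq :: "'v set \<times> (real^'n) \<Rightarrow> real^'n \<Rightarrow> real" where
  "gsq q \<xi> \<equiv> ginner P q \<xi> \<xi>"

lemma gm_measurable: "gm \<in> borel_measurable (vol P)"
  by (rule vol_measurable) (simp add: gm_def gmat_meas)

lemma AE_gm: "AE q in vol P. elliptic Lam (gm q)"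
  using AE_vol_elliptic by (simp add: gm_def)

lemma ginner_simps:
  "ginner P q (a + b) c = ginner P q a c + ginner P q b c"
  "ginner P q (a - b) c = ginner P q a c - ginner P q b c"
  "ginner P q (r *\<^sub>R a) c = r * ginner P q a c"
  "ginner P q a (b + c) = ginner P q a b + ginner P q a c"
  "ginner P q a (b - c) = ginner P q a b - ginner P q a c"
  "ginner P q a (r *\<^sub>R c) = r * ginner P q a c"
  by (simp_all add: ginner_eq inner_add inner_diff matrix_vector_right_distrib
      matrix_vector_mult_diff_distrib matrix_vector_mult_scaleR)

lemma ginner_nonneg: "elliptic Lam (gm q) \<Longrightarrow> 0 \<le> gsq q a"
  by (simp add: ginner_eq elliptic_nonneg)

lemma ginner_commute: "elliptic Lam (gm q) \<Longrightarrow> ginner P q a b = ginner P q b a"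
  by (simp add: ginner_eq elliptic_symmetric)

lemma ginner_definite: "elliptic Lam (gm q) \<Longrightarrow> gsq q a = 0 \<Longrightarrow> a = 0"
  using elliptic_pos[OF _ Lam(1), of "gm q" a] by (auto simp: ginner_eq)

lemma ginner_cauchy_schwarz:
  assumes "elliptic Lam (gm q)"
  shows "(ginner P q a b)\<^sup>2 \<le> gsq q a * gsq q b"
proof (cases "b = 0")
  case True
  then show ?thesis by (simp add: ginner_eq)
next
  case False
  let ?B = "gsq q b" and ?m = "ginner P q a b"
  have B: "0 < ?B" using elliptic_pos[OF assms Lam(1) False] by (simp add: ginner_eq)
  have "0 \<le> gsq q (a - (?m / ?B) *\<^sub>R b)" by (rule ginner_nonneg[OF assms])
  also have "\<dots> = gsq q a - ?m\<^sup>2 / ?B"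
    using B ginner_commute[OF assms, of b a] by (simp add: ginner_simps field_simps power2_eq_square)
  finally show ?thesis using B by (simp add: field_simps)
qed

text \<open>The difference of the two sides is the square of
  \<open>a - 2 *\<^sub>R b\<close>.\<close>

lemma ginner_add_le:
  assumes "elliptic Lam (gm q)"
  shows "gsq q a \<le> 2 * gsq q (a - b) + 2 * gsq q b"
proof -
  have "0 \<le> gsq q (a - 2 *\<^sub>R b)" by (rule ginner_nonneg[OF assms])
  then show ?thesis using ginner_commute[OF assms, of b a] by (simp add: ginner_simps)
qed

lemma ginner_measurable:
  assumes "gm \<in> borel_measurable M" "a \<in> borel_measurable M" "b \<in> borel_measurable M"
  shows "(\<lambda>q. ginner P q (a q) (b q)) \<in> borel_measurable M"
  unfolding ginner_eq using assms
  by (intro borel_measurable_inner borel_measurable_matrix_vector_mult)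

text \<open>A partial derivative is the Riemannian product of an axis vector with the gradient;
  Cauchy-Schwarz applies, and the axis vector has square at most \<open>Lam\<^sup>2\<close>.\<close>

lemma dvec_le:
  assumes "elliptic Lam (gm q)"
  shows "(dvec u q $ j)\<^sup>2 \<le> Lam\<^sup>2 * gsq q (grad P u q)"
proof -
  have inv: "invertible (gm q)" by (rule elliptic_invertible[OF assms Lam(1)])
  have "dvec u q = gm q *v grad P u q"
    unfolding grad_eq using matrix_inv_mult[OF inv] by (simp add: matrix_vector_mul_assoc)
  then have "dvec u q $ j = ginner P q (axis j 1) (grad P u q)"
    by (simp add: ginner_eq inner_axis')
  then have "(dvec u q $ j)\<^sup>2 \<le> gsq q (axis j 1) * gsq q (grad P u q)"
    using ginner_cauchy_schwarz[OF assms] by simp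
  also have "gsq q (axis j 1) \<le> Lam\<^sup>2 * (norm (axis j 1 :: real^'n))\<^sup>2"
    using assms unfolding ginner_eq elliptic_def by blast
  finally show ?thesis using ginner_nonneg[OF assms] by (simp add: mult_right_mono)
qed

lemma AE_vol_on_iff: "open U \<Longrightarrow> (AE q in vol_on P U. Q q) \<longleftrightarrow> (AE q in vol P. q \<in> over P U \<longrightarrow> Q q)"
  using over_open_sets by (intro AE_restrict_space_iff) auto

text \<open>By completeness the boundary of a simplex and a further null set \<open>N\<close> may be
  ignored, so formulas for derivatives that hold almost everywhere suffice.\<close>

lemma vol_on_measurableI:
  fixes F :: "'v set \<times> (real^'n) \<Rightarrow> 'z::real_normed_vector"
  assumes U: "open U"
    and F: "\<And>s. s \<in> max_simplexes P \<Longrightarrow> \<exists>g N. g \<in> borel_measurable (lebesgue_on (W s U)) \<and> negligible N \<and>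
      (\<forall>x\<in>W s U - N. F (s, x) = g x)"
  shows "F \<in> borel_measurable (vol_on P U)"
proof -
  have "(\<lambda>q. indicator (over P U) q *\<^sub>R F q) \<in> borel_measurable (vol P)"
  proof (rule vol_measurable)
    fix s assume s: "s \<in> max_simplexes P"
    obtain g N where g: "g \<in> borel_measurable (lebesgue_on (W s U))" "negligible N"
      "\<And>x. x \<in> W s U \<Longrightarrow> x \<notin> N \<Longrightarrow> F (s, x) = g x"
      using F[OF s] by blast
    have "W s U \<in> sets lebesgue" using open_W[OF s U] by auto
    then have g': "(\<lambda>x. indicator (W s U) x *\<^sub>R g x) \<in> borel_measurable lebesgue"
      using g(1) by (simp add: borel_measurable_restrict_space_iff)
    show "(\<lambda>x. indicator (over P U) (s, x) *\<^sub>R F (s, x)) \<in> borel_measurable (lebesgue_on (S s))"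
    proof (rule borel_measurable_lebesgue_on_negligible[OF S_lebesgue[OF s] measurable_restrict_space1[OF g']])
      show "negligible (N \<union> (S s - interior (S s)))" using g(2) negligible_boundary_S[OF s] by auto
      fix x assume "x \<in> S s" "x \<notin> N \<union> (S s - interior (S s))"
      then show "indicator (over P U) (s, x) *\<^sub>R F (s, x) = indicator (W s U) x *\<^sub>R g x"
        using g(3) s by (auto simp: indicator_def over_iff W_def)
    qed
  qed
  then show ?thesis using over_open_sets[OF U] by (subst borel_measurable_restrict_space_iff) auto
qed

lemma lipschitz_measurable:
  assumes U: "open U" and u: "u \<in> lipschitz_functions P U"
  shows "(\<lambda>q. u (pt P q)) \<in> borel_measurable (vol_on P U)"
proof (rule vol_on_measurableI[OF U])
  fix s assume s: "s \<in> max_simplexes P"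
  obtain L where "\<And>s. s \<in> max_simplexes P \<Longrightarrow> L-lipschitz_on (W s U) (\<lambda>x. u (pt P (s, x)))"
    using lipschitz_functions_slice[OF u] by blast
  from lipschitz_on_continuous_on[OF this[OF s]]
  have "(\<lambda>x. u (pt P (s, x))) \<in> borel_measurable (lebesgue_on (W s U))"
    by (rule continuous_imp_measurable_on_sets_lebesgue) (use open_W[OF s U] in auto)
  then show "\<exists>g N. g \<in> borel_measurable (lebesgue_on (W s U)) \<and> negligible N \<and> (\<forall>x\<in>W s U - N. u (pt P (s, x)) = g x)"
    by (intro exI[of _ "\<lambda>x. u (pt P (s, x))"] exI[of _ "{}"]) auto
qed

lemma partials_slice:
  assumes U: "open U" and u: "u \<in> lipschitz_functions P U" and s: "s \<in> max_simplexes P"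
  obtains g N where "g \<in> borel_measurable borel" "negligible N"
    "\<And>x. x \<in> W s U \<Longrightarrow> x \<notin> N \<Longrightarrow> has_partials u (s, x) \<and> dvec u (s, x) = g x"
proof -
  obtain L where L: "\<And>s. s \<in> max_simplexes P \<Longrightarrow> L-lipschitz_on (W s U) (\<lambda>x. u (pt P (s, x)))"
    using lipschitz_functions_slice[OF u] by blast
  have "\<exists>g N. g \<in> borel_measurable borel \<and> negligible N \<and> (\<forall>x\<in>W s U - N.
      ((\<lambda>t. u (pt P (s, x + t *\<^sub>R axis j 1))) has_real_derivative g x) (at 0))" for j
    by (rule lipschitz_partial_derivative[OF L[OF s] open_W[OF s U], of "axis j 1"]) blast
  then obtain g N where g: "\<And>j. g j \<in> borel_measurable borel" "\<And>j. negligible (N j)"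
    "\<And>j x. x \<in> W s U - N j \<Longrightarrow> ((\<lambda>t. u (pt P (s, x + t *\<^sub>R axis j 1))) has_real_derivative g j x) (at 0)"
    by metis
  show ?thesis
  proof (rule that[of "\<lambda>x. \<chi> j. g j x" "\<Union>j. N j"])
    show "(\<lambda>x. \<chi> j. g j x) \<in> borel_measurable borel" by (rule borel_measurable_vec_lambda) (rule g)
    show "negligible (\<Union>j. N j)" by (intro negligible_countable_Union) (use g(2) in auto)
    fix x assume "x \<in> W s U" "x \<notin> (\<Union>j. N j)"
    then have "((\<lambda>t. u (pt P (s, x + t *\<^sub>R axis j 1))) has_real_derivative (\<chi> j. g j x) $ j) (at 0)" for j
      using g(3) by simp
    then show "has_partials u (s, x) \<and> dvec u (s, x) = (\<chi> j. g j x)"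
      using has_partialsI[of u "(s, x)" "\<chi> j. g j x"] by simp
  qed
qed

lemma dvec_measurable:
  assumes U: "open U" and u: "u \<in> lipschitz_functions P U"
  shows "dvec u \<in> borel_measurable (vol_on P U)"
proof (rule vol_on_measurableI[OF U])
  fix s assume s: "s \<in> max_simplexes P"
  obtain g N where gN: "g \<in> borel_measurable borel" "negligible N"
    "\<And>x. x \<in> W s U \<Longrightarrow> x \<notin> N \<Longrightarrow> has_partials u (s, x) \<and> dvec u (s, x) = g x"
    using partials_slice[OF U u s] by blast
  have "g \<in> borel_measurable (lebesgue_on (W s U))"
    using gN(1) by (intro measurable_restrict_space1 measurable_completion) simp
  then show "\<exists>g N. g \<in> borel_measurable (lebesgue_on (W s U)) \<and> negligible N \<and> (\<forall>x\<in>W s U - N. dvec u (s, x) = g x)"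
    using gN by blast
qed

lemma gm_measurable_on: "gm \<in> borel_measurable (vol_on P U)"
  by (rule measurable_restrict_space1[OF gm_measurable])

lemma grad_measurable:
  assumes "open U" "u \<in> lipschitz_functions P U"
  shows "grad P u \<in> borel_measurable (vol_on P U)"
  unfolding grad_eq[abs_def]
  by (rule borel_measurable_matrix_inv_mult[OF gm_measurable_on dvec_measurable[OF assms]])

lemma AE_interior_over: "AE q in vol P. q \<in> over P U \<longrightarrow> fst q \<in> max_simplexes P \<and> snd q \<in> W (fst q) U"
  using AE_vol_interior by eventually_elim (auto simp: over_iff W_def)

lemma AE_has_partials:
  assumes U: "open U" and u: "u \<in> lipschitz_functions P U"
  shows "AE q in vol P. q \<in> over P U \<longrightarrow> has_partials u q"
  unfolding AE_vol_iff
proof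
  fix s assume s: "s \<in> max_simplexes P"
  obtain g N where gN: "g \<in> borel_measurable borel" "negligible N"
    "\<And>x. x \<in> W s U \<Longrightarrow> x \<notin> N \<Longrightarrow> has_partials u (s, x) \<and> dvec u (s, x) = g x"
    using partials_slice[OF U u s] by blast
  have "AE x in lebesgue. x \<notin> N \<union> (S s - interior (S s))"
    using gN(2) negligible_boundary_S[OF s] by (intro AE_not_in) (simp add: negligible_iff_null_sets[symmetric])
  then show "AE x in lebesgue. x \<in> S s \<longrightarrow> (s, x) \<in> over P U \<longrightarrow> has_partials u (s, x)"
    by eventually_elim (use gN(3) in \<open>auto simp: over_iff W_def\<close>)
qed

lemma partials_zero_on_open:
  assumes V: "open V" and zero: "\<And>y. y \<in> V \<Longrightarrow> u y = 0" and q: "fst q \<in> max_simplexes P" "snd q \<in> W (fst q) V"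
  shows "dvec u q = 0" "grad P u q = 0"
proof -
  have "((\<lambda>t. u (pt P (fst q, snd q + t *\<^sub>R axis j 1))) has_real_derivative 0 $ j) (at 0)" for j
  proof -
    have "((\<lambda>t::real. snd q + t *\<^sub>R axis j 1) \<longlongrightarrow> snd q + 0 *\<^sub>R axis j 1) (nhds 0)"
      by (intro tendsto_intros filterlim_ident)
    then have "eventually (\<lambda>t. snd q + t *\<^sub>R axis j 1 \<in> W (fst q) V) (nhds 0)"
      by (rule topological_tendstoD[OF _ open_W[OF q(1) V]]) (use q in simp)
    then have "eventually (\<lambda>t. u (pt P (fst q, snd q + t *\<^sub>R axis j 1)) = 0) (nhds 0)"
      by eventually_elim (auto simp: W_def zero)
    then show ?thesis by (subst DERIV_cong_ev[OF refl _ refl, of _ "\<lambda>_. 0"]) auto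
  qed
  then show "dvec u q = 0" by (rule has_partialsI)
  then show "grad P u q = 0" by (simp add: grad_eq)
qed

definition "testfun \<eta> w x = (sin (\<eta> x))\<^sup>2 * decay (w x)"

text \<open>The second coefficient is negative because \<open>decay\<close> decreases; this sign
  turns superharmonicity into an upper bound for the energy of \<open>f\<close>.\<close>

lemma testfun_grad:
  assumes "has_partials \<eta> q" "has_partials w q"
  shows "grad P (testfun \<eta> w) q
    = (2 * sin (\<eta> (pt P q)) * cos (\<eta> (pt P q)) * decay (w (pt P q))) *\<^sub>R grad P \<eta> q
      - ((sin (\<eta> (pt P q)))\<^sup>2 / (1 + (w (pt P q))\<^sup>2)) *\<^sub>R grad P w q"
proof -
  let ?a = "2 * sin (\<eta> (pt P q)) * cos (\<eta> (pt P q)) * decay (w (pt P q))"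
  let ?b = "(sin (\<eta> (pt P q)))\<^sup>2 / (1 + (w (pt P q))\<^sup>2)"
  have "dvec (testfun \<eta> w) q = ?a *\<^sub>R dvec \<eta> q - ?b *\<^sub>R dvec w q"
  proof (rule has_partialsI)
    fix j
    let ?\<eta> = "\<lambda>t. \<eta> (pt P (fst q, snd q + t *\<^sub>R axis j 1))" and ?w = "\<lambda>t. w (pt P (fst q, snd q + t *\<^sub>R axis j 1))"
    have e: "(?\<eta> has_real_derivative dvec \<eta> q $ j) (at 0)" and w: "(?w has_real_derivative dvec w q $ j) (at 0)"
      using assms by (auto simp: has_partials_def)
    have at0: "?\<eta> 0 = \<eta> (pt P q)" "?w 0 = w (pt P q)" by simp_all
    have d: "((\<lambda>t. decay (?w t)) has_real_derivative (- inverse (1 + (?w 0)\<^sup>2)) * dvec w q $ j) (at 0)"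
      by (rule DERIV_chain2[OF decay_derivative w])
    have "((\<lambda>t. (sin (?\<eta> t))\<^sup>2 * decay (?w t)) has_real_derivative
        (2 * sin (?\<eta> 0) * (cos (?\<eta> 0) * dvec \<eta> q $ j)) * decay (?w 0)
        + (- inverse (1 + (?w 0)\<^sup>2) * dvec w q $ j) * (sin (?\<eta> 0))\<^sup>2) (at 0)"
      by (rule DERIV_mult[OF _ d]) (auto intro!: derivative_eq_intros e)
    then show "((\<lambda>t. testfun \<eta> w (pt P (fst q, snd q + t *\<^sub>R axis j 1))) has_real_derivative (?a *\<^sub>R dvec \<eta> q - ?b *\<^sub>R dvec w q) $ j) (at 0)"
      by (simp add: testfun_def at0 divide_inverse mult_ac)
  qed
  then show ?thesis
    by (simp add: grad_eq matrix_vector_mult_diff_distrib matrix_vector_mult_scaleR)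
qed

lemma testfun_nonneg: "0 \<le> testfun \<eta> w x"
  using decay_pos[of "w x"] by (simp add: testfun_def)

text \<open>\<open>w\<close> is Lipschitz only on \<open>U\<close>, but \<eta> vanishes outside. If
  one of two points lies outside \<open>U\<close>, the increment of the product is carried by the
  factor \<open>(sin \<eta>)\<^sup>2\<close> alone.\<close>

lemma testfun_lip_c:
  assumes \<eta>: "\<eta> \<in> lip_c P UNIV" and w: "w \<in> lipschitz_functions P U" and supp: "closure {x. \<eta> x \<noteq> 0} \<subseteq> U"
  shows "testfun \<eta> w \<in> lip_c P UNIV"
proof -
  obtain L1 where L1: "\<And>x y. ennreal \<bar>\<eta> x - \<eta> y\<bar> \<le> ennreal L1 * intrinsic_dist P x y"
    using \<eta> by (auto simp: lip_c_def lipschitz_functions_def)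
  obtain L2 where L2: "\<And>x y. x \<in> U \<Longrightarrow> y \<in> U \<Longrightarrow> ennreal \<bar>w x - w y\<bar> \<le> ennreal L2 * intrinsic_dist P x y"
    using w unfolding lipschitz_functions_def by blast
  have out: "\<eta> x = 0" if "x \<notin> U" for x using that supp closure_subset[of "{x. \<eta> x \<noteq> 0}"] by blast
  have diff: "\<bar>testfun \<eta> w x - testfun \<eta> w y\<bar> \<le> 2 * pi * \<bar>\<eta> x - \<eta> y\<bar> + (if x \<in> U \<and> y \<in> U then \<bar>w x - w y\<bar> else 0)" for x y
  proof -
    have A: "\<bar>((sin (\<eta> x))\<^sup>2 - (sin (\<eta> y))\<^sup>2) * c\<bar> \<le> 2 * pi * \<bar>\<eta> x - \<eta> y\<bar>" if "0 \<le> c" "c \<le> pi" for c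
    proof -
      have "\<bar>((sin (\<eta> x))\<^sup>2 - (sin (\<eta> y))\<^sup>2) * c\<bar> \<le> (2 * \<bar>\<eta> x - \<eta> y\<bar>) * pi"
        unfolding abs_mult using that by (intro mult_mono sin_square_lipschitz) auto
      then show ?thesis by (simp add: mult_ac)
    qed
    show ?thesis
    proof (cases "x \<in> U \<and> y \<in> U")
      case True
      have "testfun \<eta> w x - testfun \<eta> w y
          = ((sin (\<eta> x))\<^sup>2 - (sin (\<eta> y))\<^sup>2) * decay (w x) + (sin (\<eta> y))\<^sup>2 * (decay (w x) - decay (w y))"
        by (simp add: testfun_def algebra_simps)
      moreover have "\<bar>(sin (\<eta> y))\<^sup>2 * (decay (w x) - decay (w y))\<bar> \<le> 1 * \<bar>w x - w y\<bar>"
        unfolding abs_mult by (intro mult_mono decay_lipschitz) (auto simp: abs_square_le_1)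
      ultimately show ?thesis using A[of "decay (w x)"] decay_pos[of "w x"] decay_le[of "w x"] True by simp
    next
      case False
      then have "\<eta> x = 0 \<or> \<eta> y = 0" using out by auto
      \<comment> \<open>As the test function vanishes at one of the two points, \<open>c\<close> is
        \<open>decay\<close> at the other.\<close>
      then have "\<exists>c. 0 \<le> c \<and> c \<le> pi \<and> testfun \<eta> w x - testfun \<eta> w y = ((sin (\<eta> x))\<^sup>2 - (sin (\<eta> y))\<^sup>2) * c"
      proof
        assume "\<eta> x = 0"
        then show ?thesis using decay_pos[of "w y"] decay_le[of "w y"]
          by (intro exI[of _ "decay (w y)"]) (simp add: testfun_def)
      next
        assume "\<eta> y = 0"
        then show ?thesis using decay_pos[of "w x"] decay_le[of "w x"]
          by (intro exI[of _ "decay (w x)"]) (simp add: testfun_def)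
      qed
      then show ?thesis using A False by auto
    qed
  qed
  have "ennreal \<bar>testfun \<eta> w x - testfun \<eta> w y\<bar> \<le> ennreal (2 * pi * max 0 L1 + max 0 L2) * intrinsic_dist P x y" for x y
  proof -
    let ?d = "intrinsic_dist P x y"
    let ?e = "if x \<in> U \<and> y \<in> U then \<bar>w x - w y\<bar> else 0"
    have "ennreal \<bar>testfun \<eta> w x - testfun \<eta> w y\<bar> \<le> ennreal (2 * pi * \<bar>\<eta> x - \<eta> y\<bar> + ?e)"
      by (rule ennreal_leI[OF diff])
    also have "\<dots> = ennreal (2 * pi) * ennreal \<bar>\<eta> x - \<eta> y\<bar> + ennreal ?e"
      by (subst ennreal_plus) (auto simp: ennreal_mult')
    also have "\<dots> \<le> ennreal (2 * pi) * (ennreal (max 0 L1) * ?d) + ennreal (max 0 L2) * ?d"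
    proof (rule add_mono)
      have "ennreal L1 * ?d \<le> ennreal (max 0 L1) * ?d" by (intro mult_right_mono ennreal_leI) auto
      then show "ennreal (2 * pi) * ennreal \<bar>\<eta> x - \<eta> y\<bar> \<le> ennreal (2 * pi) * (ennreal (max 0 L1) * ?d)"
        using L1[of x y] by (intro mult_left_mono) auto
      have "ennreal L2 * ?d \<le> ennreal (max 0 L2) * ?d" by (intro mult_right_mono ennreal_leI) auto
      then show "ennreal ?e \<le> ennreal (max 0 L2) * ?d" using L2[of x y] by (auto intro: order_trans)
    qed
    also have "\<dots> = ennreal (2 * pi * max 0 L1 + max 0 L2) * ?d"
      by (subst ennreal_plus) (auto simp: ennreal_mult distrib_right mult.assoc)
    finally show ?thesis .
  qed
  then have "testfun \<eta> w \<in> lipschitz_functions P UNIV"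
    unfolding lipschitz_functions_def by blast
  moreover have sub: "closure {x. testfun \<eta> w x \<noteq> 0} \<subseteq> closure {x. \<eta> x \<noteq> 0}"
    by (intro closure_mono) (auto simp: testfun_def)
  moreover have "compact (closure {x. \<eta> x \<noteq> 0})" using \<eta> by (simp add: lip_c_def)
  from closed_Int_compact[OF closed_closure this, of "{x. testfun \<eta> w x \<noteq> 0}"]
  have "compact (closure {x. testfun \<eta> w x \<noteq> 0})" unfolding Int_absorb2[OF sub] .
  ultimately show ?thesis by (simp add: lip_c_def)
qed

end

text \<open>Sobolev norms are extended nonnegative integrals, whereas the abstract inequality is
  stated with real-valued ones; this converts bounds and limits.\<close>

lemma L1_convergence_from_nn_integral:
  fixes g :: "nat \<Rightarrow> 'q \<Rightarrow> real"
  assumes g: "\<And>k. g k \<in> borel_measurable M" "\<And>k. AE q in M. 0 \<le> g k q"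
    and B: "\<And>k. (\<integral>\<^sup>+q. ennreal (g k q) \<partial>M) \<le> B k" "\<And>k. B k < \<infinity>" "B \<longlonglongrightarrow> (0::ennreal)"
  shows "\<And>k. integrable M (g k)" "(\<lambda>k. \<integral>q. g k q \<partial>M) \<longlonglongrightarrow> 0"
proof -
  show int: "integrable M (g k)" for k
    by (rule integrableI_nonneg[OF g]) (rule le_less_trans[OF B(1,2)])
  have nn: "0 \<le> (\<integral>q. g k q \<partial>M)" for k using g(2) by (rule integral_nonneg_AE)
  have eq: "ennreal (\<integral>q. g k q \<partial>M) = (\<integral>\<^sup>+q. ennreal (g k q) \<partial>M)" for k
    by (rule nn_integral_eq_integral[OF int g(2), symmetric])
  have "(\<lambda>k. ennreal (\<integral>q. g k q \<partial>M)) \<longlonglongrightarrow> ennreal 0"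
    unfolding eq ennreal_0 by (rule tendsto_sandwich[OF _ _ tendsto_const B(3)]) (auto simp: B(1))
  then show "(\<lambda>k. \<integral>q. g k q \<partial>M) \<longlonglongrightarrow> 0"
    by (rule tendsto_ennrealD) (auto simp: nn)
qed

section \<open>Vertex stars and relatively compact domains\<close>

context riem_poly
begin

definition "star v = {q. 0 < bary P q v}"

lemma open_star: "open (star v)"
  unfolding star_def by (intro open_Collect_less continuous_on_const bary_coord_continuous)

lemma star_simplex:
  assumes "q \<in> star v"
  shows "supp (bary P q) \<in> K" "v \<in> supp (bary P q)"
  using assms bary_in[of q] by (auto simp: star_def supp_def realization_def)

lemma star_eq:
  "star v = (\<Union>s\<in>{s \<in> K. v \<in> s}. chart ` (pos ` {\<alpha> \<in> R. supp \<alpha> \<subseteq> s \<and> 0 < \<alpha> v}))" (is "_ = ?rhs")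
proof
  show "star v \<subseteq> ?rhs"
  proof
    fix q assume q: "q \<in> star v"
    have "q = chart (pos (bary P q))" by (simp add: chart_def)
    then show "q \<in> ?rhs"
      using star_simplex[OF q] q by (intro UN_I[of "supp (bary P q)"]) (auto simp: star_def intro!: imageI)
  qed
  show "?rhs \<subseteq> star v" by (auto simp: star_def chart_def)
qed

text \<open>In the embedded complex each piece is convex, being cut out of a closed simplex by
  positivity of one coordinate, and all pieces contain the vertex \<open>v\<close>.\<close>

lemma connected_star: "connected (star v)"
  unfolding star_eq
proof (rule connected_Union, safe)
  fix s assume s: "s \<in> K" "v \<in> s"
  let ?C = "pos ` {\<alpha> \<in> R. supp \<alpha> \<subseteq> s \<and> 0 < \<alpha> v}"
  have "convex ?C"
  proof (rule convexI, safe)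
    fix a b and l m :: real
    assume *: "a \<in> R" "supp a \<subseteq> s" "0 < a v" "b \<in> R" "supp b \<subseteq> s" "0 < b v" "0 \<le> l" "0 \<le> m" "l + m = 1"
    note comb = convex_combination_realization[OF s(1) *(1,2,4,5,7,8,9)]
    have "0 < l * a v + m * b v"
    proof (cases "l = 0")
      case False
      then show ?thesis using * by (intro add_pos_nonneg) auto
    qed (use * in auto)
    then show "l *\<^sub>R pos a + m *\<^sub>R pos b \<in> ?C"
      using comb by (intro image_eqI[of _ _ "\<lambda>v. l * a v + m * b v"]) auto
  qed
  moreover have "?C \<subseteq> E" by (auto simp: E_def)
  ultimately show "connected (chart ` ?C)"
    by (intro connected_continuous_image convex_connected continuous_on_subset[OF chart_continuous])
next
  assume empty: "\<Inter> ((\<lambda>s. chart ` pos ` {\<alpha> \<in> R. supp \<alpha> \<subseteq> s \<and> 0 < \<alpha> v}) ` {s \<in> K. v \<in> s}) = {}"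
  have "chart (pos (indicator {v})) \<in> chart ` pos ` {\<alpha> \<in> R. supp \<alpha> \<subseteq> s \<and> 0 < \<alpha> v}" if "s \<in> K" "v \<in> s" for s
    using vertex_realization[OF that] that by (intro imageI) auto
  then show False using empty by blast
qed

text \<open>Local finiteness: the star is covered by the finitely many closed simplexes that contain
  \<open>v\<close>.\<close>

lemma compact_closure_star: "compact (closure (star v))"
proof -
  let ?T = "\<Union>s\<in>{s \<in> K. v \<in> s}. chart ` vhull s"
  have "finite {s \<in> K. v \<in> s}"
    using lipschitz_poly by (auto simp: lipschitz_polyhedron_def locally_finite_complex_def)
  then have T: "compact ?T"
    by (intro compact_UN compact_continuous_image continuous_on_subset[OF chart_continuous] compact_vhull)
      (use vhull_subset_E in auto)
  moreover have "star v \<subseteq> ?T"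
    unfolding star_eq using pos_simplex by (fastforce intro!: UN_mono image_mono)
  ultimately have "closure (star v) \<subseteq> ?T" by (intro closure_minimal compact_imp_closed)
  then show ?thesis using closed_Int_compact[OF closed_closure T, of "star v"] by (simp add: Int_absorb2)
qed

lemma ex_star: "\<exists>v. x \<in> star v"
proof -
  have "supp (bary P x) \<noteq> {}" using bary_in[of x] nonempty_simplex by (auto simp: realization_def)
  then obtain v where "bary P x v \<noteq> 0" by (auto simp: supp_def)
  moreover have "0 \<le> bary P x v" using bary_in[of x] by (auto simp: realization_def)
  ultimately have "x \<in> star v" by (simp add: star_def)
  then show ?thesis by blast
qed

lemma domain_nbhd: fixes x :: 'a shows "\<exists>U. relatively_compact_domain U \<and> x \<in> U"
proof -
  obtain v where "x \<in> star v" using ex_star by blast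
  then show ?thesis
    using open_star connected_star compact_closure_star by (auto simp: relatively_compact_domain_def)
qed

lemma domain_Union:
  assumes "finite \<D>" "\<And>U. U \<in> \<D> \<Longrightarrow> relatively_compact_domain U \<and> x0 \<in> U"
  shows "relatively_compact_domain (\<Union>\<D>)"
  unfolding relatively_compact_domain_def
proof (intro conjI)
  show "open (\<Union>\<D>)" using assms by (auto simp: relatively_compact_domain_def)
  show "connected (\<Union>\<D>)" 
    by (rule connected_Union) (use assms in \<open>auto simp: relatively_compact_domain_def\<close>)
  have c: "compact (\<Union>U\<in>\<D>. closure U)"
    using assms by (intro compact_UN) (auto simp: relatively_compact_domain_def)
  have "\<Union>\<D> \<subseteq> (\<Union>U\<in>\<D>. closure U)" using closure_subset by blast
  then have "closure (\<Union>\<D>) \<subseteq> (\<Union>U\<in>\<D>. closure U)"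
    using c by (intro closure_minimal compact_imp_closed)
  then show "compact (closure (\<Union>\<D>))"
    using closed_Int_compact[OF closed_closure c, of "\<Union>\<D>"] by (simp add: Int_absorb2)
qed

text \<open>The domains through a base point \<open>x0\<close> cover an open set. Its complement is
  open too, since a star meeting one of these domains could be adjoined to it; by connectedness they
  cover everything. A finite subfamily covering \<open>C\<close> has a connected union because all
  members share \<open>x0\<close>.\<close>

lemma compact_in_domain:
  fixes C :: "'a set"
  assumes "compact C" shows "\<exists>U. relatively_compact_domain U \<and> C \<subseteq> U"
proof -
  fix x0 :: 'a
  define \<U> where "\<U> = {U. relatively_compact_domain U \<and> x0 \<in> U}"
  have op: "open U" if "U \<in> \<U>" for U using that by (auto simp: \<U>_def relatively_compact_domain_def)
  have "open (- \<Union>\<U>)"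
  proof (subst open_subopen, intro ballI)
    fix y assume y: "y \<in> - \<Union>\<U>"
    obtain V where V: "relatively_compact_domain V" "y \<in> V" using domain_nbhd by blast
    have "V \<inter> \<Union>\<U> = {}"
    proof (rule ccontr)
      assume "V \<inter> \<Union>\<U> \<noteq> {}"
      then obtain z U where z: "z \<in> V" "z \<in> U" "U \<in> \<U>" by blast
      then have "relatively_compact_domain (\<Union>{U, V})"
        by (intro domain_Union[of _ z]) (use V z in \<open>auto simp: \<U>_def\<close>)
      then have "\<Union>{U, V} \<in> \<U>" using z by (auto simp: \<U>_def)
      then show False using y V(2) by blast
    qed
    then show "\<exists>T. open T \<and> y \<in> T \<and> T \<subseteq> - \<Union>\<U>"
      using V by (intro exI[of _ V]) (auto simp: relatively_compact_domain_def)
  qed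
  moreover have "connected (UNIV :: 'a set)" using lipschitz_poly by (simp add: lipschitz_polyhedron_def)
  moreover have "x0 \<in> \<Union>\<U>" using domain_nbhd[of x0] by (auto simp: \<U>_def)
  ultimately have "\<Union>\<U> = UNIV"
    using connectedD[of "UNIV :: 'a set" "\<Union>\<U>" "- \<Union>\<U>"] op by blast
  then obtain \<D> where \<D>: "\<D> \<subseteq> \<U>" "finite \<D>" "C \<subseteq> \<Union>\<D>"
    using compactE[OF assms, of \<U>] op by (metis subset_UNIV)
  have "relatively_compact_domain (\<Union>\<D>)"
    using \<D> by (intro domain_Union[of _ x0]) (auto simp: \<U>_def)
  then show ?thesis using \<D>(3) by blast
qed

section \<open>Measurability and integrals over a domain, and the inequality on the
  polyhedron\<close>

lemma vol_slice_measurable: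
  assumes s: "s \<in> max_simplexes P" shows "(\<lambda>x. (s, x)) \<in> measurable (lebesgue_on (S s)) (vol P)"
proof (rule measurableI)
  show "(s, x) \<in> space (vol P)" if "x \<in> space (lebesgue_on (S s))" for x
    using that s by (simp add: space_vol allq_iff space_restrict_space)
  fix A assume A: "A \<in> sets (vol P)"
  have "(\<lambda>x. (s, x)) -` A \<inter> space (lebesgue_on (S s)) = {x. (s, x) \<in> A}"
    using A s by (auto simp: sets_vol_iff allq_iff space_restrict_space)
  moreover have "{x. (s, x) \<in> A} \<in> sets lebesgue" "{x. (s, x) \<in> A} \<subseteq> S s"
    using A s by (auto simp: sets_vol_iff allq_iff)
  ultimately show "(\<lambda>x. (s, x)) -` A \<inter> space (lebesgue_on (S s)) \<in> sets (lebesgue_on (S s))"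
    using S_lebesgue[OF s] by (simp add: sets_restrict_space_iff)
qed

lemma vol_measurable_AE:
  fixes g h :: "'v set \<times> (real^'n) \<Rightarrow> 'z::real_normed_vector"
  assumes g: "g \<in> borel_measurable (vol P)" and eq: "AE q in vol P. h q = g q"
  shows "h \<in> borel_measurable (vol P)"
proof (rule vol_measurable)
  fix s assume s: "s \<in> max_simplexes P"
  let ?N = "{x. \<not> (x \<in> S s \<longrightarrow> h (s, x) = g (s, x))}"
  have "AE x in lebesgue. x \<notin> ?N" using eq s by (simp add: AE_vol_iff)
  then have N: "negligible ?N" by (simp add: negligible_iff_null_sets null_sets_lebesgue_if_AE)
  show "(\<lambda>x. h (s, x)) \<in> borel_measurable (lebesgue_on (S s))"
    by (rule borel_measurable_lebesgue_on_negligible[OF S_lebesgue[OF s]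
        measurable_compose[OF vol_slice_measurable[OF s] g] N]) auto
qed

text \<open>The field \<open>G\<close> is known to be measurable only over \<open>U\<close>, while
  superharmonicity integrates over the whole polyhedron. The integrand agrees almost everywhere with
  its restriction extended by zero, and measurability survives changes on null sets.\<close>

lemma integral_vol_on:
  fixes h :: "'v set \<times> (real^'n) \<Rightarrow> real"
  assumes U: "open U" and h: "h \<in> borel_measurable (vol_on P U)" and zero: "AE q in vol P. q \<notin> over P U \<longrightarrow> h q = 0"
  shows "(\<integral>q. h q \<partial>vol P) = (\<integral>q. h q \<partial>vol_on P U)"
proof -
  have ov: "over P U \<inter> space (vol P) \<in> sets (vol P)" using over_open_sets[OF U] by auto
  let ?g = "\<lambda>q. indicator (over P U) q *\<^sub>R h q"
  have g: "?g \<in> borel_measurable (vol P)"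
    using h by (subst (asm) borel_measurable_restrict_space_iff[OF ov])
  have eq: "AE q in vol P. h q = ?g q" using zero by eventually_elim (auto simp: indicator_def)
  have "(\<integral>q. h q \<partial>vol P) = (\<integral>q. ?g q \<partial>vol P)"
    by (rule integral_cong_AE[OF vol_measurable_AE[OF g eq] g eq])
  then show ?thesis by (simp add: integral_restrict_space[OF ov])
qed

lemma nn_integral_vol_on_le:
  assumes U: "open U \<or> closed U" and V: "open V \<or> closed V" "U \<subseteq> V"
  shows "(\<integral>\<^sup>+q. h q \<partial>vol_on P U) \<le> (\<integral>\<^sup>+q. h q \<partial>vol_on P V)"
proof -
  have ov: "over P U \<inter> space (vol P) \<in> sets (vol P)" "over P V \<inter> space (vol P) \<in> sets (vol P)"
    using U V over_open_sets over_closed_sets by auto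
  have "over P U \<subseteq> over P V" using V(2) by (auto simp: over_iff)
  then show ?thesis unfolding nn_integral_restrict_space[OF ov(1)] nn_integral_restrict_space[OF ov(2)]
    by (intro nn_integral_mono mult_left_mono) (auto simp: indicator_def)
qed

lemma nn_integral_vol_on_UNIV: "(\<integral>\<^sup>+q. h q \<partial>vol_on P UNIV) = (\<integral>\<^sup>+q. h q \<partial>vol P)"
proof -
  have ov: "over P UNIV \<inter> space (vol P) \<in> sets (vol P)" using over_open_sets[of UNIV] by auto
  show ?thesis unfolding nn_integral_restrict_space[OF ov]
    by (intro nn_integral_cong) (auto simp: space_vol allq_def)
qed

lemma ginner_diff_le:
  assumes "elliptic Lam (gm q)"
  shows "gsq q a \<le> 2 * gsq q (b - a) + 2 * gsq q b"
proof -
  have "0 \<le> gsq q (a - 2 *\<^sub>R b)" by (rule ginner_nonneg[OF assms])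
  then show ?thesis using ginner_commute[OF assms, of b a] by (simp add: ginner_simps)
qed

lemma lipschitz_functions_mono: "u \<in> lipschitz_functions P V \<Longrightarrow> U \<subseteq> V \<Longrightarrow> u \<in> lipschitz_functions P U"
  unfolding lipschitz_functions_def by blast

text \<open>\<open>caccioppoli_abstract\<close> for the Lipschitz functions \<open>w k\<close> that
  approximate \<open>f\<close> in the Sobolev norm over \<open>U\<close>; the closed support of
  \<eta> lies in \<open>U\<close>, which makes \<open>testfun \<eta> (w k)\<close>
  admissible.\<close>

proposition caccioppoli:
  assumes U: "relatively_compact_domain U" and G: "has_grad P U f G" and f: "\<And>x. 0 < f x"
    and super: "\<And>\<rho>. \<rho> \<in> lip_c P UNIV \<Longrightarrow> (\<forall>x. 0 \<le> \<rho> x) \<Longrightarrow> 0 \<le> (\<integral>q. ginner P q (G q) (grad P \<rho> q) \<partial>vol P)"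
    and \<eta>: "\<eta> \<in> lip_c P UNIV" "closure {x. \<eta> x \<noteq> 0} \<subseteq> U"
    and energy: "(\<integral>\<^sup>+q. ennreal (gsq q (grad P \<eta> q)) \<partial>vol P) < \<infinity>"
  shows "(\<integral>\<^sup>+q. ennreal ((sin (\<eta> (pt P q)))\<^sup>2 / (1 + (f (pt P q))\<^sup>2) * gsq q (G q)) \<partial>vol_on P U)
     \<le> 16 * (\<integral>\<^sup>+q. ennreal (gsq q (grad P \<eta> q)) \<partial>vol P)"
proof -
  let ?M = "vol_on P U"
  have oU: "open U" using U by (simp add: relatively_compact_domain_def)
  have \<eta>L: "\<eta> \<in> lipschitz_functions P UNIV" using \<eta>(1) by (simp add: lip_c_def)
  have \<eta>U: "\<eta> \<in> lipschitz_functions P U" using lipschitz_functions_mono[OF \<eta>L] by simp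
  have fm: "(\<lambda>q. f (pt P q)) \<in> borel_measurable ?M" and Gm: "G \<in> borel_measurable ?M"
    using G by (auto simp: has_grad_def sobolev_limit_def)
  obtain w0 where w0: "\<And>k. w0 k \<in> lipschitz_functions P U" "\<And>k. sobolev_norm2 P U (w0 k) (grad P (w0 k)) < \<infinity>"
    "(\<lambda>k. sobolev_norm2 P U (\<lambda>y. w0 k y - f y) (\<lambda>q. grad P (w0 k) q - G q)) \<longlonglongrightarrow> 0"
    using G unfolding has_grad_def sobolev_limit_def by blast
  obtain k0 where k0: "\<And>k. k0 \<le> k \<Longrightarrow> sobolev_norm2 P U (\<lambda>y. w0 k y - f y) (\<lambda>q. grad P (w0 k) q - G q) < \<infinity>"
    using order_tendstoD(2)[OF w0(3), of \<infinity>] unfolding eventually_sequentially by auto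
  \<comment> \<open>Convergence to 0 in \<open>ennreal\<close> allows infinite initial terms; they
    are skipped so that every error is integrable.\<close>
  define w where "w k = w0 (k + k0)" for k
  define B where "B k = sobolev_norm2 P U (\<lambda>y. w k y - f y) (\<lambda>q. grad P (w k) q - G q)" for k
  have w: "w k \<in> lipschitz_functions P U" "sobolev_norm2 P U (w k) (grad P (w k)) < \<infinity>" "B k < \<infinity>" for k
    using w0 k0 by (auto simp: w_def B_def)
  have Blim: "B \<longlonglongrightarrow> 0" unfolding B_def w_def using LIMSEQ_ignore_initial_segment[OF w0(3), of k0] .
  define N where "N q = gsq q (G q)" for q
  define e where "e q = gsq q (grad P \<eta> q)" for q
  define m where "m q = ginner P q (G q) (grad P \<eta> q)" for q
  define c where "c k q = ginner P q (G q) (grad P (w k) q - G q)" for k q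
  define d where "d k q = gsq q (grad P (w k) q - G q)" for k q
  note gm_on = gm_measurable_on[of U]
  note w_meas = lipschitz_measurable[OF oU w(1)] and gw = grad_measurable[OF oU w(1)]
  note \<eta>_meas = lipschitz_measurable[OF oU \<eta>U] and g\<eta> = grad_measurable[OF oU \<eta>U]
  have meas: "N \<in> borel_measurable ?M" "e \<in> borel_measurable ?M" "m \<in> borel_measurable ?M"
    "c k \<in> borel_measurable ?M" "d k \<in> borel_measurable ?M" for k
    unfolding N_def[abs_def] e_def[abs_def] m_def[abs_def] c_def[abs_def] d_def[abs_def]
    by (intro ginner_measurable gm_on Gm gw g\<eta> borel_measurable_diff)+
  have ell: "AE q in ?M. elliptic Lam (gm q)"
    unfolding AE_vol_on_iff[OF oU] using AE_gm by eventually_elim simp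
  have N0: "AE q in ?M. 0 \<le> N q" and e0: "AE q in ?M. 0 \<le> e q" and d0: "AE q in ?M. 0 \<le> d k q" for k
    using ell by (eventually_elim, simp add: N_def e_def d_def ginner_nonneg)+
  have Beq: "B k = (\<integral>\<^sup>+q. ennreal ((w k (pt P q) - f (pt P q))\<^sup>2 + d k q) \<partial>?M)" for k
    by (simp add: B_def sobolev_norm2_def d_def)
  have d_le: "(\<integral>\<^sup>+q. ennreal (d k q) \<partial>?M) \<le> B k" for k
    unfolding Beq by (intro nn_integral_mono ennreal_leI) simp
  have w_le: "(\<integral>\<^sup>+q. ennreal ((w k (pt P q) - f (pt P q))\<^sup>2) \<partial>?M) \<le> B k" for k
    unfolding Beq using d0[of k] by (intro nn_integral_mono_AE) (auto elim!: eventually_mono intro!: ennreal_leI)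
  note d_lim = L1_convergence_from_nn_integral[OF meas(5) d0 d_le w(3) Blim]
  have wf_meas: "(\<lambda>q. (w k (pt P q) - f (pt P q))\<^sup>2) \<in> borel_measurable ?M" for k
    using w_meas fm by (intro borel_measurable_power borel_measurable_diff)
  note wf_lim = L1_convergence_from_nn_integral[where g = "\<lambda>k q. (w k (pt P q) - f (pt P q))\<^sup>2", OF wf_meas _ w_le w(3) Blim, simplified]
  \<comment> \<open>\<open>G\<close> is square integrable because it is at finite distance from the
    gradient of \<open>w 0\<close>, which has finite energy.\<close>
  have Nint: "integrable ?M N"
  proof (rule integrableI_nonneg[OF meas(1) N0])
    let ?z = "\<lambda>q. gsq q (grad P (w 0) q)"
    have zm: "?z \<in> borel_measurable ?M" by (intro ginner_measurable gm_on gw)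
    have z_le: "(\<integral>\<^sup>+q. ennreal (?z q) \<partial>?M) \<le> sobolev_norm2 P U (w 0) (grad P (w 0))"
      unfolding sobolev_norm2_def by (intro nn_integral_mono ennreal_leI) simp
    have "(\<integral>\<^sup>+q. ennreal (N q) \<partial>?M) \<le> (\<integral>\<^sup>+q. 2 * ennreal (d 0 q) + 2 * ennreal (?z q) \<partial>?M)"
    proof (rule nn_integral_mono_AE)
      show "AE q in ?M. ennreal (N q) \<le> 2 * ennreal (d 0 q) + 2 * ennreal (?z q)"
        using ell
      proof eventually_elim
        fix q assume q: "elliptic Lam (gm q)"
        have "ennreal (N q) \<le> ennreal (2 * d 0 q + 2 * ?z q)"
          using ginner_diff_le[OF q, of "G q" "grad P (w 0) q"] by (intro ennreal_leI) (simp add: N_def d_def)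
        also have "\<dots> = 2 * ennreal (d 0 q) + 2 * ennreal (?z q)"
          using ginner_nonneg[OF q] by (simp add: d_def ennreal_plus ennreal_mult)
        finally show "ennreal (N q) \<le> 2 * ennreal (d 0 q) + 2 * ennreal (?z q)" .
      qed
    qed
    also have "\<dots> = 2 * (\<integral>\<^sup>+q. ennreal (d 0 q) \<partial>?M) + 2 * (\<integral>\<^sup>+q. ennreal (?z q) \<partial>?M)"
      using meas(5)[of 0] zm by (subst nn_integral_add) (auto simp: nn_integral_cmult)
    also have "\<dots> < \<infinity>"
      using le_less_trans[OF d_le w(3)] le_less_trans[OF z_le w(2)] by (simp add: ennreal_mult_less_top)
    finally show "(\<integral>\<^sup>+q. ennreal (N q) \<partial>?M) < \<infinity>" .
  qed
  have e_le: "(\<integral>\<^sup>+q. ennreal (e q) \<partial>?M) \<le> (\<integral>\<^sup>+q. ennreal (e q) \<partial>vol P)"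
    using nn_integral_vol_on_le[of U UNIV "\<lambda>q. ennreal (e q)"] oU by (simp add: nn_integral_vol_on_UNIV)
  have eint: "integrable ?M e"
    by (rule integrableI_nonneg[OF meas(2) e0]) (use e_le energy in \<open>auto simp: e_def intro: le_less_trans\<close>)
  have part\<eta>: "AE q in ?M. has_partials \<eta> q" unfolding AE_vol_on_iff[OF oU] by (rule AE_has_partials[OF oU \<eta>U])
  have partw: "AE q in ?M. has_partials (w k) q" for k unfolding AE_vol_on_iff[OF oU] by (rule AE_has_partials[OF oU w(1)])
  have ineq: "0 \<le> (\<integral>q. 2 * sin (\<eta> (pt P q)) * cos (\<eta> (pt P q)) * decay (w k (pt P q)) * m q
      - (sin (\<eta> (pt P q)))\<^sup>2 / (1 + (w k (pt P q))\<^sup>2) * (N q + c k q) \<partial>?M)" for k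
  proof -
    let ?\<rho> = "testfun \<eta> (w k)"
    have \<rho>: "?\<rho> \<in> lip_c P UNIV" by (rule testfun_lip_c[OF \<eta>(1) w(1) \<eta>(2)])
    then have \<rho>U: "?\<rho> \<in> lipschitz_functions P U" using lipschitz_functions_mono[of ?\<rho> UNIV U] by (simp add: lip_c_def)
    let ?h = "\<lambda>q. ginner P q (G q) (grad P ?\<rho> q)"
    have hm: "?h \<in> borel_measurable ?M" by (intro ginner_measurable gm_on Gm grad_measurable[OF oU \<rho>U])
    \<comment> \<open>Points outside \<open>U\<close> lie in the open complement of the closed
      support of \<eta>, where the test function vanishes identically and has zero gradient,
      whatever \<open>G\<close> is there.\<close>
    have zero: "AE q in vol P. q \<notin> over P U \<longrightarrow> ?h q = 0"
      using AE_interior_over[of "- closure {x. \<eta> x \<noteq> 0}"] AE_vol_interior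
    proof eventually_elim
      fix q assume q: "q \<in> over P (- closure {x. \<eta> x \<noteq> 0}) \<longrightarrow>
          fst q \<in> max_simplexes P \<and> snd q \<in> W (fst q) (- closure {x. \<eta> x \<noteq> 0})"
        "fst q \<in> max_simplexes P \<and> snd q \<in> interior (S (fst q))"
      show "q \<notin> over P U \<longrightarrow> ?h q = 0"
      proof
        assume "q \<notin> over P U"
        then have "pt P q \<notin> U" using q(2) interior_subset by (cases q) (auto simp: over_iff)
        then have "q \<in> over P (- closure {x. \<eta> x \<noteq> 0})"
          using q(2) \<eta>(2) interior_subset by (cases q) (auto simp: over_iff)
        moreover have "?\<rho> y = 0" if "y \<in> - closure {x. \<eta> x \<noteq> 0}" for y
        proof -
          have "\<eta> y = 0" using that closure_subset[of "{x. \<eta> x \<noteq> 0}"] by blast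
          then show ?thesis by (simp add: testfun_def)
        qed
        ultimately have "grad P ?\<rho> q = 0"
          using q(1) by (intro partials_zero_on_open[of "- closure {x. \<eta> x \<noteq> 0}"]) auto
        then show "?h q = 0" by (simp add: ginner_eq)
      qed
    qed
    have "0 \<le> (\<integral>q. ?h q \<partial>vol P)" by (rule super[OF \<rho>]) (simp add: testfun_nonneg)
    also have "\<dots> = (\<integral>q. ?h q \<partial>?M)" by (rule integral_vol_on[OF oU hm zero])
    also have "\<dots> = (\<integral>q. 2 * sin (\<eta> (pt P q)) * cos (\<eta> (pt P q)) * decay (w k (pt P q)) * m q
      - (sin (\<eta> (pt P q)))\<^sup>2 / (1 + (w k (pt P q))\<^sup>2) * (N q + c k q) \<partial>?M)"
    proof (rule integral_cong_AE)
      have [measurable]: "decay \<in> borel_measurable borel"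
        by (intro borel_measurable_continuous_onI) (auto simp: decay_def[abs_def] intro!: continuous_intros)
      note [measurable] = \<eta>_meas w_meas[of k] meas
      show "(\<lambda>q. 2 * sin (\<eta> (pt P q)) * cos (\<eta> (pt P q)) * decay (w k (pt P q)) * m q
        - (sin (\<eta> (pt P q)))\<^sup>2 / (1 + (w k (pt P q))\<^sup>2) * (N q + c k q)) \<in> borel_measurable ?M"
        by measurable
      show "AE q in ?M. ?h q = 2 * sin (\<eta> (pt P q)) * cos (\<eta> (pt P q)) * decay (w k (pt P q)) * m q
        - (sin (\<eta> (pt P q)))\<^sup>2 / (1 + (w k (pt P q))\<^sup>2) * (N q + c k q)"
        using part\<eta> partw[of k]
        by eventually_elim (simp add: testfun_grad ginner_simps m_def N_def c_def)
    qed (rule hm)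
    finally show ?thesis .
  qed
  have m_le: "AE q in ?M. (m q)\<^sup>2 \<le> N q * e q" and c_le: "AE q in ?M. (c k q)\<^sup>2 \<le> N q * d k q" for k
    using ell by (eventually_elim, simp add: m_def c_def N_def e_def d_def ginner_cauchy_schwarz)+
  have fpos: "AE q in ?M. 0 < f (pt P q)" by (intro AE_I2 f)
  note cacc = caccioppoli_abstract[where w = "\<lambda>k q. w k (pt P q)" and \<eta> = "\<lambda>q. \<eta> (pt P q)" and f = "\<lambda>q. f (pt P q)",
      OF \<eta>_meas fm meas(3) w_meas meas(4) Nint N0 eint e0 d_lim(1) d0 d_lim(2) wf_lim m_le c_le fpos ineq]
  have nn: "AE q in ?M. 0 \<le> (sin (\<eta> (pt P q)))\<^sup>2 / (1 + (f (pt P q))\<^sup>2) * N q"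
    using N0 by eventually_elim auto
  have "(\<integral>\<^sup>+q. ennreal ((sin (\<eta> (pt P q)))\<^sup>2 / (1 + (f (pt P q))\<^sup>2) * N q) \<partial>?M)
      = ennreal (\<integral>q. (sin (\<eta> (pt P q)))\<^sup>2 / (1 + (f (pt P q))\<^sup>2) * N q \<partial>?M)"
    by (rule nn_integral_eq_integral[OF cacc(1) nn])
  also have "\<dots> \<le> ennreal (16 * (\<integral>q. e q \<partial>?M))" by (rule ennreal_leI[OF cacc(2)])
  also have "\<dots> = 16 * ennreal (\<integral>q. e q \<partial>?M)" by (simp add: ennreal_mult')
  also have "ennreal (\<integral>q. e q \<partial>?M) = (\<integral>\<^sup>+q. ennreal (e q) \<partial>?M)"
    by (rule nn_integral_eq_integral[OF eint e0, symmetric])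
  also have "16 * (\<integral>\<^sup>+q. ennreal (e q) \<partial>?M) \<le> 16 * (\<integral>\<^sup>+q. ennreal (e q) \<partial>vol P)"
    using e_le by (rule mult_left_mono) simp
  finally show ?thesis by (simp add: N_def e_def)
qed

end

section \<open>Vanishing gradient implies constancy\<close>

text \<open>\<open>Q k\<close> dominates the squared error of \<open>w k\<close> and, up to
  \<open>C\<^sup>2\<close>, its squared derivative along \<open>e\<close>. The increment of
  \<open>F\<close> is compared in L1 with that of \<open>w k\<close>, which
  \<open>translation_increment_le\<close> bounds by the derivative. Letting \<open>k\<close> tend to
  infinity and then the weight \<sigma> to 0 makes the integral of the increments vanish, and
  continuity makes them vanish at every point of \<open>B\<close>.\<close>

lemma zero_gradient_translation:
  fixes F :: "'a::euclidean_space \<Rightarrow> real" and w g :: "nat \<Rightarrow> 'a \<Rightarrow> real" and Q :: "nat \<Rightarrow> 'a \<Rightarrow> real"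
  assumes O: "open V" "continuous_on V F" and B: "open B" and B': "compact B'" "B' \<subseteq> V"
    and sweep: "\<And>x \<tau>. x \<in> B \<Longrightarrow> 0 \<le> \<tau> \<Longrightarrow> \<tau> \<le> 1 \<Longrightarrow> x + \<tau> *\<^sub>R e \<in> B'"
    and w: "\<And>k. (L k)-lipschitz_on V (w k)"
    and g: "\<And>k. g k \<in> borel_measurable lebesgue"
      "\<And>k. AE x in lebesgue. x \<in> B' \<longrightarrow> ((\<lambda>t. w k (x + t *\<^sub>R e)) has_real_derivative g k x) (at 0)"
    and Q: "\<And>k. (\<lambda>x. ennreal (Q k x) * indicator B' x) \<in> borel_measurable lebesgue"
      "\<And>k. AE x in lebesgue. x \<in> B' \<longrightarrow> (w k x - F x)\<^sup>2 \<le> Q k x \<and> (g k x)\<^sup>2 \<le> C\<^sup>2 * Q k x"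
      "(\<lambda>k. \<integral>\<^sup>+x. ennreal (Q k x) * indicator B' x \<partial>lebesgue) \<longlonglongrightarrow> 0"
    and C: "0 < C" and z: "z \<in> B"
  shows "F (z + e) = F z"
proof -
  have B'm: "B' \<in> sets borel" using B'(1) by (rule borel_compact)
  have BB': "B \<subseteq> B'" using sweep[where \<tau> = 0] by auto
  let ?I = "\<integral>\<^sup>+x. ennreal \<bar>F (x + e) - F x\<bar> * indicator B x \<partial>lebesgue"
  let ?m = "measure lborel B'"
  have fin: "emeasure lborel B' = ennreal ?m"
    using emeasure_compact_finite[OF B'(1)] by (simp add: emeasure_eq_ennreal_measure)
  have bound: "?I \<le> ennreal ((2 + C) * \<sigma> * ?m) + ennreal ((2 + C) / \<sigma>) * (\<integral>\<^sup>+x. ennreal (Q k x) * indicator B' x \<partial>lebesgue)"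
    if \<sigma>: "0 < \<sigma>" for \<sigma> k
  proof -
    define h where "h x = indicator V x *\<^sub>R (w k x - F x)" for x
    have "continuous_on V (\<lambda>x. w k x - F x)"
      using lipschitz_on_continuous_on[OF w] O(2) by (intro continuous_intros)
    then have hm [measurable]: "h \<in> borel_measurable borel"
      unfolding h_def[abs_def] using O(1) by (intro borel_measurable_continuous_on_indicator) auto
    have h: "h x = w k x - F x" if "x \<in> B'" for x using that B'(2) by (auto simp: h_def)
    note B'm [measurable]
    \<comment> \<open>By \<open>abs_le_weighted\<close>, any function whose square is at most
      \<open>Q k\<close> is bounded by \<open>R\<close>. As \<open>B'\<close> has finite measure, L2
      smallness of the errors thus becomes L1 smallness.\<close>
    define R where "R x = ennreal \<sigma> * indicator B' x + ennreal (1 / \<sigma>) * (ennreal (Q k x) * indicator B' x)" for x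
    have Rm: "R \<in> borel_measurable lebesgue"
      unfolding R_def[abs_def]
      by (intro borel_measurable_add borel_measurable_times_ennreal borel_measurable_const Q(1) borel_measurable_indicator) (use B'm in simp)
    have Rint: "(\<integral>\<^sup>+x. R x \<partial>lebesgue) = ennreal (\<sigma> * ?m) + ennreal (1 / \<sigma>) * (\<integral>\<^sup>+x. ennreal (Q k x) * indicator B' x \<partial>lebesgue)"
    proof -
      have "(\<integral>\<^sup>+x. R x \<partial>lebesgue) = (\<integral>\<^sup>+x. ennreal \<sigma> * indicator B' x \<partial>lebesgue)
          + (\<integral>\<^sup>+x. ennreal (1 / \<sigma>) * (ennreal (Q k x) * indicator B' x) \<partial>lebesgue)"
        unfolding R_def
        by (intro nn_integral_add borel_measurable_times_ennreal borel_measurable_const Q(1) borel_measurable_indicator) (use B'm in simp)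
      also have "(\<integral>\<^sup>+x. ennreal \<sigma> * indicator B' x \<partial>lebesgue) = ennreal (\<sigma> * ?m)"
        using B'm \<sigma> by (simp add: nn_integral_cmult_indicator fin ennreal_mult)
      also have "(\<integral>\<^sup>+x. ennreal (1 / \<sigma>) * (ennreal (Q k x) * indicator B' x) \<partial>lebesgue)
          = ennreal (1 / \<sigma>) * (\<integral>\<^sup>+x. ennreal (Q k x) * indicator B' x \<partial>lebesgue)"
        by (rule nn_integral_cmult[OF Q(1)])
      finally show ?thesis .
    qed
    have small: "ennreal \<bar>a\<bar> \<le> ennreal c * R x" if "x \<in> B'" "a\<^sup>2 \<le> c\<^sup>2 * Q k x" "0 \<le> Q k x" "0 < c" for a c x
    proof -
      have "\<bar>a / c\<bar> \<le> \<sigma> * 1 + Q k x / \<sigma>"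
        using that \<sigma> by (intro abs_le_weighted) (auto simp: power_divide divide_le_eq mult.commute)
      then have "\<bar>a\<bar> \<le> c * (\<sigma> + Q k x / \<sigma>)" using that(4) by (simp add: divide_le_eq mult.commute)
      then have "ennreal \<bar>a\<bar> \<le> ennreal (c * (\<sigma> + Q k x / \<sigma>))" by (rule ennreal_leI)
      also have "\<dots> = ennreal c * (ennreal \<sigma> + ennreal (1 / \<sigma>) * ennreal (Q k x))"
        using that \<sigma> by (simp add: ennreal_mult[symmetric] ennreal_plus[symmetric] del: ennreal_plus)
      finally show ?thesis using that(1) by (simp add: R_def)
    qed
    have "?I \<le> (\<integral>\<^sup>+x. (ennreal \<bar>h (x + e)\<bar> * indicator B' (x + e) + ennreal \<bar>h x\<bar> * indicator B' x)
        + ennreal \<bar>w k (x + e) - w k x\<bar> * indicator B x \<partial>lebesgue)"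
    proof (rule nn_integral_mono)
      fix x
      show "ennreal \<bar>F (x + e) - F x\<bar> * indicator B x \<le> (ennreal \<bar>h (x + e)\<bar> * indicator B' (x + e) + ennreal \<bar>h x\<bar> * indicator B' x)
        + ennreal \<bar>w k (x + e) - w k x\<bar> * indicator B x"
      proof (cases "x \<in> B")
        case True
        have xB: "x \<in> B'" "x + e \<in> B'" using BB' True sweep[OF True, of 1] by auto
        have "\<bar>F (x + e) - F x\<bar> \<le> \<bar>h (x + e)\<bar> + \<bar>h x\<bar> + \<bar>w k (x + e) - w k x\<bar>"
          unfolding h[OF xB(1)] h[OF xB(2)] by linarith
        then have "ennreal \<bar>F (x + e) - F x\<bar> \<le> ennreal (\<bar>h (x + e)\<bar> + \<bar>h x\<bar> + \<bar>w k (x + e) - w k x\<bar>)"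
          by (rule ennreal_leI)
        then show ?thesis using True xB by (simp add: ennreal_plus)
      qed simp
    qed
    also have "\<dots> = (\<integral>\<^sup>+x. ennreal \<bar>h (x + e)\<bar> * indicator B' (x + e) \<partial>lebesgue) + (\<integral>\<^sup>+x. ennreal \<bar>h x\<bar> * indicator B' x \<partial>lebesgue)
        + (\<integral>\<^sup>+x. ennreal \<bar>w k (x + e) - w k x\<bar> * indicator B x \<partial>lebesgue)"
    proof -
      define w' where "w' x = indicator B x *\<^sub>R (w k (x + e) - w k x)" for x
      have "continuous_on B (\<lambda>x. w k (x + e) - w k x)"
      proof (intro continuous_on_diff)
        have cw: "continuous_on V (w k)" by (rule lipschitz_on_continuous_on[OF w])
        from continuous_on_subset[OF this] show "continuous_on B (w k)" using BB' B'(2) by blast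
        show "continuous_on B (\<lambda>x. w k (x + e))"
          by (rule continuous_on_compose2[OF cw]) (use sweep[where \<tau> = 1] B'(2) in \<open>auto intro!: continuous_intros\<close>)
      qed
      then have "w' \<in> borel_measurable borel"
        unfolding w'_def[abs_def] using B by (intro borel_measurable_continuous_on_indicator) auto
      then have 3: "(\<lambda>x. ennreal \<bar>w' x\<bar>) \<in> borel_measurable lebesgue" by (intro measurable_completion) measurable
      have eq: "ennreal \<bar>w k (x + e) - w k x\<bar> * indicator B x = ennreal \<bar>w' x\<bar>" for x
        by (auto simp: w'_def indicator_def)
      have 1: "(\<lambda>x. ennreal \<bar>h (x + e)\<bar> * indicator B' (x + e)) \<in> borel_measurable lebesgue"
        by (rule measurable_completion) measurable
      have 2: "(\<lambda>x. ennreal \<bar>h x\<bar> * indicator B' x) \<in> borel_measurable lebesgue"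
        by (rule measurable_completion) measurable
      show ?thesis unfolding eq
        by (subst nn_integral_add[OF borel_measurable_add[OF 1 2] 3], subst nn_integral_add[OF 1 2]) simp
    qed
    also have "(\<integral>\<^sup>+x. ennreal \<bar>h (x + e)\<bar> * indicator B' (x + e) \<partial>lebesgue) = (\<integral>\<^sup>+x. ennreal \<bar>h x\<bar> * indicator B' x \<partial>lebesgue)"
    proof -
      have "(\<integral>\<^sup>+x. ennreal \<bar>h x\<bar> * indicator B' x \<partial>lborel) = (\<integral>\<^sup>+x. ennreal \<bar>h x\<bar> * indicator B' x \<partial>distr lborel borel ((+) e))"
        by (simp add: lborel_distr_plus)
      also have "\<dots> = (\<integral>\<^sup>+x. ennreal \<bar>h (x + e)\<bar> * indicator B' (x + e) \<partial>lborel)"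
        by (subst nn_integral_distr) (auto simp: add.commute)
      finally show ?thesis by (simp add: nn_integral_completion)
    qed
    also have "(\<integral>\<^sup>+x. ennreal \<bar>h x\<bar> * indicator B' x \<partial>lebesgue) \<le> (\<integral>\<^sup>+x. R x \<partial>lebesgue)"
    proof (rule nn_integral_mono_AE)
      show "AE x in lebesgue. ennreal \<bar>h x\<bar> * indicator B' x \<le> R x"
        using Q(2)[of k]
      proof eventually_elim
        fix x assume q: "x \<in> B' \<longrightarrow> (w k x - F x)\<^sup>2 \<le> Q k x \<and> (g k x)\<^sup>2 \<le> C\<^sup>2 * Q k x"
        show "ennreal \<bar>h x\<bar> * indicator B' x \<le> R x"
        proof (cases "x \<in> B'")
          case True
          then have "(h x)\<^sup>2 \<le> 1\<^sup>2 * Q k x" "0 \<le> Q k x"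
            using q h[OF True] by (auto intro: order_trans[OF zero_le_power2])
          then show ?thesis using small[OF True, of "h x" 1] True by simp
        qed simp
      qed
    qed
    also have "(\<integral>\<^sup>+x. ennreal \<bar>w k (x + e) - w k x\<bar> * indicator B x \<partial>lebesgue) \<le> (\<integral>\<^sup>+x. ennreal \<bar>g k x\<bar> * indicator B' x \<partial>lebesgue)"
      by (rule translation_increment_le[OF w O(1) B' _ sweep g]) (use B in auto)
    also have "\<dots> \<le> (\<integral>\<^sup>+x. ennreal C * R x \<partial>lebesgue)"
    proof (rule nn_integral_mono_AE)
      show "AE x in lebesgue. ennreal \<bar>g k x\<bar> * indicator B' x \<le> ennreal C * R x"
        using Q(2)[of k]
      proof eventually_elim
        fix x assume q: "x \<in> B' \<longrightarrow> (w k x - F x)\<^sup>2 \<le> Q k x \<and> (g k x)\<^sup>2 \<le> C\<^sup>2 * Q k x"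
        show "ennreal \<bar>g k x\<bar> * indicator B' x \<le> ennreal C * R x"
        proof (cases "x \<in> B'")
          case True
          then have "0 \<le> Q k x" using q by (auto intro: order_trans[OF zero_le_power2])
          then show ?thesis using small[OF True, of "g k x" C] q C True by simp
        qed simp
      qed
    qed
    also have "\<dots> = ennreal C * (\<integral>\<^sup>+x. R x \<partial>lebesgue)" by (rule nn_integral_cmult[OF Rm])
    \<comment> \<open>Two copies for the errors of \<open>w k\<close> at both ends of the
      translation, and \<open>C\<close> copies for its increment.\<close>
    finally have "?I \<le> ((\<integral>\<^sup>+x. R x \<partial>lebesgue) + (\<integral>\<^sup>+x. R x \<partial>lebesgue)) + ennreal C * (\<integral>\<^sup>+x. R x \<partial>lebesgue)"
      by (simp add: add_mono)
    also have "\<dots> = ennreal (2 + C) * (\<integral>\<^sup>+x. R x \<partial>lebesgue)"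
      using C by (simp add: ennreal_plus distrib_right mult_2)
    also have "\<dots> = ennreal ((2 + C) * \<sigma> * ?m) + ennreal ((2 + C) / \<sigma>) * (\<integral>\<^sup>+x. ennreal (Q k x) * indicator B' x \<partial>lebesgue)"
      unfolding Rint distrib_left mult.assoc[symmetric] using C \<sigma>
      by (simp add: ennreal_mult[symmetric] mult.assoc del: ennreal_plus)
    finally show ?thesis .
  qed
  have "?I \<le> ennreal ((2 + C) * \<sigma> * ?m)" if \<sigma>: "0 < \<sigma>" for \<sigma>
  proof -
    have "(\<lambda>k. ennreal ((2 + C) * \<sigma> * ?m) + ennreal ((2 + C) / \<sigma>) * (\<integral>\<^sup>+x. ennreal (Q k x) * indicator B' x \<partial>lebesgue))
        \<longlonglongrightarrow> ennreal ((2 + C) * \<sigma> * ?m) + ennreal ((2 + C) / \<sigma>) * 0"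
      by (intro tendsto_add tendsto_const ennreal_tendsto_cmult Q(3)) simp
    from LIMSEQ_le_const[OF this, of ?I] show ?thesis using bound[OF \<sigma>] by auto
  qed
  then have "?I \<le> 0 + ennreal \<epsilon>" if "0 < \<epsilon>" for \<epsilon>
  proof -
    \<comment> \<open>With \<open>?m + 1\<close> in place of \<open>?m\<close> the divisor stays
      positive even if \<open>B'\<close> has measure zero.\<close>
    define X where "X = (2 + C) * (?m + 1)"
    define \<sigma> where "\<sigma> = \<epsilon> / X"
    have pos: "0 < X" unfolding X_def using C by (intro mult_pos_pos) (auto simp: add_nonneg_pos)
    then have "0 < \<sigma>" using that by (simp add: \<sigma>_def)
    moreover have "(2 + C) * \<sigma> * ?m \<le> \<epsilon>"
    proof -
      have "(2 + C) * \<sigma> * ?m \<le> (2 + C) * \<sigma> * (?m + 1)" using C \<open>0 < \<sigma>\<close> by (intro mult_left_mono) auto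
      also have "\<dots> = \<sigma> * X" by (simp only: X_def mult_ac)
      also have "\<dots> = \<epsilon>" using pos by (simp add: \<sigma>_def)
      finally show ?thesis .
    qed
    ultimately have "?I \<le> ennreal \<epsilon>"
      using \<open>\<And>\<sigma>. 0 < \<sigma> \<Longrightarrow> ?I \<le> ennreal ((2 + C) * \<sigma> * ?m)\<close>[of \<sigma>] by (meson ennreal_leI order_trans)
    then show ?thesis by simp
  qed
  then have I0: "?I = 0" using ennreal_le_epsilon[of 0 ?I] by (simp add: le_zero_eq)
  have cF: "continuous_on B (\<lambda>x. F (x + e) - F x)"
  proof (intro continuous_on_diff)
    show "continuous_on B F" using BB' B'(2) by (intro continuous_on_subset[OF O(2)]) auto
    show "continuous_on B (\<lambda>x. F (x + e))"
      by (rule continuous_on_compose2[OF O(2)]) (use sweep[where \<tau> = 1] B'(2) in \<open>auto intro!: continuous_intros\<close>)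
  qed
  define \<psi> where "\<psi> x = indicator B x *\<^sub>R (F (x + e) - F x)" for x
  have eqI: "ennreal \<bar>F (x + e) - F x\<bar> * indicator B x = ennreal \<bar>\<psi> x\<bar>" for x
    by (auto simp: \<psi>_def indicator_def)
  have "\<psi> \<in> borel_measurable borel"
    unfolding \<psi>_def[abs_def] using B cF by (intro borel_measurable_continuous_on_indicator) auto
  then have "(\<lambda>x. ennreal \<bar>\<psi> x\<bar>) \<in> borel_measurable lebesgue"
    by (intro measurable_completion) measurable
  then have "AE x in lebesgue. ennreal \<bar>\<psi> x\<bar> = 0"
    using I0 unfolding eqI by (subst (asm) nn_integral_0_iff_AE) auto
  then have ae: "AE x in lebesgue. x \<notin> {x \<in> B. F (x + e) - F x \<in> - {0}}"
    by eventually_elim (auto simp: \<psi>_def)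
  have "open {x \<in> B. F (x + e) - F x \<in> - {0}}"
  proof -
    have "open (B \<inter> (\<lambda>x. F (x + e) - F x) -` (- {0}))"
      by (rule continuous_open_preimage[OF cF B]) auto
    then show ?thesis by (simp only: vimage_def Int_def mem_Collect_eq)
  qed
  moreover have "negligible {x \<in> B. F (x + e) - F x \<in> - {0}}"
    using null_sets_lebesgue_if_AE[OF ae] by (simp add: negligible_iff_null_sets)
  ultimately have "{x \<in> B. F (x + e) - F x \<in> - {0}} = {}" using open_not_negligible by blast
  then show ?thesis using z by auto
qed

text \<open>Coordinates are exchanged one at a time. The intermediate points mix coordinates of
  \<open>x\<close> and \<open>y\<close>, so they are no farther from \<open>x\<close> than
  \<open>y\<close> is and remain in the ball.\<close>

lemma constant_on_if_axis_increments_zero: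
  fixes F :: "real^'n \<Rightarrow> 'b"
  assumes V: "connected V"
    and inc: "\<And>x. x \<in> V \<Longrightarrow> \<exists>r>0. \<forall>z\<in>ball x r. \<forall>j t. \<bar>t\<bar> \<le> r \<longrightarrow> F (z + t *\<^sub>R axis j 1) = F z"
  shows "F constant_on V"
proof (rule locally_constant_imp_constant[OF V])
  fix x assume "x \<in> V"
  then obtain r where r: "0 < r" "\<And>z j t. z \<in> ball x r \<Longrightarrow> \<bar>t\<bar> \<le> r \<Longrightarrow> F (z + t *\<^sub>R axis j 1) = F z"
    using inc by meson
  have "F y = F x" if y: "y \<in> ball x r" for y
  proof -
    define z where "z J = (\<chi> i. if i \<in> J then y $ i else x $ i)" for J
    have zb: "z J \<in> ball x r" for J
    proof -
      have "norm (z J - x) \<le> norm (y - x)"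
        by (rule norm_le_componentwise_cart) (auto simp: z_def)
      then show ?thesis using y by (simp add: dist_norm norm_minus_commute)
    qed
    have "F (z J) = F x" if "finite J" for J
      using that
    proof (induction J)
      case empty
      show ?case by (simp add: z_def)
    next
      case (insert j J)
      have "z (insert j J) = z J + (y $ j - x $ j) *\<^sub>R axis j 1"
        using insert(2) by (auto simp: z_def vec_eq_iff axis_def)
      moreover have "\<bar>y $ j - x $ j\<bar> \<le> r"
        using component_le_norm_cart[of "y - x" j] y by (simp add: dist_norm norm_minus_commute)
      ultimately show ?case using r(2)[OF zb] insert.IH by metis
    qed
    from this[of UNIV] show ?thesis by (simp add: z_def)
  qed
  then have "\<forall>y\<in>V \<inter> ball x r. F y = F x" by blast
  moreover have "openin (top_of_set V) (V \<inter> ball x r)" by (rule openin_open_Int[OF open_ball])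
  moreover have "x \<in> V \<inter> ball x r" using r(1) \<open>x \<in> V\<close> by simp
  ultimately show "\<exists>T. openin (top_of_set V) T \<and> x \<in> T \<and> (\<forall>y\<in>T. F y = F x)" by blast
qed

section \<open>Cutoffs from zero capacity, vanishing gradient and constancy\<close>

context riem_poly
begin

text \<open>A competitor \<open>u\<close> of energy below \<epsilon> is approximated by a Lipschitz
  function within \<epsilon> in squared Sobolev norm: twice the energy of \<open>u\<close> plus
  twice the error gives \<open>4 * \<epsilon>\<close>. Since \<open>u = 1\<close> near
  \<open>D\<close>, the same error bounds the squared L2 distance to 1 on \<open>D\<close>.\<close>

lemma capacity_zero_cutoff:
  assumes par: "two_parabolic P UNIV" and D: "compact D" and \<epsilon>: "0 < \<epsilon>"
  obtains \<eta> where "\<eta> \<in> lip_c P UNIV"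
    "(\<integral>\<^sup>+q. ennreal (gsq q (grad P \<eta> q)) \<partial>vol P) \<le> ennreal (4 * \<epsilon>)"
    "(\<integral>\<^sup>+q. ennreal ((\<eta> (pt P q) - 1)\<^sup>2) \<partial>vol_on P D) \<le> ennreal \<epsilon>"
proof -
  let ?M = "vol_on P UNIV"
  define A where "A = {(u, G). has_grad0 P UNIV u G \<and> (AE q in ?M. u (pt P q) \<le> 1) \<and>
    (\<exists>V. open V \<and> D \<subseteq> V \<and> V \<subseteq> UNIV \<and> (AE q in vol_on P V. u (pt P q) = 1))}"
  have "capacity P D UNIV = 0" using par D by (simp add: two_parabolic_def)
  then have "(INF (u, G)\<in>A. \<integral>\<^sup>+q. ennreal (gsq q (G q)) \<partial>?M) < ennreal \<epsilon>"
    unfolding capacity_def A_def[symmetric] using \<epsilon> by simp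
  then obtain p where p: "p \<in> A" "(case p of (u, G) \<Rightarrow> \<integral>\<^sup>+q. ennreal (gsq q (G q)) \<partial>?M) < ennreal \<epsilon>"
    unfolding INF_less_iff by (elim bexE)
  obtain u H where uH: "p = (u, H)" by (cases p)
  have u: "has_grad0 P UNIV u H" and exV: "\<exists>V. open V \<and> D \<subseteq> V \<and> V \<subseteq> UNIV \<and> (AE q in vol_on P V. u (pt P q) = 1)"
    and cap: "(\<integral>\<^sup>+q. ennreal (gsq q (H q)) \<partial>?M) < ennreal \<epsilon>"
    using p unfolding uH A_def by simp_all
  obtain V where V: "open V" "D \<subseteq> V" "AE q in vol_on P V. u (pt P q) = 1" using exV by (elim exE conjE)
  have um: "(\<lambda>q. u (pt P q)) \<in> borel_measurable ?M" and Hm: "H \<in> borel_measurable ?M"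
    using u by (auto simp: has_grad0_def sobolev_limit_def)
  obtain w where w: "\<And>k. w k \<in> lip_c P UNIV"
    "(\<lambda>k. sobolev_norm2 P UNIV (\<lambda>y. w k y - u y) (\<lambda>q. grad P (w k) q - H q)) \<longlonglongrightarrow> 0"
    using u unfolding has_grad0_def sobolev_limit_def by blast
  have "eventually (\<lambda>k. sobolev_norm2 P UNIV (\<lambda>y. w k y - u y) (\<lambda>q. grad P (w k) q - H q) < ennreal \<epsilon>) sequentially"
    using order_tendstoD(2)[OF w(2), of "ennreal \<epsilon>"] \<epsilon> by simp
  then obtain k where k: "sobolev_norm2 P UNIV (\<lambda>y. w k y - u y) (\<lambda>q. grad P (w k) q - H q) < ennreal \<epsilon>"
    by (auto simp: eventually_sequentially)
  define \<eta> where "\<eta> = w k"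
  have \<eta>: "\<eta> \<in> lip_c P UNIV" using w(1) by (simp add: \<eta>_def)
  then have \<eta>L: "\<eta> \<in> lipschitz_functions P UNIV" by (simp add: lip_c_def)
  let ?d = "\<lambda>q. gsq q (grad P \<eta> q - H q)"
  have sob: "(\<integral>\<^sup>+q. ennreal ((\<eta> (pt P q) - u (pt P q))\<^sup>2 + ?d q) \<partial>?M) < ennreal \<epsilon>"
    using k by (simp add: sobolev_norm2_def \<eta>_def)
  note gm_on = gm_measurable_on[of UNIV] and g\<eta> = grad_measurable[OF open_UNIV \<eta>L]
  have ell: "AE q in ?M. elliptic Lam (gm q)"
    unfolding AE_vol_on_iff[OF open_UNIV] using AE_gm by eventually_elim simp
  have dm: "?d \<in> borel_measurable ?M" and Hm2: "(\<lambda>q. gsq q (H q)) \<in> borel_measurable ?M"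
    by (intro ginner_measurable gm_on g\<eta> Hm borel_measurable_diff)+
  have "(\<integral>\<^sup>+q. ennreal (gsq q (grad P \<eta> q)) \<partial>vol P)
      = (\<integral>\<^sup>+q. ennreal (gsq q (grad P \<eta> q)) \<partial>?M)" by (simp add: nn_integral_vol_on_UNIV)
  also have "\<dots> \<le> (\<integral>\<^sup>+q. 2 * ennreal (?d q) + 2 * ennreal (gsq q (H q)) \<partial>?M)"
  proof (rule nn_integral_mono_AE)
    show "AE q in ?M. ennreal (gsq q (grad P \<eta> q)) \<le> 2 * ennreal (?d q) + 2 * ennreal (gsq q (H q))"
      using ell
    proof eventually_elim
      fix q assume q: "elliptic Lam (gm q)"
      have "ennreal (gsq q (grad P \<eta> q)) \<le> ennreal (2 * ?d q + 2 * gsq q (H q))"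
        by (rule ennreal_leI[OF ginner_add_le[OF q]])
      also have "\<dots> = 2 * ennreal (?d q) + 2 * ennreal (gsq q (H q))"
        using ginner_nonneg[OF q] by (simp add: ennreal_plus ennreal_mult)
      finally show "ennreal (gsq q (grad P \<eta> q)) \<le> 2 * ennreal (?d q) + 2 * ennreal (gsq q (H q))" .
    qed
  qed
  also have "\<dots> = 2 * (\<integral>\<^sup>+q. ennreal (?d q) \<partial>?M) + 2 * (\<integral>\<^sup>+q. ennreal (gsq q (H q)) \<partial>?M)"
    using dm Hm2 by (subst nn_integral_add) (auto simp: nn_integral_cmult)
  also have "\<dots> \<le> 2 * ennreal \<epsilon> + 2 * ennreal \<epsilon>"
  proof (intro add_mono mult_left_mono)
    have "(\<integral>\<^sup>+q. ennreal (?d q) \<partial>?M) \<le> (\<integral>\<^sup>+q. ennreal ((\<eta> (pt P q) - u (pt P q))\<^sup>2 + ?d q) \<partial>?M)"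
      by (intro nn_integral_mono ennreal_leI) simp
    then show "(\<integral>\<^sup>+q. ennreal (?d q) \<partial>?M) \<le> ennreal \<epsilon>" using sob by simp
  qed (use cap in auto)
  also have "\<dots> = ennreal (4 * \<epsilon>)"
  proof -
    have "2 * ennreal \<epsilon> = ennreal (2 * \<epsilon>)" using \<epsilon> by (simp add: ennreal_mult)
    then show ?thesis using \<epsilon> by (simp add: ennreal_plus[symmetric] del: ennreal_plus)
  qed
  finally have 1: "(\<integral>\<^sup>+q. ennreal (gsq q (grad P \<eta> q)) \<partial>vol P) \<le> ennreal (4 * \<epsilon>)" .
  have "(\<integral>\<^sup>+q. ennreal ((\<eta> (pt P q) - 1)\<^sup>2) \<partial>vol_on P D) \<le> (\<integral>\<^sup>+q. ennreal ((\<eta> (pt P q) - 1)\<^sup>2) \<partial>vol_on P V)"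
    using D V by (intro nn_integral_vol_on_le) (auto intro: compact_imp_closed)
  also have "\<dots> = (\<integral>\<^sup>+q. ennreal ((\<eta> (pt P q) - u (pt P q))\<^sup>2) \<partial>vol_on P V)"
    using V(3) by (intro nn_integral_cong_AE) (auto elim!: eventually_mono)
  also have "\<dots> \<le> (\<integral>\<^sup>+q. ennreal ((\<eta> (pt P q) - u (pt P q))\<^sup>2) \<partial>?M)"
    using V by (intro nn_integral_vol_on_le) auto
  also have "\<dots> \<le> (\<integral>\<^sup>+q. ennreal ((\<eta> (pt P q) - u (pt P q))\<^sup>2 + ?d q) \<partial>?M)"
    using ell by (intro nn_integral_mono_AE) (auto elim!: eventually_mono intro!: ennreal_leI ginner_nonneg)
  finally have 2: "(\<integral>\<^sup>+q. ennreal ((\<eta> (pt P q) - 1)\<^sup>2) \<partial>vol_on P D) \<le> ennreal \<epsilon>" using sob by simp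
  from that[OF \<eta> 1 2] show ?thesis .
qed

lemma measurable_vol_on_subset:
  "X \<subseteq> U \<Longrightarrow> h \<in> borel_measurable (vol_on P U) \<Longrightarrow> h \<in> borel_measurable (vol_on P X)"
  by (erule measurable_restrict_mono) (auto simp: over_iff)

text \<open>\<open>caccioppoli\<close> makes the weighted energy on \<open>D\<close> tend to 0 along
  the cutoffs. By Fatou's lemma the limiting weighted energy is 0, and its weight is strictly
  positive.\<close>

proposition superharmonic_gradient_zero:
  assumes par: "two_parabolic P UNIV" and D: "compact D"
    and G: "has_grad_loc P f G" and f: "\<And>x. 0 < f x"
    and super: "\<And>\<rho>. \<rho> \<in> lip_c P UNIV \<Longrightarrow> (\<forall>x. 0 \<le> \<rho> x) \<Longrightarrow> 0 \<le> (\<integral>q. ginner P q (G q) (grad P \<rho> q) \<partial>vol P)"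
  shows "AE q in vol P. q \<in> over P D \<longrightarrow> G q = 0"
proof -
  let ?M = "vol_on P D"
  have cD: "closed D" using D by (rule compact_imp_closed)
  have ovD: "over P D \<inter> space (vol P) \<in> sets (vol P)" using over_closed_sets[OF cD] by auto
  define \<epsilon> where "\<epsilon> n = inverse (real (Suc n))" for n
  have "\<exists>\<eta>. \<eta> \<in> lip_c P UNIV \<and>
     (\<integral>\<^sup>+q. ennreal (gsq q (grad P \<eta> q)) \<partial>vol P) \<le> ennreal (4 * \<epsilon> n) \<and>
     (\<integral>\<^sup>+q. ennreal ((\<eta> (pt P q) - 1)\<^sup>2) \<partial>?M) \<le> ennreal (\<epsilon> n)" for n
    by (rule capacity_zero_cutoff[OF par D, of "\<epsilon> n"]) (auto simp: \<epsilon>_def)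
  then have "\<exists>\<eta>. \<forall>n. \<eta> n \<in> lip_c P UNIV \<and>
     (\<integral>\<^sup>+q. ennreal (gsq q (grad P (\<eta> n) q)) \<partial>vol P) \<le> ennreal (4 * \<epsilon> n) \<and>
     (\<integral>\<^sup>+q. ennreal ((\<eta> n (pt P q) - 1)\<^sup>2) \<partial>?M) \<le> ennreal (\<epsilon> n)"
    by (intro choice allI)
  then obtain \<eta> where all: "\<forall>n. \<eta> n \<in> lip_c P UNIV \<and>
     (\<integral>\<^sup>+q. ennreal (gsq q (grad P (\<eta> n) q)) \<partial>vol P) \<le> ennreal (4 * \<epsilon> n) \<and>
     (\<integral>\<^sup>+q. ennreal ((\<eta> n (pt P q) - 1)\<^sup>2) \<partial>?M) \<le> ennreal (\<epsilon> n)"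
    by (elim exE)
  have \<eta>: "\<And>n. \<eta> n \<in> lip_c P UNIV"
    "\<And>n. (\<integral>\<^sup>+q. ennreal (gsq q (grad P (\<eta> n) q)) \<partial>vol P) \<le> ennreal (4 * \<epsilon> n)"
    "\<And>n. (\<integral>\<^sup>+q. ennreal ((\<eta> n (pt P q) - 1)\<^sup>2) \<partial>?M) \<le> ennreal (\<epsilon> n)"
    using all by simp_all
  have \<epsilon>lim: "\<epsilon> \<longlonglongrightarrow> 0" unfolding \<epsilon>_def by (rule LIMSEQ_inverse_real_of_nat)
  have \<eta>m: "(\<lambda>q. \<eta> n (pt P q)) \<in> borel_measurable ?M" for n
    by (rule measurable_vol_on_subset[of D UNIV]) (use \<eta>(1) in \<open>auto simp: lip_c_def intro: lipschitz_measurable\<close>)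
  have sqm: "(\<lambda>q. (\<eta> n (pt P q) - 1)\<^sup>2) \<in> borel_measurable ?M" for n
    by (intro borel_measurable_power borel_measurable_diff \<eta>m borel_measurable_const)
  have "(\<lambda>n. ennreal (\<epsilon> n)) \<longlonglongrightarrow> ennreal 0" by (intro tendsto_ennrealI \<epsilon>lim)
  then have en: "(\<lambda>n. ennreal (\<epsilon> n)) \<longlonglongrightarrow> 0" by simp
  note L1 = L1_convergence_from_nn_integral[where g = "\<lambda>n q. (\<eta> n (pt P q) - 1)\<^sup>2", OF sqm _ \<eta>(3) _ en, simplified]
  obtain r where r: "strict_mono r" "AE q in ?M. (\<lambda>n. (\<eta> (r n) (pt P q) - 1)\<^sup>2) \<longlonglongrightarrow> 0"
    using tendsto_L1_AE_subseq[of ?M "\<lambda>n q. (\<eta> n (pt P q) - 1)\<^sup>2"] L1 by auto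
  \<comment> \<open>The domain must contain the support of the \<open>n\<close>-th cutoff and so
    depends on \<open>n\<close>; the constant in \<open>caccioppoli\<close> does not.\<close>
  have "\<exists>U. relatively_compact_domain U \<and> D \<union> closure {x. \<eta> n x \<noteq> 0} \<subseteq> U" for n
    using D \<eta>(1)[of n] by (intro compact_in_domain compact_Un) (auto simp: lip_c_def)
  then obtain U where U: "\<And>n. relatively_compact_domain (U n)" "\<And>n. D \<subseteq> U n" "\<And>n. closure {x. \<eta> n x \<noteq> 0} \<subseteq> U n"
    by (metis Un_subset_iff)
  have hg: "has_grad P (U n) f G" for n using G U(1) by (simp add: has_grad_loc_def)
  then have fm: "(\<lambda>q. f (pt P q)) \<in> borel_measurable ?M" and Gm: "G \<in> borel_measurable ?M"
    using measurable_vol_on_subset[OF U(2)[of 0]] by (auto simp: has_grad_def sobolev_limit_def)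
  define N where "N q = gsq q (G q)" for q
  have Nm: "N \<in> borel_measurable ?M" unfolding N_def[abs_def] by (intro ginner_measurable gm_measurable_on Gm)
  define b where "b n q = (sin (\<eta> (r n) (pt P q)))\<^sup>2 / (1 + (f (pt P q))\<^sup>2) * N q" for n q
  \<comment> \<open>Along the subsequence the cutoffs tend to 1 almost everywhere on
    \<open>D\<close>, which leaves the positive factor \<open>(sin 1)\<^sup>2\<close>.\<close>
  define b' where "b' q = (sin 1)\<^sup>2 / (1 + (f (pt P q))\<^sup>2) * N q" for q
  note [measurable] = fm \<eta>m Nm
  have bm: "b n \<in> borel_measurable ?M" for n unfolding b_def[abs_def] by measurable
  have b'm: "b' \<in> borel_measurable ?M" unfolding b'_def[abs_def] by measurable
  have b_le: "(\<integral>\<^sup>+q. ennreal (b n q) \<partial>?M) \<le> ennreal (64 * \<epsilon> n)" for n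
  proof -
    have oU: "open (U (r n))" using U(1) by (simp add: relatively_compact_domain_def)
    have "(\<integral>\<^sup>+q. ennreal (b n q) \<partial>?M) \<le> (\<integral>\<^sup>+q. ennreal (b n q) \<partial>vol_on P (U (r n)))"
      using oU cD U(2) by (intro nn_integral_vol_on_le) auto
    also have "\<dots> \<le> 16 * (\<integral>\<^sup>+q. ennreal (ginner P q (grad P (\<eta> (r n)) q) (grad P (\<eta> (r n)) q)) \<partial>vol P)"
      unfolding b_def N_def
    proof (rule caccioppoli[OF U(1) hg f super \<eta>(1) U(3)])
      show "(\<integral>\<^sup>+q. ennreal (ginner P q (grad P (\<eta> (r n)) q) (grad P (\<eta> (r n)) q)) \<partial>vol P) < \<infinity>"
        using \<eta>(2)[of "r n"] by (rule le_less_trans) simp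
    qed
    also have "\<dots> \<le> 16 * ennreal (4 * \<epsilon> (r n))" using \<eta>(2)[of "r n"] by (rule mult_left_mono) simp
    \<comment> \<open>The factor 16 of the energy inequality times the 4 of the cutoffs.\<close>
    also have "\<dots> = ennreal (64 * \<epsilon> (r n))"
      by (simp add: \<epsilon>_def ennreal_mult[symmetric] flip: ennreal_numeral)
    also have "\<dots> \<le> ennreal (64 * \<epsilon> n)"
      using seq_suble[OF r(1), of n] by (intro ennreal_leI) (simp add: \<epsilon>_def field_simps)
    finally show ?thesis .
  qed
  have blim: "AE q in ?M. (\<lambda>n. ennreal (b n q)) \<longlonglongrightarrow> ennreal (b' q)"
    using r(2)
  proof eventually_elim
    fix q assume "(\<lambda>n. (\<eta> (r n) (pt P q) - 1)\<^sup>2) \<longlonglongrightarrow> 0"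
    then have "(\<lambda>n. sqrt ((\<eta> (r n) (pt P q) - 1)\<^sup>2)) \<longlonglongrightarrow> sqrt 0" by (rule tendsto_real_sqrt)
    then have "(\<lambda>n. \<eta> (r n) (pt P q) - 1) \<longlonglongrightarrow> 0" by (simp add: tendsto_rabs_zero_iff)
    then have "(\<lambda>n. \<eta> (r n) (pt P q)) \<longlonglongrightarrow> 1" by (rule LIM_zero_cancel)
    then have "(\<lambda>n. b n q) \<longlonglongrightarrow> b' q"
      unfolding b_def b'_def divide_inverse by (intro tendsto_intros)
    then show "(\<lambda>n. ennreal (b n q)) \<longlonglongrightarrow> ennreal (b' q)" by (rule tendsto_ennrealI)
  qed
  have "(\<integral>\<^sup>+q. ennreal (b' q) \<partial>?M) = (\<integral>\<^sup>+q. liminf (\<lambda>n. ennreal (b n q)) \<partial>?M)"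
    using blim by (intro nn_integral_cong_AE) (auto elim!: eventually_mono simp: lim_imp_Liminf)
  also have "\<dots> \<le> liminf (\<lambda>n. \<integral>\<^sup>+q. ennreal (b n q) \<partial>?M)"
    by (rule nn_integral_liminf) (use bm in measurable)
  also have "\<dots> \<le> liminf (\<lambda>n. ennreal (64 * \<epsilon> n))"
    by (intro Liminf_mono always_eventually allI b_le)
  also have "\<dots> = 0"
  proof -
    have "(\<lambda>n. ennreal (64 * \<epsilon> n)) \<longlonglongrightarrow> ennreal (64 * 0)" by (intro tendsto_ennrealI tendsto_mult tendsto_const \<epsilon>lim)
    then show ?thesis by (simp add: lim_imp_Liminf)
  qed
  finally have "(\<integral>\<^sup>+q. ennreal (b' q) \<partial>?M) = 0" by simp
  then have "AE q in ?M. ennreal (b' q) = 0"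
    using b'm by (subst (asm) nn_integral_0_iff_AE) auto
  then have "AE q in vol P. q \<in> over P D \<longrightarrow> ennreal (b' q) = 0"
    by (subst (asm) AE_restrict_space_iff[OF ovD])
  then show ?thesis using AE_gm
  proof eventually_elim
    fix q assume q: "q \<in> over P D \<longrightarrow> ennreal (b' q) = 0" "elliptic Lam (gm q)"
    show "q \<in> over P D \<longrightarrow> G q = 0"
    proof
      assume "q \<in> over P D"
      then have "b' q \<le> 0" using q(1) by (simp add: ennreal_eq_0_iff)
      moreover have "0 < (sin (1::real))\<^sup>2 / (1 + (f (pt P q))\<^sup>2)"
        using sin_gt_zero_02[of 1] by (intro divide_pos_pos) (auto simp: add_pos_nonneg)
      ultimately have "N q \<le> 0" unfolding b'_def by (meson mult_pos_pos not_le)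
      then have "N q = 0" using ginner_nonneg[OF q(2), of "G q"] by (simp add: N_def)
      then show "G q = 0" using ginner_definite[OF q(2)] by (simp add: N_def)
    qed
  qed
qed

text \<open>The integrand of the Sobolev error serves as \<open>Q k\<close>: where \<open>G\<close>
  vanishes it controls both the distance of \<open>w k\<close> to \<open>f\<close> and the partial
  derivatives of \<open>w k\<close>. Continuity extends constancy from the interior to the closed
  simplex.\<close>

lemma constant_on_cell:
  assumes s: "s \<in> max_simplexes P" and f: "continuous_on UNIV f" and G: "has_grad_loc P f G"
    and G0: "AE q in vol P. q \<in> over P (closed_cell P s) \<longrightarrow> G q = 0"
  shows "f constant_on closed_cell P s"
proof -
  define F where "F x = f (pt P (s, x))" for x
  define I where "I = interior (S s)"
  have ptD: "pt P (s, x) \<in> closed_cell P s" if "x \<in> S s" for x using closed_cell_eq[OF s] that by auto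
  \<comment> \<open>A domain around the whole closed cell, so that \<open>W s U\<close> is the full
    interior of the simplex.\<close>
  obtain U where U: "relatively_compact_domain U" "closed_cell P s \<subseteq> U"
    using compact_in_domain[OF compact_closed_cell[OF s]] by blast
  have oU: "open U" using U(1) by (simp add: relatively_compact_domain_def)
  have WI: "W s U = I" using ptD U(2) interior_subset[of "S s"] by (auto simp: W_def I_def)
  have IS: "I \<subseteq> S s" unfolding I_def by (rule interior_subset)
  have G': "has_grad P U f G" using G U(1) by (simp add: has_grad_loc_def)
  obtain w where w: "\<And>k. w k \<in> lipschitz_functions P U"
    "(\<lambda>k. sobolev_norm2 P U (\<lambda>y. w k y - f y) (\<lambda>q. grad P (w k) q - G q)) \<longlonglongrightarrow> 0"
    using G' unfolding has_grad_def sobolev_limit_def by blast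
  have fm: "(\<lambda>q. f (pt P q)) \<in> borel_measurable (vol_on P U)" and Gm: "G \<in> borel_measurable (vol_on P U)"
    using G' by (auto simp: has_grad_def sobolev_limit_def)
  have cF: "continuous_on (S s) F"
    unfolding F_def by (rule continuous_on_compose2[OF f pt_continuous[OF s]]) auto
  define Qf where "Qf k q = (w k (pt P q) - f (pt P q))\<^sup>2 + gsq q (grad P (w k) q - G q)" for k q
  have Qfm: "Qf k \<in> borel_measurable (vol_on P U)" for k
    unfolding Qf_def[abs_def]
    by (intro borel_measurable_add borel_measurable_power borel_measurable_diff lipschitz_measurable[OF oU w(1)] fm
        ginner_measurable gm_measurable_on grad_measurable[OF oU w(1)] Gm)
  define Q where "Q k x = Qf k (s, x)" for k x
  have ovU: "over P U \<inter> space (vol P) \<in> sets (vol P)" using over_open_sets[OF oU] by auto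
  define H where "H k q = ennreal (Qf k q) * indicator (over P U) q" for k q
  have Hm: "H k \<in> borel_measurable (vol P)" for k
    unfolding H_def[abs_def] using Qfm
    by (subst borel_measurable_restrict_space_iff_ennreal[OF ovU, symmetric]) measurable
  have Hint: "(\<integral>\<^sup>+q. H k q \<partial>vol P) = sobolev_norm2 P U (\<lambda>y. w k y - f y) (\<lambda>q. grad P (w k) q - G q)" for k
    by (simp add: sobolev_norm2_def nn_integral_restrict_space[OF ovU] H_def Qf_def)
  have Hs: "H k (s, x) = ennreal (Q k x)" if "x \<in> S s" for k x
  proof -
    have "(s, x) \<in> over P U" using that s ptD[OF that] U(2) unfolding over_iff by blast
    then show ?thesis by (simp add: H_def Q_def)
  qed
  have Hsm: "(\<lambda>x. H k (s, x) * indicator (S s) x) \<in> borel_measurable lebesgue" for k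
  proof -
    have "(\<lambda>x. H k (s, x)) \<in> borel_measurable (lebesgue_on (S s))"
      by (rule measurable_compose[OF vol_slice_measurable[OF s] Hm])
    then show ?thesis using S_lebesgue[OF s] by (simp add: borel_measurable_restrict_space_iff_ennreal)
  qed
  obtain L where L: "\<And>k. (L k)-lipschitz_on I (\<lambda>x. w k (pt P (s, x)))"
  proof -
    have "\<exists>L. L-lipschitz_on I (\<lambda>x. w k (pt P (s, x)))" for k
    proof -
      obtain L where "\<And>s. s \<in> max_simplexes P \<Longrightarrow> L-lipschitz_on (W s U) (\<lambda>x. w k (pt P (s, x)))"
        using lipschitz_functions_slice[OF w(1)] by blast
      from this[OF s] show ?thesis unfolding WI by blast
    qed
    then show ?thesis using that by metis
  qed
  have "\<exists>g N. g \<in> borel_measurable borel \<and> negligible N \<and>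
    (\<forall>x\<in>I - N. has_partials (w k) (s, x) \<and> dvec (w k) (s, x) = g x)" for k
    by (rule partials_slice[OF oU w(1) s, of k]) (unfold WI, blast)
  then obtain g N where g: "\<And>k. g k \<in> borel_measurable borel" "\<And>k. negligible (N k)"
    "\<And>k x. x \<in> I - N k \<Longrightarrow> has_partials (w k) (s, x) \<and> dvec (w k) (s, x) = g k x"
    by metis
  have ell: "AE x in lebesgue. x \<in> S s \<longrightarrow> elliptic Lam (gm (s, x))" using AE_gm s by (simp add: AE_vol_iff)
  have G0s: "AE x in lebesgue. x \<in> S s \<longrightarrow> G (s, x) = 0"
  proof -
    have "AE x in lebesgue. x \<in> S s \<longrightarrow> (s, x) \<in> over P (closed_cell P s) \<longrightarrow> G (s, x) = 0"
      using G0 s by (simp add: AE_vol_iff)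
    then show ?thesis by eventually_elim (use s ptD in \<open>auto simp: over_iff\<close>)
  qed
  \<comment> \<open>A step of length at most \<open>r\<close> from the ball of radius
    \<open>r\<close> ends in the ball of radius \<open>2 * r\<close>. The derivative along
    \<open>t *\<^sub>R axis j 1\<close> is \<open>t\<close> times a partial derivative, whence the
    constant \<open>Lam * r\<close>.\<close>
  have inc: "F (z + t *\<^sub>R axis j 1) = F z"
    if r: "0 < r" "cball x (2 * r) \<subseteq> I" and z: "z \<in> ball x r" and t: "\<bar>t\<bar> \<le> r" for x r z j t
  proof (rule zero_gradient_translation[where V = I and B = "ball x r" and B' = "cball x (2 * r)"
        and w = "\<lambda>k x. w k (pt P (s, x))" and L = L and g = "\<lambda>k x. g k x $ j * t" and Q = Q and C = "Lam * r"])
    have B'S: "cball x (2 * r) \<subseteq> S s" using r(2) IS by auto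
    show "open I" by (simp add: I_def)
    show "continuous_on I F" by (rule continuous_on_subset[OF cF IS])
    show "y + \<tau> *\<^sub>R t *\<^sub>R axis j 1 \<in> cball x (2 * r)" if y: "y \<in> ball x r" "0 \<le> \<tau>" "\<tau> \<le> 1" for y \<tau>
    proof -
      have "norm (\<tau> *\<^sub>R t *\<^sub>R axis j (1::real) :: real^'n) = \<tau> * \<bar>t\<bar>" using y by (simp add: abs_mult)
      also have "\<dots> \<le> 1 * r" using y t by (intro mult_mono) auto
      finally have "dist x (y + \<tau> *\<^sub>R t *\<^sub>R axis j 1) \<le> dist x y + r"
        using norm_triangle_ineq4[of "x - y" "\<tau> *\<^sub>R t *\<^sub>R axis j 1"] by (simp add: dist_norm algebra_simps)
      then show ?thesis using y(1) by simp
    qed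
    show "(\<lambda>x. g k x $ j * t) \<in> borel_measurable lebesgue" for k
    proof (rule measurable_completion)
      have "(\<lambda>x. g k x $ j) \<in> borel_measurable borel"
        by (rule measurable_compose[OF g(1)]) (intro borel_measurable_continuous_onI continuous_intros)
      then show "(\<lambda>x. g k x $ j * t) \<in> borel_measurable lborel" by simp
    qed
    have Nk: "AE x in lebesgue. x \<notin> N k" for k using g(2) by (intro AE_not_in) (simp add: negligible_iff_null_sets[symmetric])
    show "AE y in lebesgue. y \<in> cball x (2 * r) \<longrightarrow>
        ((\<lambda>\<tau>. w k (pt P (s, y + \<tau> *\<^sub>R t *\<^sub>R axis j 1))) has_real_derivative g k y $ j * t) (at 0)" for k
      using Nk[of k]
    proof eventually_elim
      fix y assume yN: "y \<notin> N k"
      show "y \<in> cball x (2 * r) \<longrightarrow>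
        ((\<lambda>\<tau>. w k (pt P (s, y + \<tau> *\<^sub>R t *\<^sub>R axis j 1))) has_real_derivative g k y $ j * t) (at 0)"
      proof
        assume "y \<in> cball x (2 * r)"
        then have "y \<in> I - N k" using r(2) yN by auto
        then have d: "((\<lambda>\<tau>. w k (pt P (s, y + \<tau> *\<^sub>R axis j 1))) has_real_derivative g k y $ j) (at (0 * t))"
          using g(3)[of y k] by (auto simp: has_partials_def)
        have "((\<lambda>\<tau>. w k (pt P (s, y + (\<tau> * t) *\<^sub>R axis j 1))) has_real_derivative g k y $ j * t) (at 0)"
          by (rule DERIV_chain2[where f = "\<lambda>\<tau>. w k (pt P (s, y + \<tau> *\<^sub>R axis j 1))" and g = "\<lambda>\<tau>. \<tau> * t", OF d])
            (auto intro!: derivative_eq_intros)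
        then show "((\<lambda>\<tau>. w k (pt P (s, y + \<tau> *\<^sub>R t *\<^sub>R axis j 1))) has_real_derivative g k y $ j * t) (at 0)" by simp
      qed
    qed
    have QH: "ennreal (Q k y) * indicator (cball x (2 * r)) y = H k (s, y) * indicator (S s) y * indicator (cball x (2 * r)) y" for k y
      using B'S Hs by (auto simp: indicator_def)
    show "(\<lambda>y. ennreal (Q k y) * indicator (cball x (2 * r)) y) \<in> borel_measurable lebesgue" for k
      unfolding QH by (intro borel_measurable_times_ennreal Hsm borel_measurable_indicator) simp
    show "AE y in lebesgue. y \<in> cball x (2 * r) \<longrightarrow> (w k (pt P (s, y)) - F y)\<^sup>2 \<le> Q k y \<and> (g k y $ j * t)\<^sup>2 \<le> (Lam * r)\<^sup>2 * Q k y" for k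
      using Nk[of k] ell G0s
    proof eventually_elim
      fix y assume y: "y \<notin> N k" "y \<in> S s \<longrightarrow> elliptic Lam (gm (s, y))" "y \<in> S s \<longrightarrow> G (s, y) = 0"
      show "y \<in> cball x (2 * r) \<longrightarrow> (w k (pt P (s, y)) - F y)\<^sup>2 \<le> Q k y \<and> (g k y $ j * t)\<^sup>2 \<le> (Lam * r)\<^sup>2 * Q k y"
      proof
        assume yB: "y \<in> cball x (2 * r)"
        then have yS: "y \<in> S s" and yI: "y \<in> I - N k" using B'S r(2) y(1) by auto
        have e: "elliptic Lam (gm (s, y))" and "G (s, y) = 0" using y yS by auto
        let ?D = "gsq (s, y) (grad P (w k) (s, y))"
        have Qeq: "Q k y = (w k (pt P (s, y)) - F y)\<^sup>2 + ?D"
          using \<open>G (s, y) = 0\<close> by (simp add: Q_def Qf_def F_def)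
        have D0: "0 \<le> ?D" by (rule ginner_nonneg[OF e])
        have "(g k y $ j)\<^sup>2 \<le> Lam\<^sup>2 * ?D" using dvec_le[OF e, of "w k" j] g(3)[OF yI] by simp
        moreover have "t\<^sup>2 \<le> r\<^sup>2" using t r(1) by (simp add: abs_le_square_iff[symmetric])
        ultimately have "(g k y $ j)\<^sup>2 * t\<^sup>2 \<le> (Lam\<^sup>2 * ?D) * r\<^sup>2" using D0 by (intro mult_mono) auto
        also have "\<dots> = (Lam * r)\<^sup>2 * ?D" by (simp add: power_mult_distrib mult_ac)
        also have "\<dots> \<le> (Lam * r)\<^sup>2 * Q k y" unfolding Qeq by (intro mult_left_mono) auto
        finally show "(w k (pt P (s, y)) - F y)\<^sup>2 \<le> Q k y \<and> (g k y $ j * t)\<^sup>2 \<le> (Lam * r)\<^sup>2 * Q k y"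
          using D0 by (simp add: Qeq power_mult_distrib)
      qed
    qed
    show "(\<lambda>k. \<integral>\<^sup>+y. ennreal (Q k y) * indicator (cball x (2 * r)) y \<partial>lebesgue) \<longlonglongrightarrow> 0"
    proof -
      \<comment> \<open>The Sobolev errors are measured by the volume, the translation argument by
        Lebesgue measure; the lower bound of the density relates them.\<close>
      obtain \<delta> where \<delta>: "0 < \<delta>" "\<And>g::real^'n^'n. elliptic Lam g \<Longrightarrow> \<delta> \<le> det g"
        using elliptic_det_lower[OF Lam(1)] by blast
      have c: "(\<integral>\<^sup>+x. H k (s, x) * indicator (S s) x \<partial>lebesgue) \<le> ennreal (1 / sqrt \<delta>) * (\<integral>\<^sup>+q. H k q \<partial>vol P)" for k
        by (rule integral_simplex_le[OF Hm s \<delta>])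
      have le: "(\<integral>\<^sup>+y. ennreal (Q k y) * indicator (cball x (2 * r)) y \<partial>lebesgue)
          \<le> ennreal (1 / sqrt \<delta>) * sobolev_norm2 P U (\<lambda>y. w k y - f y) (\<lambda>q. grad P (w k) q - G q)" for k
      proof -
        have "(\<integral>\<^sup>+y. ennreal (Q k y) * indicator (cball x (2 * r)) y \<partial>lebesgue)
            \<le> (\<integral>\<^sup>+x. H k (s, x) * indicator (S s) x \<partial>lebesgue)"
          unfolding QH by (intro nn_integral_mono) (auto simp: indicator_def)
        also note c
        finally show ?thesis unfolding Hint .
      qed
      have "(\<lambda>k. ennreal (1 / sqrt \<delta>) * sobolev_norm2 P U (\<lambda>y. w k y - f y) (\<lambda>q. grad P (w k) q - G q)) \<longlonglongrightarrow> ennreal (1 / sqrt \<delta>) * 0"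
        by (intro ennreal_tendsto_cmult w(2)) simp
      then have lim0: "(\<lambda>k. ennreal (1 / sqrt \<delta>) * sobolev_norm2 P U (\<lambda>y. w k y - f y) (\<lambda>q. grad P (w k) q - G q)) \<longlonglongrightarrow> 0" by simp
      show ?thesis by (rule tendsto_sandwich[OF _ _ tendsto_const lim0]) (auto simp: le)
    qed
  qed (use r z Lam(1) L in auto)
  have "F constant_on I"
  proof (rule constant_on_if_axis_increments_zero)
    show "connected I" unfolding I_def by (intro convex_connected convex_interior convex_S s)
    fix x assume "x \<in> I"
    then obtain r where r: "0 < r" "cball x r \<subseteq> I"
      using open_contains_cball[of I] by (auto simp: I_def)
    \<comment> \<open>The radius is halved because \<open>inc\<close> needs the closed ball of twice
      its radius inside the interior.\<close>
    then show "\<exists>r>0. \<forall>z\<in>ball x r. \<forall>j t. \<bar>t\<bar> \<le> r \<longrightarrow> F (z + t *\<^sub>R axis j 1) = F z"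
      using inc[of "r / 2" x] by (intro exI[of _ "r / 2"]) auto
  qed
  then obtain a where a: "\<And>x. x \<in> I \<Longrightarrow> F x = a" by (auto simp: constant_on_def)
  have "F x = a" if "x \<in> S s" for x
  proof (rule continuous_constant_on_closure[of I F a])
    show "continuous_on (closure I) F" "x \<in> closure I"
      using cF that closure_interior_S[OF s] by (simp_all add: I_def)
  qed (rule a)
  then show ?thesis
    unfolding closed_cell_eq[OF s, symmetric] constant_on_def by (auto simp: F_def)
qed

lemma constant_if_constant_on_cells:
  assumes "\<And>s. s \<in> max_simplexes P \<Longrightarrow> f constant_on closed_cell P s"
  shows "f constant_on (UNIV :: 'a set)"
proof (rule locally_constant_imp_constant)
  show "connected (UNIV :: 'a set)" using lipschitz_poly by (simp add: lipschitz_polyhedron_def)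
  fix x :: 'a
  obtain v where x: "x \<in> star v" using ex_star by blast
  \<comment> \<open>A maximal simplex above the support of \<open>y\<close> also contains the vertex
    \<open>v\<close>, so \<open>y\<close> and \<open>v\<close> share a closed cell on which
    \<open>f\<close> is constant.\<close>
  have to_vertex: "f y = f (tri P (indicator {v}))" if y: "y \<in> star v" for y
  proof -
    obtain s where s: "s \<in> max_simplexes P" "supp (bary P y) \<subseteq> s"
      using ex_max_simplex star_simplex(1)[OF y] by blast
    have "v \<in> s" using star_simplex(2)[OF y] s(2) by auto
    note vr = vertex_realization[OF max_simplexD[OF s(1)] this]
    have "tri P (bary P y) \<in> closed_cell P s"
      unfolding closed_cell_def using s(2) by (intro imageI) auto
    moreover have "tri P (indicator {v}) \<in> closed_cell P s"
      unfolding closed_cell_def using vr \<open>v \<in> s\<close> by (intro imageI) auto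
    ultimately show ?thesis using assms[OF s(1)] by (auto simp: constant_on_def)
  qed
  show "\<exists>T. openin (top_of_set UNIV) T \<and> x \<in> T \<and> (\<forall>y\<in>T. f y = f x)"
  proof (intro exI[of _ "star v"] conjI ballI)
    show "openin (top_of_set UNIV) (star v)" using open_star by simp
    show "f y = f x" if "y \<in> star v" for y using to_vertex[OF that] to_vertex[OF x] by simp
  qed (rule x)
qed

end

theorem proposition5p3:
  fixes P :: "('v, 'a::metric_space, 'e::euclidean_space, 'n::finite) triangulated_polyhedron"
    and f :: "'a \<Rightarrow> real"
  assumes "riemannian_polyhedron P"
    and "admissible P"
    and "polyhedron_boundary P = {}"
    and "two_parabolic P (UNIV :: 'a set)"
    and "f \<in> W12_loc P"
    and "\<forall>x. 0 < f x"
    and "continuous_on UNIV f"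
    and "weakly_superharmonic P f"
  shows "f constant_on (UNIV :: 'a set)"
proof -
  interpret riem_poly P by unfold_locales (rule assms(1))
  obtain G where G: "has_grad_loc P f G"
    and super: "\<And>\<rho>. \<rho> \<in> lip_c P UNIV \<Longrightarrow> (\<forall>x. 0 \<le> \<rho> x) \<Longrightarrow> 0 \<le> (\<integral>q. ginner P q (G q) (grad P \<rho> q) \<partial>vol P)"
    using assms(8) unfolding weakly_superharmonic_def by blast
  show ?thesis
  proof (rule constant_if_constant_on_cells)
    fix s assume s: "s \<in> max_simplexes P"
    have "AE q in vol P. q \<in> over P (closed_cell P s) \<longrightarrow> G q = 0"
      by (rule superharmonic_gradient_zero[OF assms(4) compact_closed_cell[OF s] G _ super]) (use assms(6) in auto)
    then show "f constant_on closed_cell P s" by (rule constant_on_cell[OF s assms(7) G])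
  qed
qed

end
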